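(* Let $g\in\mathrm{PGL}(V)$. (i) Let $V'\subsetneq V$ be a subspace and let $x\in\mathcal{P}_{V/V'}(\bar k)\subset\mathbf{P}_V(\bar k)$ be represented by $l:V_{\bar k}\twoheadrightarrow\bar k$, with induced map $\bar l:(V/V')_{\bar k}\to\bar k$. Then $g$ fixes $x$ if and only if $g$ is (represented by a matrix) of the form $$g=\begin{pmatrix}\ast&\ast\\0&S\end{pmatrix}$$ with respect to $V=V'\oplus V''$ for some complementary space $V''$ of $V'$, where the class of $S$ in $\mathrm{PGL}(V'')\cong\mathrm{PGL}(V/V')$ satisfies condition (F) with respect to $\bar l$. Every such $S$ is semi-simple. (ii) Let $\{0\}\ne V'\subset V$ be a subspace and let $x\in\mathcal{Q}_{V'}(\bar k)\subset\mathbf{Q}_V(\bar k)$ be represented by the reciprocal map $r:V\setminus\{0\}\to\bar k$; let $l':V'_{\bar k}\twoheadrightarrow\bar k$ be the $\bar k$-linear map with $l'(v)=\frac1{r(v)}$ for $v\in V'\setminus\{0\}$. Then $g$ fixes $x$ if and only if $g$ is of the form $$g=\begin{pmatrix}S&\ast\\0&\ast\end{pmatrix}$$ with respect to $V=V'\oplus V''$ for some complementary space $V''$ of $V'$, where the class of $S$ in $\mathrm{PGL}(V')$ satisfies condition (F) with respect to $l'$. Every such $S$ is semi-simple. (iii) Let $\mathcal{F}=(\{0\}\subsetneq V_r\subset\dots\subset V_0\subsetneq V)$ be a flag, put $V_{-1}=V$, $V_{r+1}=\{0\}$, and let $x\in\mathcal{B}_{\mathcal{F}}(\bar k)\subset\mathbf{B}_V(\bar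 k)$ be represented by $(l_W)_{\{0\}\neq W\subset V}$, with induced maps $\bar l_{V_{i-1}}:(V_{i-1}/V_i)_{\bar k}\to\bar k$ for $i=0,\dots,r+1$. Then $g$ fixes $x$ if and only if $g$ is of the block upper triangular form $$g=\begin{pmatrix}S_{r+1}&&&\ast\\&S_r&&\\&&\ddots&\\0&&&S_0\end{pmatrix}$$ with respect to $V=V_r\oplus V_r'\oplus\dots\oplus V_0'$ for some complementary spaces $V_{i-1}=V_i\oplus V_i'$, $i=0,\dots,r$, where for each $i=0,\dots,r+1$ the class of $S_i$ in $\mathrm{PGL}(V_{i-1}/V_i)$ (using $V_i'\cong V_{i-1}/V_i$ for $i\le r$ and $V_r= V_r/V_{r+1}$ for $i=r+1$) satisfies condition (F) with respect to $\bar l_{V_{i-1}}$. All such $S_i$ are semi-simple.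
   Context: Let $k=\mathbb{F}_q$ be a finite field, $\bar k$ an algebraic closure, $V$ a $k$-vector space of dimension $n+1\ge2$; $\mathrm{GL}(V)$, $\mathrm{PGL}(V)$ denote the groups of $k$-rational points; $W_{\bar k}=W\otimes_k\bar k$. Spaces and points. $\mathbf{P}_V=\mathrm{Proj}(\mathrm{Sym}\,V)$; its $\bar k$-points are the nonzero linear forms $l:V_{\bar k}\to\bar k$ up to $\bar k^\times$. $\mathbf{Q}_V=\mathrm{Proj}\,k[\frac1v\mid v\in V\setminus\{0\}]$ (subalgebra of $\mathrm{Frac}(\mathrm{Sym}\,V)$, $\deg\frac1v=1$); its $\bar k$-points are the not identically zero reciprocal maps $r:V\setminus\{0\}\to\bar k$ up to $\bar k^\times$, where $r$ is reciprocal if $r(\lambda v)=\lambda^{-1}r(v)$ for $\lambda\in k^\times$ and $r(v)r(v')=r(v+v')(r(v)+r(v'))$ whenever $v,v',v+v'\ne0$. $\mathbf{B}_V$ is the variety obtained from $\mathbf{P}_V$ by successively blowing up, for $i=0,1,\dots,n-1$, the strict transforms of all linear subspaces $\mathbf{P}_{V/V'}$ (zero locus of $V'\subsetneq V$) of dimension $i$; its $\bar k$-points are the families $(l_W:W_{\bar k}\twoheadrightarrow\bar k)_{\{0\}\ne W\subset V}$ of nonzero linear forms, each up to $\bar k^\times$, such that for all $\{0\}\ne W'\subset W$ the restriction $l_W|_{W'_{\bar k}}$ is a (possibly zero) scalar multiple of $l_{W'}$. Strata. $\mathcal{P}_{V/V'}=\mathbf{P}_{V/V'}\setminus\bigcup_{V'\subsetneq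 W\subsetneq V}\mathbf{P}_{V/W}$ for $V'\subsetneq V$. $\mathcal{Q}_{V'}=\mathbf{Q}_{V'}\setminus\bigcup_{\{0\}\ne W\subsetneq V'}\mathbf{Q}_W$ for $\{0\}\ne V'\subset V$, where $\mathbf{Q}_W\subset\mathbf{Q}_V$ is the closed subscheme defined by $(\frac1v\mid v\in V\setminus W)$. $\mathcal{B}_{\mathcal{F}}=\big(\bigcap_{W\in\mathcal{F}}D_W\big)\setminus\big(\bigcup_{W\notin\mathcal{F}}D_W\big)$, where $\{0\}\ne W\subsetneq V$ and $D_W\subset\mathbf{B}_V$ is the exceptional divisor arising from $\mathbf{P}_{V/W}$; for the trivial flag ($r=-1$) the empty intersection is $\mathbf{B}_V$. Flags consist of strictly decreasing subspaces $V\supsetneq V_0\supsetneq\dots\supsetneq V_r\supsetneq\{0\}$. Action. $\mathrm{PGL}(V)$ acts from the right: $l\cdot g=l\circ g$ on $\mathbf{P}_V(\bar k)$, $r\cdot g=r\circ g$ on $\mathbf{Q}_V(\bar k)$, and $(l_W)_W\cdot g=(l_{g(W)}\circ g|_{W_{\bar k}})_W$ on $\mathbf{B}_V(\bar k)$. Condition (F). Let $W\neq\{0\}$ be a finite-dimensional $k$-vector space, $m=\dim_kW$, and $l:W_{\bar k}\to\bar k$ a linear form with $l(w)\ne0$ for all $w\in W\setminus\{0\}$. Let $F$ be the Frobenius $\lambda\mapsto\lambda^q$ of $\bar k$, acting on $W_{\bar k}$ by $F(w\otimes\lambda)=w\otimes F(\lambda)$; put $l^{F^i}=F^{-i}\circ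 l\circ F^i\in W_{\bar k}^*$, and for a subspace $U\subset W_{\bar k}^*$ put $F^i(U)=\{u^{F^i}\mid u\in U\}$. Let $k_d\subset\bar k$ be the subfield of degree $d$ over $k$. An element $h\in\mathrm{PGL}(W)$ satisfies condition (F) with respect to $l$ if there is a $d\in\mathbb{N}$ with $d\mid m$ such that $\mathrm{span}(l,l^{F^d},l^{F^{2d}},\dots)=\mathrm{span}(l,l^{F^d},\dots,l^{F^{m-d}})=:U$, and a $\lambda\in k_d^\times$ such that the transpose $h^*\in\mathrm{PGL}(W_{\bar k}^* )$ (induced by $u\mapsto u\circ h$) is represented by a linear automorphism whose restriction to $F^i(U)$ is $F^{-i}(\lambda)\,\mathrm{id}$ for $i=0,\dots,d-1$. An element of $\mathrm{PGL}(W)$ is semi-simple if its representatives in $\mathrm{GL}(W)$ are diagonalizable over $\bar k$. *)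

theory Defs
  imports
    "Jordan_Normal_Form.VS_Connect"
    "HOL-Algebra.Algebraic_Closure_Type"
    "HOL-Algebra.Bij"
    "HOL-Library.Cardinality"
begin

text \<open>
  The finite field \<open>k = \<bbbF>\<^sub>q\<close> is a type \<open>'k\<close> of sort \<open>{field, finite}\<close>, so \<open>q = CARD('k)\<close>; its algebraic
  closure is the type \<open>'k alg_closure\<close>, with embedding \<open>to_ac\<close>.  Vector spaces are HOL-Algebra modules
  over \<open>class_ring\<close>, the field structure carried by the whole scalar type.  Functions between carriers
  are extensional throughout, so that equality of functions is equality on the carrier.
\<close>

section \<open>Linear algebra\<close>

abbreviation on :: "('f, 'v) module \<Rightarrow> 'v set \<Rightarrow> ('f, 'v) module" where
  "on V W \<equiv> V\<lparr>carrier := W\<rparr>"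

abbreviation lin_subspace :: "('f :: field, 'v) module \<Rightarrow> 'v set \<Rightarrow> bool" where
  "lin_subspace V W \<equiv> VectorSpace.subspace (class_ring :: 'f ring) W V"

definition quot :: "('f, 'v) module \<Rightarrow> 'v set \<Rightarrow> ('f, 'v set) module" where
  "quot M N =
    \<lparr>carrier = a_rcosets\<^bsub>M\<^esub> N, monoid.mult = (\<lambda>_ _. N), one = N, zero = N,
     add = (\<lambda>A B. A <+>\<^bsub>M\<^esub> B), module.smult = (\<lambda>c A. \<Union>x\<in>A. N +>\<^bsub>M\<^esub> (c \<odot>\<^bsub>M\<^esub> x))\<rparr>"

definition scalar_line :: "('f :: field, 'f) module" where
  "scalar_line = \<lparr>carrier = UNIV, monoid.mult = (*), one = 1, zero = 0, add = (+), module.smult = (*)\<rparr>"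

definition dual :: "('f :: field, 'v) module \<Rightarrow> ('f, 'v \<Rightarrow> 'f) module" where
  "dual M =
    \<lparr>carrier = LinearCombinations.module_hom class_ring M scalar_line \<inter> extensional (carrier M),
     monoid.mult = (\<lambda>_ _. \<lambda>x\<in>carrier M. 0), one = (\<lambda>x\<in>carrier M. 0), zero = (\<lambda>x\<in>carrier M. 0),
     add = (\<lambda>u u'. \<lambda>x\<in>carrier M. u x + u' x), module.smult = (\<lambda>c u. \<lambda>x\<in>carrier M. c * u x)\<rparr>"

definition GL :: "('f :: field, 'v) module \<Rightarrow> ('v \<Rightarrow> 'v) monoid" where
  "GL M = (BijGroup (carrier M))\<lparr>carrier := Bij (carrier M) \<inter> LinearCombinations.module_hom class_ring M M\<rparr>"

definition scalars :: "('f :: field, 'v) module \<Rightarrow> ('v \<Rightarrow> 'v) set" where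
  "scalars M = {\<lambda>x\<in>carrier M. c \<odot>\<^bsub>M\<^esub> x | c. c \<noteq> 0}"

text \<open>An element of \<open>PGL\<close> is the set of all its representatives in \<open>GL\<close>.\<close>

definition PGL :: "('f :: field, 'v) module \<Rightarrow> ('v \<Rightarrow> 'v) set monoid" where
  "PGL M = GL M Mod scalars M"

definition pgl_class :: "('f :: field, 'v) module \<Rightarrow> ('v \<Rightarrow> 'v) \<Rightarrow> ('v \<Rightarrow> 'v) set" where
  "pgl_class M f = scalars M #>\<^bsub>GL M\<^esub> f"

text \<open>The isomorphism \<open>PGL(M) \<cong> PGL(N)\<close> induced by an isomorphism \<open>\<phi> : M \<cong> N\<close>.\<close>

definition pgl_transport ::
  "('f, 'v) module \<Rightarrow> ('f, 'w) module \<Rightarrow> ('v \<Rightarrow> 'w) \<Rightarrow> ('v \<Rightarrow> 'v) set \<Rightarrow> ('w \<Rightarrow> 'w) set" where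
  "pgl_transport M N \<phi> h = {\<lambda>y\<in>carrier N. \<phi> (f (inv_into (carrier M) \<phi> y)) | f. f \<in> h}"

definition complement_in :: "('f :: field, 'v) module \<Rightarrow> 'v set \<Rightarrow> 'v set \<Rightarrow> 'v set \<Rightarrow> bool" where
  "complement_in V A B C \<longleftrightarrow>
     lin_subspace V C \<and> C \<subseteq> A \<and> B <+>\<^bsub>V\<^esub> C = A \<and> B \<inter> C = {\<zero>\<^bsub>V\<^esub>}"

section \<open>Extension of scalars\<close>

text \<open>
  Let \<open>K\<close> be the algebraic closure of \<open>k\<close>.  \<open>W \<otimes> K\<close> is the free \<open>K\<close>-vector space on the set \<open>W\<close> modulo the relations making \<open>w \<mapsto> [w]\<close> a
  \<open>k\<close>-linear map; \<open>w \<otimes> a\<close> is the class of \<open>a[w]\<close>.  All spaces \<open>W\<close> below are finite sets, so the free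
  vector space is the space of all functions on \<open>W\<close>.
\<close>

definition free_gen :: "('k :: field, 'w) module \<Rightarrow> 'w \<Rightarrow> 'k alg_closure \<Rightarrow> 'w \<Rightarrow> 'k alg_closure" where
  "free_gen W w a = (\<lambda>x\<in>carrier W. if x = w then a else 0)"

definition free_space :: "('k :: field, 'w) module \<Rightarrow> ('k alg_closure, 'w \<Rightarrow> 'k alg_closure) module" where
  "free_space W = ring.func_space class_ring (carrier W)"

definition tensor_relations :: "('k :: field, 'w) module \<Rightarrow> ('w \<Rightarrow> 'k alg_closure) set" where
  "tensor_relations W =
     {\<lambda>x\<in>carrier W. free_gen W (w \<oplus>\<^bsub>W\<^esub> w') 1 x - free_gen W w 1 x - free_gen W w' 1 x
       | w w'. w \<in> carrier W \<and> w' \<in> carrier W} \<union>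
     {\<lambda>x\<in>carrier W. free_gen W (c \<odot>\<^bsub>W\<^esub> w) 1 x - free_gen W w (to_ac c) x
       | c w. w \<in> carrier W}"

definition relation_span :: "('k :: field, 'w) module \<Rightarrow> ('w \<Rightarrow> 'k alg_closure) set" where
  "relation_span W =
     LinearCombinations.module.span class_ring (free_space W) (tensor_relations W)"

definition base_change ::
  "('k :: field, 'w) module \<Rightarrow> ('k alg_closure, ('w \<Rightarrow> 'k alg_closure) set) module" where
  "base_change W = quot (free_space W) (relation_span W)"

definition tensor ::
  "('k :: field, 'w) module \<Rightarrow> 'w \<Rightarrow> 'k alg_closure \<Rightarrow> ('w \<Rightarrow> 'k alg_closure) set" where
  "tensor W w a = relation_span W +>\<^bsub>free_space W\<^esub> free_gen W w a"

text \<open>\<open>T \<otimes> id : W \<otimes> K \<rightarrow> W' \<otimes> K\<close> for a \<open>k\<close>-linear map \<open>T : W \<rightarrow> W'\<close>\<close>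

definition base_change_map ::
  "('k :: field, 'w) module \<Rightarrow> ('k, 'x) module \<Rightarrow> ('w \<Rightarrow> 'x) \<Rightarrow>
     ('w \<Rightarrow> 'k alg_closure) set \<Rightarrow> ('x \<Rightarrow> 'k alg_closure) set" where
  "base_change_map W W' T =
     (THE f. f \<in> LinearCombinations.module_hom class_ring (base_change W) (base_change W') \<inter>
                 extensional (carrier (base_change W)) \<and>
             (\<forall>w\<in>carrier W. \<forall>a. f (tensor W w a) = tensor W' (T w) a))"

abbreviation forms ::
  "('k :: field, 'w) module \<Rightarrow> ('k alg_closure, ('w \<Rightarrow> 'k alg_closure) set \<Rightarrow> 'k alg_closure) module" where
  "forms W \<equiv> dual (base_change W)"

definition pull_form ::
  "('k :: field, 'w) module \<Rightarrow> ('k, 'x) module \<Rightarrow> ('w \<Rightarrow> 'x) \<Rightarrow>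
     (('x \<Rightarrow> 'k alg_closure) set \<Rightarrow> 'k alg_closure) \<Rightarrow>
     (('w \<Rightarrow> 'k alg_closure) set \<Rightarrow> 'k alg_closure)" where
  "pull_form W W' T l = compose (carrier (base_change W)) l (base_change_map W W' T)"

text \<open>The form on \<open>(W/B) \<otimes> K\<close> induced by a form on \<open>W \<otimes> K\<close> that vanishes on \<open>B\<close>\<close>

definition induced_form ::
  "('k :: field, 'w) module \<Rightarrow> 'w set \<Rightarrow> (('w \<Rightarrow> 'k alg_closure) set \<Rightarrow> 'k alg_closure) \<Rightarrow>
     (('w set \<Rightarrow> 'k alg_closure) set \<Rightarrow> 'k alg_closure)" where
  "induced_form W B l =
     (THE l'. l' \<in> carrier (forms (quot W B)) \<and> pull_form W (quot W B) (\<lambda>w. B +>\<^bsub>W\<^esub> w) l' = l)"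

section \<open>Condition (F) and semi-simplicity\<close>

definition frob :: "'k :: {field, finite} alg_closure \<Rightarrow> 'k alg_closure" where
  "frob x = x ^ CARD('k)"

definition frob_space ::
  "('k :: {field, finite}, 'w) module \<Rightarrow> ('w \<Rightarrow> 'k alg_closure) set \<Rightarrow> ('w \<Rightarrow> 'k alg_closure) set" where
  "frob_space W =
     (THE f. f \<in> extensional (carrier (base_change W)) \<and>
             f \<in> carrier (base_change W) \<rightarrow> carrier (base_change W) \<and>
             (\<forall>x\<in>carrier (base_change W). \<forall>y\<in>carrier (base_change W).
                f (x \<oplus>\<^bsub>base_change W\<^esub> y) = f x \<oplus>\<^bsub>base_change W\<^esub> f y) \<and>
             (\<forall>w\<in>carrier W. \<forall>a. f (tensor W w a) = tensor W w (frob a)))"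

text \<open>
  \<open>frob_twist W i l\<close> is the conjugate of \<open>l\<close> by the \<open>i\<close>-th power of Frobenius.  The inverse is written
  \<open>inv_into UNIV\<close> because \<open>inv\<close> is also the notation for inverses in HOL-Algebra groups.
\<close>

definition frob_twist ::
  "('k :: {field, finite}, 'w) module \<Rightarrow> nat \<Rightarrow> (('w \<Rightarrow> 'k alg_closure) set \<Rightarrow> 'k alg_closure) \<Rightarrow>
     (('w \<Rightarrow> 'k alg_closure) set \<Rightarrow> 'k alg_closure)" where
  "frob_twist W i l =
     (\<lambda>x\<in>carrier (base_change W). (inv_into UNIV frob ^^ i) (l ((frob_space W ^^ i) x)))"

definition subfield_of_degree :: "nat \<Rightarrow> 'k :: field alg_closure set" where
  "subfield_of_degree d =
     (THE E. subfield E class_ring \<and> range to_ac \<subseteq> E \<and> ring.dimension class_ring d (range to_ac) E)"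

definition pgl_transpose ::
  "('k :: field, 'w) module \<Rightarrow> ('w \<Rightarrow> 'w) set \<Rightarrow>
     ((('w \<Rightarrow> 'k alg_closure) set \<Rightarrow> 'k alg_closure) \<Rightarrow>
      (('w \<Rightarrow> 'k alg_closure) set \<Rightarrow> 'k alg_closure)) set" where
  "pgl_transpose W h =
     (\<Union>f\<in>h. pgl_class (forms W) (\<lambda>u\<in>carrier (forms W). pull_form W W f u))"

definition condition_F ::
  "('k :: {field, finite}, 'w) module \<Rightarrow> (('w \<Rightarrow> 'k alg_closure) set \<Rightarrow> 'k alg_closure) \<Rightarrow>
     ('w \<Rightarrow> 'w) set \<Rightarrow> bool" where
  "condition_F W l h \<longleftrightarrow>
     (\<exists>d U. let m = vectorspace.dim class_ring W;
                span = LinearCombinations.module.span class_ring (forms W)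
      in 0 < d \<and> d dvd m \<and>
         U = span {frob_twist W (j * d) l | j. True} \<and>
         U = span {frob_twist W (j * d) l | j. j * d \<le> m - d} \<and>
         (\<exists>a\<in>subfield_of_degree d - {0}. \<exists>\<phi>\<in>pgl_transpose W h.
            \<forall>i<d. \<forall>u\<in>frob_twist W i ` U. \<phi> u = (inv_into UNIV frob ^^ i) a \<odot>\<^bsub>forms W\<^esub> u))"

definition pgl_semisimple :: "('k :: field, 'w) module \<Rightarrow> ('w \<Rightarrow> 'w) set \<Rightarrow> bool" where
  "pgl_semisimple W h \<longleftrightarrow>
     (\<forall>f\<in>h. \<exists>E. vectorspace.basis class_ring (base_change W) E \<and>
        (\<forall>e\<in>E. \<exists>c. base_change_map W W f e = c \<odot>\<^bsub>base_change W\<^esub> e))"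

section \<open>The spaces, their strata and the action on geometric points\<close>

text \<open>
  A point is the set of all its representatives.  The right action of a class \<open>g\<close> in \<open>PGL(V)\<close> on a point
  is computed with all representatives of both at once; this set is again a point.
\<close>

definition P_class ::
  "('k :: field, 'v) module \<Rightarrow> (('v \<Rightarrow> 'k alg_closure) set \<Rightarrow> 'k alg_closure) \<Rightarrow>
     (('v \<Rightarrow> 'k alg_closure) set \<Rightarrow> 'k alg_closure) set" where
  "P_class V l = {c \<odot>\<^bsub>forms V\<^esub> l | c. c \<noteq> 0}"

definition P_points ::
  "('k :: field, 'v) module \<Rightarrow> (('v \<Rightarrow> 'k alg_closure) set \<Rightarrow> 'k alg_closure) set set" where
  "P_points V = {P_class V l | l. l \<in> carrier (forms V) \<and> l \<noteq> \<zero>\<^bsub>forms V\<^esub>}"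

definition P_locus ::
  "('k :: field, 'v) module \<Rightarrow> 'v set \<Rightarrow>
     (('v \<Rightarrow> 'k alg_closure) set \<Rightarrow> 'k alg_closure) set set" where
  "P_locus V V' = {x \<in> P_points V. \<forall>l\<in>x. \<forall>v\<in>V'. l (tensor V v 1) = 0}"

definition P_stratum ::
  "('k :: field, 'v) module \<Rightarrow> 'v set \<Rightarrow>
     (('v \<Rightarrow> 'k alg_closure) set \<Rightarrow> 'k alg_closure) set set" where
  "P_stratum V V' =
     P_locus V V' - \<Union> {P_locus V W | W. lin_subspace V W \<and> V' \<subset> W \<and> W \<subset> carrier V}"

definition P_act ::
  "('k :: field, 'v) module \<Rightarrow> (('v \<Rightarrow> 'k alg_closure) set \<Rightarrow> 'k alg_closure) set \<Rightarrow>
     ('v \<Rightarrow> 'v) set \<Rightarrow> (('v \<Rightarrow> 'k alg_closure) set \<Rightarrow> 'k alg_closure) set" where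
  "P_act V x g = {pull_form V V \<gamma> l | l \<gamma>. l \<in> x \<and> \<gamma> \<in> g}"

definition reciprocal :: "('k :: field, 'v) module \<Rightarrow> ('v \<Rightarrow> 'k alg_closure) \<Rightarrow> bool" where
  "reciprocal V r \<longleftrightarrow>
     r \<in> extensional (carrier V - {\<zero>\<^bsub>V\<^esub>}) \<and>
     (\<forall>c v. c \<noteq> 0 \<longrightarrow> v \<in> carrier V - {\<zero>\<^bsub>V\<^esub>} \<longrightarrow> r (c \<odot>\<^bsub>V\<^esub> v) = inverse (to_ac c) * r v) \<and>
     (\<forall>v\<in>carrier V - {\<zero>\<^bsub>V\<^esub>}. \<forall>v'\<in>carrier V - {\<zero>\<^bsub>V\<^esub>}. v \<oplus>\<^bsub>V\<^esub> v' \<noteq> \<zero>\<^bsub>V\<^esub> \<longrightarrow>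
        r v * r v' = r (v \<oplus>\<^bsub>V\<^esub> v') * (r v + r v'))"

definition Q_points :: "('k :: field, 'v) module \<Rightarrow> ('v \<Rightarrow> 'k alg_closure) set set" where
  "Q_points V =
     {{\<lambda>v\<in>carrier V - {\<zero>\<^bsub>V\<^esub>}. c * r v | c. c \<noteq> 0} | r.
        reciprocal V r \<and> (\<exists>v\<in>carrier V - {\<zero>\<^bsub>V\<^esub>}. r v \<noteq> 0)}"

definition Q_locus :: "('k :: field, 'v) module \<Rightarrow> 'v set \<Rightarrow> ('v \<Rightarrow> 'k alg_closure) set set" where
  "Q_locus V W = {x \<in> Q_points V. \<forall>r\<in>x. \<forall>v\<in>carrier V - W. r v = 0}"

definition Q_stratum :: "('k :: field, 'v) module \<Rightarrow> 'v set \<Rightarrow> ('v \<Rightarrow> 'k alg_closure) set set" where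
  "Q_stratum V V' =
     Q_locus V V' - \<Union> {Q_locus V W | W. lin_subspace V W \<and> W \<noteq> {\<zero>\<^bsub>V\<^esub>} \<and> W \<subset> V'}"

definition Q_act ::
  "('k :: field, 'v) module \<Rightarrow> ('v \<Rightarrow> 'k alg_closure) set \<Rightarrow> ('v \<Rightarrow> 'v) set \<Rightarrow>
     ('v \<Rightarrow> 'k alg_closure) set" where
  "Q_act V x g = {compose (carrier V - {\<zero>\<^bsub>V\<^esub>}) r \<gamma> | r \<gamma>. r \<in> x \<and> \<gamma> \<in> g}"

definition reciprocal_form ::
  "('k :: field, 'v) module \<Rightarrow> 'v set \<Rightarrow> ('v \<Rightarrow> 'k alg_closure) \<Rightarrow>
     (('v \<Rightarrow> 'k alg_closure) set \<Rightarrow> 'k alg_closure)" where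
  "reciprocal_form V V' r =
     (THE l'. l' \<in> carrier (forms (on V V')) \<and>
              (\<forall>v\<in>V' - {\<zero>\<^bsub>V\<^esub>}. l' (tensor (on V V') v 1) = 1 / r v))"

definition nonzero_subspaces :: "('k :: field, 'v) module \<Rightarrow> 'v set set" where
  "nonzero_subspaces V = {W. lin_subspace V W \<and> W \<noteq> {\<zero>\<^bsub>V\<^esub>}}"

type_synonym ('k, 'v) form_family = "'v set \<Rightarrow> ('v \<Rightarrow> 'k alg_closure) set \<Rightarrow> 'k alg_closure"

definition B_family :: "('k :: field, 'v) module \<Rightarrow> ('k, 'v) form_family \<Rightarrow> bool" where
  "B_family V l \<longleftrightarrow>
     l \<in> extensional (nonzero_subspaces V) \<and>
     (\<forall>W\<in>nonzero_subspaces V.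
        l W \<in> carrier (forms (on V W)) \<and> l W \<noteq> \<zero>\<^bsub>forms (on V W)\<^esub>) \<and>
     (\<forall>W\<in>nonzero_subspaces V. \<forall>W'\<in>nonzero_subspaces V. W' \<subseteq> W \<longrightarrow>
        (\<exists>c. pull_form (on V W') (on V W) (\<lambda>w. w) (l W) = c \<odot>\<^bsub>forms (on V W')\<^esub> l W'))"

definition B_class :: "('k :: field, 'v) module \<Rightarrow> ('k, 'v) form_family \<Rightarrow> ('k, 'v) form_family set" where
  "B_class V l =
     {\<lambda>W\<in>nonzero_subspaces V. c W \<odot>\<^bsub>forms (on V W)\<^esub> l W | c. \<forall>W\<in>nonzero_subspaces V. c W \<noteq> 0}"

definition B_points :: "('k :: field, 'v) module \<Rightarrow> ('k, 'v) form_family set set" where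
  "B_points V = {B_class V l | l. B_family V l}"

definition B_act ::
  "('k :: field, 'v) module \<Rightarrow> ('k, 'v) form_family set \<Rightarrow> ('v \<Rightarrow> 'v) set \<Rightarrow>
     ('k, 'v) form_family set" where
  "B_act V x g =
     {\<lambda>W\<in>nonzero_subspaces V. pull_form (on V W) (on V (\<gamma> ` W)) \<gamma> (l (\<gamma> ` W)) | l \<gamma>. l \<in> x \<and> \<gamma> \<in> g}"

text \<open>
  The geometric points of \<open>B\<^sub>V\<close> form a closed subset of the product of the projective spaces of the \<open>l\<^sub>W\<close>,
  and the blow-down to \<open>P\<^sub>V\<close> is \<open>(l\<^sub>W)\<^sub>W \<mapsto> l\<^sub>V\<close>.  The functions below are the polynomials in the coordinates
  of all \<open>l\<^sub>W\<close>.  They need not be multihomogeneous: the set of representatives of a set of points is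
  stable under independent rescaling of the \<open>l\<^sub>W\<close>, so all multihomogeneous components of a polynomial
  vanishing on it vanish on it as well, and the closure obtained is the Zariski closure in \<open>B\<^sub>V\<close>.
\<close>

inductive_set B_polynomials ::
  "('k :: field, 'v) module \<Rightarrow> (('k, 'v) form_family \<Rightarrow> 'k alg_closure) set" for V where
  const: "(\<lambda>l. c) \<in> B_polynomials V"
| coord: "W \<in> nonzero_subspaces V \<Longrightarrow> t \<in> carrier (base_change (on V W)) \<Longrightarrow>
            (\<lambda>l. l W t) \<in> B_polynomials V"
| add: "p \<in> B_polynomials V \<Longrightarrow> p' \<in> B_polynomials V \<Longrightarrow> (\<lambda>l. p l + p' l) \<in> B_polynomials V"
| mult: "p \<in> B_polynomials V \<Longrightarrow> p' \<in> B_polynomials V \<Longrightarrow> (\<lambda>l. p l * p' l) \<in> B_polynomials V"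

definition B_closure ::
  "('k :: field, 'v) module \<Rightarrow> ('k, 'v) form_family set set \<Rightarrow> ('k, 'v) form_family set set" where
  "B_closure V Z =
     {x \<in> B_points V. \<forall>p\<in>B_polynomials V. (\<forall>y\<in>Z. \<forall>l\<in>y. p l = 0) \<longrightarrow> (\<forall>l\<in>x. p l = 0)}"

definition blow_down ::
  "('k :: field, 'v) module \<Rightarrow> ('k, 'v) form_family set \<Rightarrow>
     (('v \<Rightarrow> 'k alg_closure) set \<Rightarrow> 'k alg_closure) set" where
  "blow_down V x = {l (carrier V) | l. l \<in> x}"

text \<open>
  \<open>P_stratum V W\<close> is the part of the centre \<open>P_locus V W\<close> outside all smaller centres.
  The exceptional divisor over the strict transform of the centre is a projective bundle over it, hence
  irreducible, and the divisor \<open>D\<^sub>W\<close> of \<open>B\<^sub>V\<close> arising from it is its strict transform under the later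
  blow-ups, hence the closure of its nonempty open part lying over that stratum.
\<close>

definition B_divisor :: "('k :: field, 'v) module \<Rightarrow> 'v set \<Rightarrow> ('k, 'v) form_family set set" where
  "B_divisor V W = B_closure V {x \<in> B_points V. blow_down V x \<in> P_stratum V W}"

definition B_stratum :: "('k :: field, 'v) module \<Rightarrow> 'v set set \<Rightarrow> ('k, 'v) form_family set set" where
  "B_stratum V \<F> =
     {x \<in> B_points V. (\<forall>W\<in>\<F>. x \<in> B_divisor V W) \<and>
        (\<forall>W\<in>nonzero_subspaces V. W \<subset> carrier V \<longrightarrow> W \<notin> \<F> \<longrightarrow> x \<notin> B_divisor V W)}"

text \<open>
  The flag \<open>V\<^sub>0 \<supset> \<dots> \<supset> V\<^sub>r\<close> is the list of its members, of length \<open>r + 1\<close> and empty for the trivial flag.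
  Entry \<open>i\<close> of \<open>flag_chain\<close> is \<open>V\<close> with index \<open>i - 1\<close>, for \<open>0 \<le> i \<le> r + 2\<close>.
\<close>

definition flag_chain :: "('k :: field, 'v) module \<Rightarrow> 'v set list \<Rightarrow> 'v set list" where
  "flag_chain V Fs = carrier V # Fs @ [{\<zero>\<^bsub>V\<^esub>}]"

definition is_flag :: "('k :: field, 'v) module \<Rightarrow> 'v set list \<Rightarrow> bool" where
  "is_flag V Fs \<longleftrightarrow>
     (\<forall>W\<in>set Fs. lin_subspace V W) \<and> sorted_wrt (\<lambda>A B. B \<subset> A) (flag_chain V Fs)"

text \<open>
  For \<open>A = B \<oplus> C\<close> and \<open>S\<close> in \<open>GL(C)\<close>: the class of \<open>S\<close>, carried over to \<open>PGL(A/B)\<close> along \<open>C \<cong> A/B\<close>,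
  satisfies (F) with respect to the form on \<open>A/B\<close> induced by \<open>l\<close>.
\<close>

definition condition_F_quot ::
  "('k :: {field, finite}, 'v) module \<Rightarrow> 'v set \<Rightarrow> 'v set \<Rightarrow> 'v set \<Rightarrow>
     (('v \<Rightarrow> 'k alg_closure) set \<Rightarrow> 'k alg_closure) \<Rightarrow> ('v \<Rightarrow> 'v) \<Rightarrow> bool" where
  "condition_F_quot V A B C l S \<longleftrightarrow>
     condition_F (quot (on V A) B) (induced_form (on V A) B l)
       (pgl_transport (on V C) (quot (on V A) B) (\<lambda>v. B +>\<^bsub>V\<^esub> v) (pgl_class (on V C) S))"

end

theory Submission
  imports Defs "HOL-Algebra.Embedded_Algebras" "HOL-Number_Theory.Cong"
begin

text \<open>Forms on W \<otimes> K are handled through \<open>val\<close>, their values on the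
  vectors w \<otimes> 1. By the universal property of base change these values are exactly the
  k-linear maps from W to K, and a Frobenius twist acts on them by inverse Frobenius. Spans of
  twists, restrictions and transposes thus become identities between elements of K.

  Condition (F) looks stronger than the eigenvector equation because it prescribes the transpose on
  every F^i(U). But twisting l \<circ> h = c l gives the eigenvalue F^{-i}(c) on the i-th twist of
  l, and twists by multiples of d fix c, so the eigenvalues on all F^i(U) are forced.

  For \<open>B\<^sub>V\<close> the obstacle is that a divisor is defined as a Zariski closure, so
  its points have to be approached from the open stratum. The curve is made polynomial in t: a
  polynomial in t that vanishes for all but finitely many t in an infinite field also vanishes at t
  = 0.\<close>

text \<open>
  All three parts reduce to one eigenvector equation.  If \<open>l\<close> is a form on \<open>W\<close> without nonzero rational zeros and
  \<open>h \<in> GL(W)\<close>, then \<open>[h]\<close> satisfies condition (F) if and only if \<open>l \<circ> h = c l\<close> for some \<open>c\<close>.  Indeed \<open>l\<close> identifies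
  \<open>W\<close> with a finite subgroup \<open>L\<close> of the algebraic closure, \<open>c\<close> lies in the field \<open>E = {e. e L \<subseteq> L}\<close>, and the degree
  \<open>d\<close> of \<open>E\<close> divides \<open>dim W\<close>; as \<open>L\<close> has dimension \<open>dim W / d\<close> over \<open>E\<close>, a polynomial in the \<open>d\<close>-th power of Frobenius of that
  degree annihilates \<open>L\<close>, which gives the equality of spans.  Since \<open>h\<close> acts on \<open>L\<close> as \<open>c\<close>, its order divides \<open>|E| - 1\<close>
  and it is semi-simple.

  Points of the strata are determined by forms on rational subspaces whose rational kernels are exactly known, so
  fixed points translate into eigenvector equations on the graded pieces of a flag.  For \<open>B\<^sub>V\<close> the point needed
  is that \<open>x \<in> D\<^sub>U\<close> if and only if \<open>l\<^bsub>U'\<^esub>\<close> vanishes on \<open>U \<inter> U'\<close> for every \<open>U'\<close> not contained in \<open>U\<close>.  The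
  condition is closed and holds over the open stratum; conversely, such a family is the limit at \<open>t = 0\<close> of
  a curve of families whose form on \<open>V\<close> has kernel exactly \<open>U\<close>.
\<close>

section \<open>Finite fields\<close>

lemma class_ring_ring: "ring (class_ring :: 'f :: field ring)"
  by (rule class_ring.ring_axioms)

lemma line_extension_class_ring_iff:
  "u \<in> ring.line_extension (class_ring :: 'f :: field ring) K a E \<longleftrightarrow> (\<exists>k\<in>K. \<exists>v\<in>E. u = k * a + v)"
  using ring.line_extension_mem_iff[OF class_ring_ring, of u K a E] by simp

lemma Span_class_ring_simps:
  "ring.Span (class_ring :: 'f :: field ring) K [] = {0}"
  "ring.Span (class_ring :: 'f :: field ring) K (a # as) =
     ring.line_extension class_ring K a (ring.Span class_ring K as)"
  by (simp_all add: ring.Span.simps[OF class_ring_ring])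

lemma subfield_class_ringI:
  fixes E :: "'f :: field set"
  assumes "1 \<in> E" and diff: "\<And>x y. x \<in> E \<Longrightarrow> y \<in> E \<Longrightarrow> x - y \<in> E"
    and mult: "\<And>x y. x \<in> E \<Longrightarrow> y \<in> E \<Longrightarrow> x * y \<in> E"
    and inv: "\<And>x. x \<in> E \<Longrightarrow> inverse x \<in> E"
  shows "subfield E (class_ring :: 'f ring)"
proof -
  have 0: "0 \<in> E" using diff[OF assms(1) assms(1)] by simp
  have neg: "- x \<in> E" if "x \<in> E" for x using diff[OF 0 that] by simp
  have add: "x + y \<in> E" if "x \<in> E" "y \<in> E" for x y
    using diff[OF that(1) neg[OF that(2)]] by simp
  show ?thesis
  proof (rule field.subfieldI'[OF class_field])
    show "subring E class_ring"
      by (rule ring.subringI[OF class_ring_ring]) (use assms(1) neg add mult in \<open>auto simp: class_ring_simps\<close>)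
    show "inv\<^bsub>class_ring\<^esub> k \<in> E" if "k \<in> E - {\<zero>\<^bsub>class_ring\<^esub>}" for k
      using that inv by (auto simp: class_ring_simps)
  qed
qed

lemma subfield_class_ringD:
  fixes E :: "'f :: field set"
  assumes "subfield E (class_ring :: 'f ring)"
  shows "0 \<in> E" "1 \<in> E" "\<And>x. x \<in> E \<Longrightarrow> - x \<in> E"
    "\<And>x y. x \<in> E \<Longrightarrow> y \<in> E \<Longrightarrow> x + y \<in> E" "\<And>x y. x \<in> E \<Longrightarrow> y \<in> E \<Longrightarrow> x * y \<in> E"
    "\<And>x. x \<in> E \<Longrightarrow> inverse x \<in> E"
proof -
  note s = subringE[OF subfieldE(1)[OF assms]]
  show "0 \<in> E" "1 \<in> E" "\<And>x. x \<in> E \<Longrightarrow> - x \<in> E"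
    "\<And>x y. x \<in> E \<Longrightarrow> y \<in> E \<Longrightarrow> x + y \<in> E" "\<And>x y. x \<in> E \<Longrightarrow> y \<in> E \<Longrightarrow> x * y \<in> E"
    using s(2,3,5,6,7) by (auto simp: class_ring_simps)
  show "inverse x \<in> E" if "x \<in> E" for x
    using ring.subfield_m_inv(1)[OF class_ring_ring assms, of x] that by (cases "x = 0") (auto simp: class_ring_simps)
qed

text \<open>Multiplication by a nonzero \<open>x\<close> is injective on the finite set
  \<open>E\<close>, hence onto, so it reaches 1.\<close>

lemma finite_subring_inverse:
  fixes E :: "'f :: field set"
  assumes "finite E" "1 \<in> E" "\<And>x y. x \<in> E \<Longrightarrow> y \<in> E \<Longrightarrow> x * y \<in> E" "x \<in> E"
  shows "inverse x \<in> E"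
proof (cases "x = 0")
  case False
  have "inj_on ((*) x) E" using False by (auto simp: inj_on_def)
  then have "(*) x ` E = E"
    using assms by (intro endo_inj_surj) auto
  then obtain y where "y \<in> E" "x * y = 1" using assms(2) by (metis imageE)
  then show ?thesis by (metis inverse_unique)
qed (use assms in auto)

text \<open>Multiplication by \<open>c\<close> permutes \<open>S\<close>, so the product of all
  elements of \<open>S\<close> is multiplied by \<open>c ^ card S\<close> and yet unchanged; being
  nonzero, it cancels.\<close>

lemma power_card_cancel:
  fixes c :: "'f :: field"
  assumes "finite S" "0 \<notin> S" "c \<noteq> 0" "\<And>x. x \<in> S \<Longrightarrow> c * x \<in> S"
  shows "c ^ card S = 1"
proof -
  have inj: "inj_on ((*) c) S" using assms by (auto simp: inj_on_def)
  then have im: "(*) c ` S = S" using assms by (intro endo_inj_surj) auto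
  have "(\<Prod>x\<in>S. x) = (\<Prod>x\<in>S. c * x)"
    by (subst (1) im[symmetric], subst prod.reindex[OF inj]) simp
  also have "\<dots> = c ^ card S * (\<Prod>x\<in>S. x)" by (simp add: prod.distrib)
  finally show ?thesis using assms by (auto simp: prod_zero_iff)
qed

lemma finite_subfield_power_card:
  fixes E :: "'f :: field set"
  assumes "subfield E (class_ring :: 'f ring)" "finite E" "x \<in> E"
  shows "x ^ card E = x" and "x \<noteq> 0 \<Longrightarrow> x ^ (card E - 1) = 1"
proof -
  note E = subfield_class_ringD[OF assms(1)]
  show *: "x ^ (card E - 1) = 1" if "x \<noteq> 0"
  proof -
    have "x ^ card (E - {0}) = 1"
      by (rule power_card_cancel) (use assms E that in auto)
    then show ?thesis using E(1) assms(2) by simp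
  qed
  have "card E = Suc (card E - 1)" using assms by (cases "card E") auto
  then have "x ^ card E = x * x ^ (card E - 1)" by (metis power_Suc)
  then show "x ^ card E = x" using * by (cases "x = 0") auto
qed

text \<open>Each step of the dimension adjoins a vector \<open>v\<close> outside \<open>M\<close>,
  and (k, u) \<mapsto> k v + u is then a bijection from \<open>E \<times> M\<close>. Two
  representations with different scalars would put \<open>v\<close> into \<open>M\<close>.\<close>

lemma card_eq_power_dimension:
  fixes E :: "'f :: field set"
  assumes "subfield E (class_ring :: 'f ring)" "finite E"
    and "ring.dimension (class_ring :: 'f ring) n E L"
  shows "finite L \<and> card L = card E ^ n"
proof -
  note E = subfield_class_ringD[OF assms(1)]
  have "ring.dimension class_ring n E L" by (rule assms(3))
  then show ?thesis using assms(1,2)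
  proof (induction n E L rule: ring.dimension.induct[OF class_ring_ring, consumes 1, case_names zero_dim Suc_dim])
    case (Suc_dim v M n E)
    note E = subfield_class_ringD[OF Suc_dim.prems(1)]
    note M = ring.space_subgroup_props[OF class_ring_ring Suc_dim.prems(1) Suc_dim.hyps(3)]
    have eq: "ring.line_extension class_ring E v M = (\<lambda>(k, u). k * v + u) ` (E \<times> M)"
    proof (rule Set.set_eqI)
      fix x show "(x \<in> ring.line_extension class_ring E v M) = (x \<in> (\<lambda>(k, u). k * v + u) ` (E \<times> M))"
        unfolding line_extension_class_ring_iff by force
    qed
    have "inj_on (\<lambda>(k, u). k * v + u) (E \<times> M)"
    proof (rule inj_onI, clarify)
      fix a b c d assume *: "a \<in> E" "b \<in> M" "c \<in> E" "d \<in> M" "a * v + b = c * v + d"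
      have "d - b \<in> M"
        using M(3)[OF *(4) M(4)[OF *(2)]] by (simp add: class_ring_simps)
      moreover have "(a - c) * v = d - b" using *(5) by (simp add: algebra_simps)
      moreover have "a - c \<in> E" using E(3,4) * by (metis diff_conv_add_uminus)
      ultimately have "a - c = 0"
        using M(6)[of "a - c" v] Suc_dim.hyps by (auto simp: class_ring_simps)
      then show "a = c \<and> b = d" using *(5) by simp
    qed
    then show ?case using Suc_dim eq by (auto simp: card_image card_cartesian_product)
  qed auto
qed

text \<open>A list of all elements of \<open>L\<close> is a spanning family, so finite dimension
  needs no construction of a basis.\<close>

lemma finite_subalgebra_dimension:
  fixes E :: "'f :: field set"
  assumes E: "subfield E (class_ring :: 'f ring)" and "finite L" "0 \<in> L"
    and add: "\<And>x y. x \<in> L \<Longrightarrow> y \<in> L \<Longrightarrow> x + y \<in> L"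
    and mult: "\<And>e x. e \<in> E \<Longrightarrow> x \<in> L \<Longrightarrow> e * x \<in> L"
  obtains n where "ring.dimension (class_ring :: 'f ring) n E L"
proof -
  obtain Us where Us: "set Us = L" using assms(2) finite_list by blast
  have neg: "- x \<in> L" if "x \<in> L" for x
    using mult[of "-1" x] subfield_class_ringD[OF E] that by auto
  have "subgroup L (add_monoid class_ring)"
  proof (rule subgroup.intro)
    show "inv\<^bsub>add_monoid class_ring\<^esub> x \<in> L" if "x \<in> L" for x
    proof -
      have "a_inv class_ring x \<in> L" using neg[OF that] by (simp only: class_ring_simps)
      then show ?thesis by (simp only: a_inv_def)
    qed
  qed (use assms in auto)
  then have "subalgebra E L class_ring"
    by (intro subalgebra.intro) (auto simp: subalgebra_axioms_def mult)
  then have "ring.Span class_ring E Us = L"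
    using ring.subalgebra_Span_incl[OF class_ring_ring E, of L Us] ring.Span_base_incl[OF class_ring_ring E, of Us] Us by auto
  then have "ring.finite_dimension class_ring E L"
    using ring.Span_finite_dimension[OF class_ring_ring E, of Us] by auto
  then show ?thesis using that unfolding ring.finite_dimension_def[OF class_ring_ring] by blast
qed

text \<open>This is the prime field. Subtraction is available because CHAR - 1 represents -1, and
  inverses come from finiteness.\<close>

lemma of_nat_range_subfield: "subfield (range of_nat) (class_ring :: 'f :: {field, finite} ring)"
proof (rule subfield_class_ringI)
  have CH: "CHAR('f) > 0" by (rule finite_imp_CHAR_pos) simp
  have m: "x * y \<in> range (of_nat :: nat \<Rightarrow> 'f)" if "x \<in> range of_nat" "y \<in> range of_nat" for x y :: 'f
    using that by (auto simp flip: of_nat_mult)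
  show m': "\<And>x y :: 'f. x \<in> range of_nat \<Longrightarrow> y \<in> range of_nat \<Longrightarrow> x * y \<in> range of_nat"
    by (rule m)
  have a: "x + y \<in> range (of_nat :: nat \<Rightarrow> 'f)" if "x \<in> range of_nat" "y \<in> range of_nat" for x y :: 'f
    using that by (auto simp flip: of_nat_add)
  have "of_nat (CHAR('f) - 1) = (-1 :: 'f)"
    using CH by (simp add: of_nat_diff)
  then have "(-1 :: 'f) \<in> range of_nat" by (metis rangeI)
  then show "x - y \<in> range of_nat" if "x \<in> range of_nat" "y \<in> range of_nat" for x y :: 'f
    using a[OF that(1) m[OF _ that(2)], of "-1"] by simp
  show "(1 :: 'f) \<in> range of_nat" by (metis of_nat_1 rangeI)
  show "inverse x \<in> range of_nat" if "x \<in> range of_nat" for x :: 'f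
    by (rule finite_subring_inverse) (use m that \<open>1 \<in> range of_nat\<close> in auto)
qed

text \<open>The field is a vector space over its prime field, whose elements are the residues modulo
  the characteristic. This makes q-th powers additive.\<close>

lemma card_finite_field_eq_CHAR_power:
  obtains n where "CARD('f :: {field, finite}) = CHAR('f) ^ n"
proof -
  obtain n where "ring.dimension class_ring n (range of_nat) (UNIV :: 'f set)"
    by (rule finite_subalgebra_dimension[OF of_nat_range_subfield, of "UNIV :: 'f set"]) auto
  from card_eq_power_dimension[OF of_nat_range_subfield _ this]
  have *: "CARD('f) = card (range (of_nat :: nat \<Rightarrow> 'f)) ^ n" by simp
  have CH: "CHAR('f) > 0" by (rule finite_imp_CHAR_pos) simp
  have "range (of_nat :: nat \<Rightarrow> 'f) = of_nat ` {..<CHAR('f)}"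
  proof
    show "range (of_nat :: nat \<Rightarrow> 'f) \<subseteq> of_nat ` {..<CHAR('f)}"
    proof clarify
      fix k
      have "(of_nat k :: 'f) = of_nat (k mod CHAR('f))"
        by (simp add: of_nat_eq_iff_cong_CHAR cong_def)
      then show "(of_nat k :: 'f) \<in> of_nat ` {..<CHAR('f)}" using CH by auto
    qed
  qed auto
  moreover have "inj_on (of_nat :: nat \<Rightarrow> 'f) {..<CHAR('f)}"
    by (auto simp: inj_on_def of_nat_eq_iff_cong_CHAR cong_def)
  ultimately have "card (range (of_nat :: nat \<Rightarrow> 'f)) = CHAR('f)" by (simp add: card_image)
  with * show ?thesis using that by simp
qed

section \<open>The Frobenius automorphism of the algebraic closure\<close>

lemma frob_add: "frob (x + y :: 'k :: {field, finite} alg_closure) = frob x + frob y"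
proof -
  obtain n where "CARD('k) = CHAR('k) ^ n" by (rule card_finite_field_eq_CHAR_power)
  moreover have "Factorial_Ring.prime CHAR('k)" by (rule prime_CHAR_semidom) (simp add: finite_imp_CHAR_pos)
  ultimately show ?thesis
    unfolding frob_def using freshmans_dream'[of "CARD('k)" n x y] by simp
qed

lemma frob_mult: "frob (x * y) = frob x * frob y"
  by (simp add: frob_def power_mult_distrib)

lemma card_field_gt_1: "1 < CARD('k :: {field, finite})"
  using card_mono[of "UNIV :: 'k set" "{0, 1}"] by simp

lemma frob_0 [simp]: "frob (0 :: 'k :: {field, finite} alg_closure) = 0"
  and frob_1 [simp]: "frob (1 :: 'k :: {field, finite} alg_closure) = 1"
  using card_field_gt_1[where 'k = 'k] by (simp_all add: frob_def)

lemma frob_minus: "frob (- x) = - frob (x :: 'k :: {field, finite} alg_closure)"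
  using frob_add[of x "- x"] by (simp add: eq_neg_iff_add_eq_0 add.commute)

lemma field_UNIV_subfield: "subfield UNIV (class_ring :: 'f :: field ring)"
  by (rule subfield_class_ringI) auto

lemma frob_to_ac [simp]: "frob (to_ac (c :: 'k :: {field, finite})) = to_ac c"
proof -
  have "c ^ CARD('k) = c"
    by (rule finite_subfield_power_card(1)[OF field_UNIV_subfield]) auto
  then show ?thesis unfolding frob_def by (metis to_ac_power)
qed

lemma bij_frob: "bij (frob :: 'k :: {field, finite} alg_closure \<Rightarrow> _)"
proof (rule bijI)
  show "inj (frob :: 'k alg_closure \<Rightarrow> _)"
  proof (rule injI)
    fix x y :: "'k alg_closure" assume "frob x = frob y"
    then have "frob (x - y) = 0"
      using frob_add[of x "- y"] by (simp add: frob_minus)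
    then show "x = y" by (simp add: frob_def)
  qed
  show "surj (frob :: 'k alg_closure \<Rightarrow> _)"
  proof (rule surjI)
    show "frob (SOME x. x ^ CARD('k) = y) = y" for y :: "'k alg_closure"
      unfolding frob_def by (rule someI_ex, rule nth_root_exists) (simp add: zero_less_card_finite)
  qed
qed

abbreviation ifrob :: "'k :: {field, finite} alg_closure \<Rightarrow> 'k alg_closure" where
  "ifrob \<equiv> inv_into UNIV frob"

lemma ifrob_frob [simp]: "ifrob (frob x) = x" and frob_ifrob [simp]: "frob (ifrob x) = x"
  by (simp_all add: bij_frob bij_is_inj bij_is_surj surj_f_inv_f)

lemma ifrob_add: "ifrob (x + y) = ifrob x + ifrob y"
  by (metis frob_add frob_ifrob ifrob_frob)

lemma ifrob_mult: "ifrob (x * y) = ifrob x * ifrob y"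
  by (metis frob_mult frob_ifrob ifrob_frob)

lemma ifrob_0 [simp]: "ifrob 0 = 0" and ifrob_to_ac [simp]: "ifrob (to_ac c) = to_ac c"
  by (metis frob_0 ifrob_frob, metis frob_to_ac ifrob_frob)

lemma ifrob_pow_add: "(ifrob ^^ i) (x + y) = (ifrob ^^ i) x + (ifrob ^^ i) y"
  and ifrob_pow_mult: "(ifrob ^^ i) (x * y) = (ifrob ^^ i) x * (ifrob ^^ i) y"
  and ifrob_pow_0 [simp]: "(ifrob ^^ i) 0 = 0"
  and ifrob_pow_to_ac [simp]: "(ifrob ^^ i) (to_ac c) = to_ac c"
  by (induction i) (simp_all add: ifrob_add ifrob_mult)

lemma frob_pow: "(frob ^^ d) (x :: 'k :: {field, finite} alg_closure) = x ^ (CARD('k) ^ d)"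
  by (induction d) (simp_all add: frob_def power_mult[symmetric] mult.commute)

lemma ifrob_pow_fixed:
  assumes "x ^ (CARD('k :: {field, finite}) ^ d) = (x :: 'k alg_closure)"
  shows "(ifrob ^^ d) x = x" "(ifrob ^^ (j * d)) x = x"
proof -
  have "(ifrob ^^ d) ((frob ^^ d) x) = x"
    by (induction d) (simp_all add: funpow_swap1[of ifrob])
  then show *: "(ifrob ^^ d) x = x" using assms by (simp add: frob_pow)
  show "(ifrob ^^ (j * d)) x = x"
    by (induction j) (simp_all add: funpow_add *)
qed

section \<open>Subfields of given degree and annihilating polynomials\<close>

lemma range_to_ac_subfield: "subfield (range to_ac) (class_ring :: 'k :: field alg_closure ring)"
proof (rule subfield_class_ringI)
  show "1 \<in> range to_ac" by (metis rangeI to_ac_1)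
  show "\<And>x y. x \<in> range to_ac \<Longrightarrow> y \<in> range to_ac \<Longrightarrow> x - y \<in> range to_ac"
    by (auto simp flip: to_ac_diff)
  show "\<And>x y. x \<in> range to_ac \<Longrightarrow> y \<in> range to_ac \<Longrightarrow> x * y \<in> range to_ac"
    by (auto simp flip: to_ac_mult)
  show "\<And>x. x \<in> range to_ac \<Longrightarrow> inverse x \<in> range to_ac"
    by (auto simp flip: to_ac_inverse)
qed

lemma card_range_to_ac: "card (range (to_ac :: 'k \<Rightarrow> _)) = CARD('k :: {field, finite})"
  by (simp add: card_image inj_to_ac)

text \<open>Every field of degree \<open>d\<close> over k has q^d elements, all of them roots of
  X^(q^d) - X. That polynomial has at most q^d roots, so all candidates coincide with its root
  set.\<close>

lemma subfield_of_degree_eqI: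
  fixes E :: "'k :: {field, finite} alg_closure set"
  assumes E: "subfield E class_ring" "range to_ac \<subseteq> E"
    "ring.dimension class_ring d (range to_ac) E" and "0 < d"
  shows "subfield_of_degree d = E"
  unfolding subfield_of_degree_def
proof (rule the_equality)
  let ?N = "CARD('k) ^ d"
  define p :: "'k alg_closure poly" where "p = Polynomial.monom 1 ?N - Polynomial.monom 1 1"
  have N: "1 < ?N" using card_field_gt_1[where 'k = 'k] assms(4) by (rule one_less_power)
  have p: "poly p x = x ^ ?N - x" for x by (simp add: p_def poly_monom)
  have "Polynomial.coeff p ?N = 1" using N by (simp add: p_def)
  then have p0: "p \<noteq> 0" by auto
  have "Polynomial.degree p \<le> ?N" using N by (auto simp: p_def intro!: degree_diff_le degree_monom_le[THEN order_trans])
  then have le: "card {x. poly p x = 0} \<le> ?N" using card_poly_roots_bound[OF p0] by linarith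
  have *: "M = {x. poly p x = 0}" if "subfield M class_ring \<and> range to_ac \<subseteq> M \<and> ring.dimension class_ring d (range to_ac) M" for M
  proof -
    have c: "finite M \<and> card M = ?N"
      using card_eq_power_dimension[OF range_to_ac_subfield, of d M] that by (simp add: card_range_to_ac)
    then have "M \<subseteq> {x. poly p x = 0}"
      using finite_subfield_power_card(1)[of M] that by (auto simp: p)
    then show ?thesis using c le by (intro card_seteq poly_roots_finite[OF p0]) auto
  qed
  show "subfield E class_ring \<and> range to_ac \<subseteq> E \<and> ring.dimension class_ring d (range to_ac) E" using E by simp
  show "M = E" if "subfield M class_ring \<and> range to_ac \<subseteq> M \<and> ring.dimension class_ring d (range to_ac) M" for M
    using *[OF that] * E by blast
qed

text \<open>The sum is a monic skew polynomial in \<open>G\<close>, built factor by factor: if A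
  kills the span of \<open>Us\<close>, then (G - c) A with a suitable c kills \<open>u\<close> as
  well. It still kills the span of \<open>Us\<close>, and it is \<open>E\<close>-linear because
  \<open>G\<close> fixes \<open>E\<close>, so it kills the enlarged span.\<close>

lemma Span_annihilator:
  fixes E :: "'f :: field set" and G :: "'f \<Rightarrow> 'f"
  assumes E: "subfield E class_ring" and G: "\<And>x y. G (x + y) = G x + G y" "\<And>x y. G (x * y) = G x * G y"
    and GE: "\<And>e. e \<in> E \<Longrightarrow> G e = e"
  shows "\<exists>b. b (length Us) = 1 \<and>
    (\<forall>x\<in>ring.Span class_ring E Us. (\<Sum>i\<le>length Us. b i * (G ^^ i) x) = 0)"
proof -
  have G0: "G 0 = 0" by (metis G(1) add_cancel_right_right)
  have Gm: "G (- x) = - G x" for x using G(1)[of x "- x"] G0 by (simp add: eq_neg_iff_add_eq_0 add.commute)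
  have Gs: "G (sum f A) = (\<Sum>i\<in>A. G (f i))" if "finite A" for f and A :: "nat set"
    using that by (induction A) (auto simp: G0 G)
  have Gi: "(G ^^ i) (x + y) = (G ^^ i) x + (G ^^ i) y" "(G ^^ i) (x * y) = (G ^^ i) x * (G ^^ i) y"
    "e \<in> E \<Longrightarrow> (G ^^ i) e = e" for i x y e
    by (induction i) (auto simp: G GE)
  show ?thesis
  proof (induction Us)
    case Nil
    show ?case by (rule exI[of _ "\<lambda>_. 1"]) (simp add: Span_class_ring_simps)
  next
    case (Cons u Us)
    let ?n = "length Us"
    obtain b where b: "b ?n = 1" "\<And>x. x \<in> ring.Span class_ring E Us \<Longrightarrow> (\<Sum>i\<le>?n. b i * (G ^^ i) x) = 0"
      using Cons by blast
    define A where "A x = (\<Sum>i\<le>?n. b i * (G ^^ i) x)" for x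
    define c where "c = G (A u) / A u"
    \<comment> \<open>Coefficients of (G - c) A: moving \<open>G\<close> past a coefficient applies
      \<open>G\<close> to it and raises the index by one.\<close>
    define b' where "b' i = (if i = 0 then 0 else G (b (i - 1))) - c * (if i \<le> ?n then b i else 0)" for i
    have A: "(\<Sum>i\<le>Suc ?n. b' i * (G ^^ i) x) = G (A x) - c * A x" for x
    proof -
      have "(\<Sum>i\<le>Suc ?n. (if i = 0 then 0 else G (b (i - 1))) * (G ^^ i) x) = G (A x)"
        unfolding A_def by (subst sum.atMost_Suc_shift) (simp add: Gs G)
      moreover have "(\<Sum>i\<le>Suc ?n. c * (if i \<le> ?n then b i else 0) * (G ^^ i) x) = c * A x"
        unfolding A_def by (simp add: sum_distrib_left mult.assoc)
      ultimately show ?thesis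
        unfolding b'_def by (simp only: left_diff_distrib sum_subtractf)
    qed
    \<comment> \<open>If \<open>A u = 0\<close>, division by zero makes \<open>c = 0\<close> and
      both terms vanish; otherwise \<open>c\<close> was chosen for this.\<close>
    have Au: "G (A u) - c * A u = 0" by (cases "A u = 0") (auto simp: c_def G0)
    have "(\<Sum>i\<le>Suc ?n. b' i * (G ^^ i) x) = 0" if "x \<in> ring.Span class_ring E (u # Us)" for x
    proof -
      from that obtain k v where x: "k \<in> E" "v \<in> ring.Span class_ring E Us" "x = k * u + v"
        unfolding Span_class_ring_simps line_extension_class_ring_iff by blast
      have "A x = k * A u + A v"
        using x by (simp add: A_def Gi sum.distrib sum_distrib_left algebra_simps)
      also have "A v = 0" using b(2)[OF x(2)] by (simp add: A_def)
      finally have "G (A x) - c * A x = k * (G (A u) - c * A u)"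
        using x(1) by (simp add: G GE algebra_simps)
      then show ?thesis using A Au by simp
    qed
    note kill = this
    have "b' (Suc ?n) = 1" using b(1) GE[OF subfield_class_ringD(2)[OF E]] by (simp add: b'_def)
    show ?case unfolding length_Cons
    proof (rule exI[of _ b'], rule conjI, rule \<open>b' (Suc ?n) = 1\<close>, rule ballI)
      fix x assume "x \<in> ring.Span class_ring E (u # Us)"
      then show "(\<Sum>i\<le>Suc ?n. b' i * (G ^^ i) x) = 0" by (rule kill)
    qed
  qed
qed

section \<open>Vector spaces\<close>

abbreviation lin_hom :: "('f :: field, 'v) module \<Rightarrow> ('f, 'w) module \<Rightarrow> ('v \<Rightarrow> 'w) set" where
  "lin_hom M N \<equiv> LinearCombinations.module_hom class_ring M N"

lemma lin_hom_iff:
  "f \<in> lin_hom M N \<longleftrightarrow> f \<in> carrier M \<rightarrow> carrier N \<and>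
     (\<forall>x\<in>carrier M. \<forall>y\<in>carrier M. f (x \<oplus>\<^bsub>M\<^esub> y) = f x \<oplus>\<^bsub>N\<^esub> f y) \<and>
     (\<forall>c. \<forall>x\<in>carrier M. f (c \<odot>\<^bsub>M\<^esub> x) = c \<odot>\<^bsub>N\<^esub> f x)"
  by (auto simp: LinearCombinations.module_hom_def)

text \<open>Vector spaces with all scalars of a type: the axioms are restated with the operations of
  the type instead of those of \<open>class_ring\<close>.\<close>

locale vsp =
  fixes W :: "('f :: field, 'w) module" (structure)
  assumes vs: "vectorspace (class_ring :: 'f ring) W"
begin

sublocale abelian_group W
  using vs unfolding vectorspace_def by (blast dest: Module.module.axioms(2))

lemma module: "Module.module (class_ring :: 'f ring) W"
  using vs by (simp add: vectorspace_def)

lemma smult_closed [simp, intro]: "x \<in> carrier W \<Longrightarrow> c \<odot> x \<in> carrier W"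
  and smult_l_distr: "x \<in> carrier W \<Longrightarrow> (a + b) \<odot> x = a \<odot> x \<oplus> b \<odot> x"
  and smult_r_distr: "x \<in> carrier W \<Longrightarrow> y \<in> carrier W \<Longrightarrow> a \<odot> (x \<oplus> y) = a \<odot> x \<oplus> a \<odot> y"
  and smult_smult: "x \<in> carrier W \<Longrightarrow> a \<odot> (b \<odot> x) = (a * b) \<odot> x"
  and smult_one [simp]: "x \<in> carrier W \<Longrightarrow> 1 \<odot> x = x"
  using Module.module.smult_closed[OF module] Module.module.smult_l_distr[OF module]
    Module.module.smult_r_distr[OF module] Module.module.smult_assoc1[OF module] Module.module.smult_one[OF module]
  by simp_all

lemma smult_0 [simp]: "x \<in> carrier W \<Longrightarrow> 0 \<odot> x = \<zero>"
  and smult_zero [simp]: "c \<odot> \<zero> = \<zero>"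
  using Module.module.smult_l_null[OF module] Module.module.smult_r_null[OF module] by simp_all

lemma smult_minus: "x \<in> carrier W \<Longrightarrow> (- c) \<odot> x = \<ominus> (c \<odot> x)"
  using smult_l_distr[of x "- c" c] by (simp add: minus_equality)

lemma smult_minus1: "x \<in> carrier W \<Longrightarrow> (- 1) \<odot> x = \<ominus> x"
  by (simp add: smult_minus)

lemma smult_cancel: "x \<in> carrier W \<Longrightarrow> c \<noteq> 0 \<Longrightarrow> c \<odot> x = y \<Longrightarrow> x = inverse c \<odot> y"
  by (auto simp: smult_smult)

lemma minus_smult1: "x \<in> carrier W \<Longrightarrow> y \<in> carrier W \<Longrightarrow> x \<ominus> y = x \<oplus> (- 1) \<odot> y"
  by (simp add: smult_minus1 minus_eq)

lemma minus_zero_iff: "x \<in> carrier W \<Longrightarrow> y \<in> carrier W \<Longrightarrow> x \<ominus> y = \<zero> \<longleftrightarrow> x = y"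
  by simp

lemma minus_add_cancel: "x \<in> carrier W \<Longrightarrow> y \<in> carrier W \<Longrightarrow> (x \<ominus> y) \<oplus> y = x"
  by (simp add: minus_eq a_assoc l_neg)

lemma add_minus_cancel: "x \<in> carrier W \<Longrightarrow> y \<in> carrier W \<Longrightarrow> (x \<oplus> y) \<ominus> y = x"
  by (simp add: minus_eq a_assoc r_neg)

text \<open>Serves uniqueness in direct sums: if b, b' lie in one summand and c, c' in the other,
  the common difference lies in their intersection.\<close>

lemma diff_eq_diff:
  assumes "b \<in> carrier W" "c \<in> carrier W" "b' \<in> carrier W" "c' \<in> carrier W" "b \<oplus> c = b' \<oplus> c'"
  shows "b \<ominus> b' = c' \<ominus> c"
proof -
  have "b = (b' \<oplus> c') \<ominus> c" using assms by (metis add_minus_cancel)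
  also have "\<dots> = (c' \<ominus> c) \<oplus> b'" using assms by (simp add: minus_eq a_ac)
  finally show ?thesis using assms by (simp add: add_minus_cancel)
qed

lemma subspace_iff:
  "lin_subspace W U \<longleftrightarrow> U \<subseteq> carrier W \<and> \<zero> \<in> U \<and> (\<forall>x\<in>U. \<forall>y\<in>U. x \<oplus> y \<in> U) \<and>
     (\<forall>c. \<forall>x\<in>U. c \<odot> x \<in> U)"
  using vs module by (auto simp: VectorSpace.subspace_def LinearCombinations.submodule_def)

lemma subspaceD:
  assumes "lin_subspace W U"
  shows "U \<subseteq> carrier W" "\<zero> \<in> U" "\<And>x y. x \<in> U \<Longrightarrow> y \<in> U \<Longrightarrow> x \<oplus> y \<in> U"
    "\<And>c x. x \<in> U \<Longrightarrow> c \<odot> x \<in> U" "\<And>x y. x \<in> U \<Longrightarrow> y \<in> U \<Longrightarrow> x \<ominus> y \<in> U" "\<And>x. x \<in> U \<Longrightarrow> x \<in> carrier W"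
proof -
  note * = assms[unfolded subspace_iff]
  then show "U \<subseteq> carrier W" "\<zero> \<in> U" "\<And>x y. x \<in> U \<Longrightarrow> y \<in> U \<Longrightarrow> x \<oplus> y \<in> U"
    "\<And>c x. x \<in> U \<Longrightarrow> c \<odot> x \<in> U" "\<And>x. x \<in> U \<Longrightarrow> x \<in> carrier W" by auto
  show "x \<ominus> y \<in> U" if "x \<in> U" "y \<in> U" for x y
    using * that by (subst minus_smult1) auto
qed

lemma vsp_on: "lin_subspace W U \<Longrightarrow> vsp (on W U)"
  by (intro vsp.intro vectorspace.subspace_is_vs[OF vs])

lemma subspace_on_iff:
  assumes "lin_subspace W A"
  shows "lin_subspace (on W A) U \<longleftrightarrow> lin_subspace W U \<and> U \<subseteq> A"
  using vsp.subspace_iff[OF vsp_on[OF assms], of U] subspaceD(1)[OF assms] subspace_iff[of U] by auto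

lemma subspace_carrier: "lin_subspace W (carrier W)" and subspace_zero: "lin_subspace W {\<zero>}"
  by (auto simp: subspace_iff)

lemma minus_on:
  assumes U: "lin_subspace W U" and "x \<in> U" "y \<in> U"
  shows "x \<ominus>\<^bsub>on W U\<^esub> y = x \<ominus> y"
proof -
  interpret O: vsp "on W U" by (rule vsp_on[OF U])
  show ?thesis using O.minus_smult1[of x y] minus_smult1[of x y] subspaceD(6)[OF U] assms by simp
qed

end

text \<open>The axioms pass along a surjection compatible with the operations, so quotients inherit
  them from the space above.\<close>

lemma vspI_surj:
  fixes M :: "('f :: field, 'v) module" and Q :: "('f, 'w) module"
  assumes M: "vsp M" and c: "carrier Q = p ` carrier M"
    and a: "\<And>x y. x \<in> carrier M \<Longrightarrow> y \<in> carrier M \<Longrightarrow> p x \<oplus>\<^bsub>Q\<^esub> p y = p (x \<oplus>\<^bsub>M\<^esub> y)"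
    and s: "\<And>c x. x \<in> carrier M \<Longrightarrow> c \<odot>\<^bsub>Q\<^esub> p x = p (c \<odot>\<^bsub>M\<^esub> x)"
    and z: "\<zero>\<^bsub>Q\<^esub> = p \<zero>\<^bsub>M\<^esub>"
  shows "vsp Q"
proof -
  interpret vsp M by (rule M)
  have "\<exists>n\<in>carrier Q. p x \<oplus>\<^bsub>Q\<^esub> n = \<zero>\<^bsub>Q\<^esub>" if "x \<in> carrier M" for x
    by (rule bexI[of _ "p (\<ominus>\<^bsub>M\<^esub> x)"]) (use that in \<open>auto simp: c a z r_neg\<close>)
  then show ?thesis
    by (intro vsp.intro vs_criteria[OF class_field])
       (auto simp: c a s z a_ac smult_smult smult_l_distr smult_r_distr)
qed

section \<open>Quotients and complements\<close>

context vsp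
begin

lemma coset_eq: "U +> x = {u \<oplus> x | u. u \<in> U}"
  by (auto simp: a_r_coset_def r_coset_def)

context
  fixes U assumes U: "lin_subspace W U"
begin

lemma coset_eq_iff:
  assumes "x \<in> carrier W" "y \<in> carrier W"
  shows "U +> x = U +> y \<longleftrightarrow> x \<ominus> y \<in> U"
proof
  assume "U +> x = U +> y"
  then have "\<zero> \<oplus> x \<in> U +> y" using subspaceD(2)[OF U] unfolding coset_eq by blast
  then obtain u where "u \<in> U" "x = u \<oplus> y" using assms by (auto simp: coset_eq)
  then show "x \<ominus> y \<in> U" using assms subspaceD(6)[OF U] by (simp add: add_minus_cancel)
next
  assume d: "x \<ominus> y \<in> U"
  have *: "U +> x \<subseteq> U +> y" if "x \<ominus> y \<in> U" "x \<in> carrier W" "y \<in> carrier W" for x y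
  proof -
    have "u \<oplus> x = (u \<oplus> (x \<ominus> y)) \<oplus> y" if "u \<in> U" for u
      using that \<open>x \<in> carrier W\<close> \<open>y \<in> carrier W\<close> subspaceD(6)[OF U that] by (simp add: a_assoc minus_add_cancel)
    then show ?thesis using subspaceD(3)[OF U _ that(1)] unfolding coset_eq by blast
  qed
  have "y \<ominus> x = (- 1) \<odot> (x \<ominus> y)"
    using assms by (simp add: smult_minus1 minus_eq minus_add a_comm)
  then have "y \<ominus> x \<in> U" using subspaceD(4)[OF U d] by simp
  then show "U +> x = U +> y" using *[OF d] *[of y x] assms by blast
qed

lemma coset_self: "x \<in> carrier W \<Longrightarrow> x \<in> U +> x"
  using subspaceD(2)[OF U] l_zero unfolding coset_eq by force

lemma coset_add:
  assumes "x \<in> carrier W" "y \<in> carrier W"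
  shows "set_add W (U +> x) (U +> y) = U +> (x \<oplus> y)"
proof (rule equalityI)
  show "set_add W (U +> x) (U +> y) \<subseteq> U +> (x \<oplus> y)"
  proof
    fix z assume "z \<in> set_add W (U +> x) (U +> y)"
    then obtain u v where uv: "u \<in> U" "v \<in> U" "z = (u \<oplus> x) \<oplus> (v \<oplus> y)"
      by (auto simp: coset_eq set_add_def set_mult_def)
    then have "z = (u \<oplus> v) \<oplus> (x \<oplus> y)" using assms subspaceD(6)[OF U] by (simp add: a_ac)
    then show "z \<in> U +> (x \<oplus> y)" using subspaceD(3)[OF U uv(1,2)] unfolding coset_eq by blast
  qed
  show "U +> (x \<oplus> y) \<subseteq> set_add W (U +> x) (U +> y)"
  proof
    fix z assume "z \<in> U +> (x \<oplus> y)"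
    then obtain u where u: "u \<in> U" "z = u \<oplus> (x \<oplus> y)" by (auto simp: coset_eq)
    then have "z = (u \<oplus> x) \<oplus> (\<zero> \<oplus> y)" using assms subspaceD(6)[OF U] by (simp add: a_ac)
    then show "z \<in> set_add W (U +> x) (U +> y)"
      using u(1) subspaceD(2)[OF U] unfolding coset_eq set_add_def set_mult_def by force
  qed
qed

text \<open>Scalar multiplication in \<open>quot\<close> is a union over all representatives; here
  all members of that union turn out to be the same coset.\<close>

lemma coset_smult:
  assumes "x \<in> carrier W"
  shows "(\<Union>y\<in>U +> x. U +> (c \<odot> y)) = U +> (c \<odot> x)"
proof -
  have "U +> (c \<odot> y) = U +> (c \<odot> x)" if "y \<in> U +> x" for y
  proof -
    from that obtain u where u: "u \<in> U" "y = u \<oplus> x" by (auto simp: coset_eq)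
    then have "c \<odot> y \<ominus> c \<odot> x = c \<odot> u"
      using assms subspaceD(6)[OF U] by (simp add: smult_r_distr add_minus_cancel)
    then show ?thesis
      using u assms subspaceD(4)[OF U u(1)] subspaceD(6)[OF U] by (subst coset_eq_iff) auto
  qed
  then show ?thesis using coset_self[OF assms] by blast
qed

lemma quot_simps:
  "carrier (quot W U) = (\<lambda>x. U +> x) ` carrier W"
  "x \<in> carrier W \<Longrightarrow> y \<in> carrier W \<Longrightarrow> (U +> x) \<oplus>\<^bsub>quot W U\<^esub> (U +> y) = U +> (x \<oplus> y)"
  "x \<in> carrier W \<Longrightarrow> c \<odot>\<^bsub>quot W U\<^esub> (U +> x) = U +> (c \<odot> x)"
  "\<zero>\<^bsub>quot W U\<^esub> = U +> \<zero>"
proof -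
  show "carrier (quot W U) = (\<lambda>x. U +> x) ` carrier W"
    by (auto simp: quot_def A_RCOSETS_def RCOSETS_def a_r_coset_def)
  show "x \<in> carrier W \<Longrightarrow> y \<in> carrier W \<Longrightarrow> (U +> x) \<oplus>\<^bsub>quot W U\<^esub> (U +> y) = U +> (x \<oplus> y)"
    by (simp add: quot_def coset_add)
  show "x \<in> carrier W \<Longrightarrow> c \<odot>\<^bsub>quot W U\<^esub> (U +> x) = U +> (c \<odot> x)"
    by (simp add: quot_def coset_smult)
  show "\<zero>\<^bsub>quot W U\<^esub> = U +> \<zero>"
    using subspaceD(6)[OF U] by (force simp: quot_def coset_eq)
qed

lemma vsp_quot: "vsp (quot W U)"
  by (rule vspI_surj[OF _ quot_simps(1)]) (simp_all add: quot_simps vsp_axioms)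

lemma quot_hom: "(\<lambda>x. U +> x) \<in> lin_hom W (quot W U)"
  by (auto simp: lin_hom_iff quot_simps)

end

lemma subspace_sum_line:
  assumes C: "lin_subspace W C" and w: "w \<in> carrier W"
  shows "lin_subspace W {c \<oplus> a \<odot> w | c a. c \<in> C}"
  unfolding subspace_iff
proof (intro conjI ballI allI)
  note C' = subspaceD[OF C]
  show "{c \<oplus> a \<odot> w | c a. c \<in> C} \<subseteq> carrier W" using w C'(6) by auto
  show "\<zero> \<in> {c \<oplus> a \<odot> w | c a. c \<in> C}"
    using w C'(2) by (intro CollectI exI[of _ \<zero>] exI[of _ 0]) auto
  fix x assume "x \<in> {c \<oplus> a \<odot> w | c a. c \<in> C}"
  then obtain c a where x: "x = c \<oplus> a \<odot> w" "c \<in> C" by blast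
  show "b \<odot> x \<in> {c \<oplus> a \<odot> w | c a. c \<in> C}" for b
    using x w C'(6) C'(4)[OF x(2)]
    by (intro CollectI exI[of _ "b \<odot> c"] exI[of _ "b * a"]) (auto simp: smult_r_distr smult_smult)
  fix y assume "y \<in> {c \<oplus> a \<odot> w | c a. c \<in> C}"
  then obtain c' a' where y: "y = c' \<oplus> a' \<odot> w" "c' \<in> C" by blast
  show "x \<oplus> y \<in> {c \<oplus> a \<odot> w | c a. c \<in> C}"
    using x y w C'(6) C'(3)[OF x(2) y(2)]
    by (intro CollectI exI[of _ "c \<oplus> c'"] exI[of _ "a + a'"]) (auto simp: smult_l_distr a_ac)
qed

section \<open>Complements and projections\<close>

lemma complement_decomp:
  assumes "complement_in W A B C" "x \<in> A"
  obtains b c where "b \<in> B" "c \<in> C" "x = b \<oplus> c"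
  using assms by (auto simp: complement_in_def set_add_def set_mult_def)

text \<open>Among the subspaces of \<open>A\<close> meeting \<open>B\<close> trivially take one, C,
  of largest cardinality. A vector w outside B + C could be adjoined to C without creating an
  intersection with \<open>B\<close>, contradicting maximality.\<close>

lemma exists_complement:
  assumes fin: "finite (carrier W)" and A: "lin_subspace W A" and B: "lin_subspace W B" and "B \<subseteq> A"
  shows "\<exists>C. complement_in W A B C"
proof -
  let ?S = "{C. lin_subspace W C \<and> C \<subseteq> A \<and> B \<inter> C = {\<zero>}}"
  note A' = subspaceD[OF A] and B' = subspaceD[OF B]
  have "?S \<subseteq> Pow (carrier W)" using A'(1) by auto
  then have "finite ?S" using fin by (meson finite_Pow_iff finite_subset)
  moreover have "{\<zero>} \<in> ?S" using A' B' subspace_zero by auto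
  ultimately have "Max (card ` ?S) \<in> card ` ?S" by (intro Max_in) auto
  then obtain C where C: "C \<in> ?S" and "card C = Max (card ` ?S)" by force
  with \<open>finite ?S\<close> have max: "card C' \<le> card C" if "C' \<in> ?S" for C'
    using that by simp
  have Cs: "lin_subspace W C" "C \<subseteq> A" "B \<inter> C = {\<zero>}" using C by auto
  note C' = subspaceD[OF Cs(1)]
  have "set_add W B C = A"
  proof (rule equalityI)
    show "set_add W B C \<subseteq> A"
      using \<open>B \<subseteq> A\<close> Cs(2) A'(3) by (auto simp: set_add_def set_mult_def)
    show "A \<subseteq> set_add W B C"
    proof
      fix w assume wA: "w \<in> A"
      then have w: "w \<in> carrier W" by (rule A'(6))
      show "w \<in> set_add W B C"
      proof (rule ccontr)
        assume nw: "w \<notin> set_add W B C"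
        let ?C = "{c \<oplus> a \<odot> w | c a. c \<in> C}"
        have sub: "?C \<subseteq> A" using Cs(2) A'(3,4) wA by blast
        have "b = \<zero>" if "b \<in> B" "b \<in> ?C" for b
        proof -
          from that(2) obtain c a where b: "b = c \<oplus> a \<odot> w" "c \<in> C" by blast
          note cl = C'(6)[OF b(2)] B'(6)[OF that(1)]
          \<comment> \<open>With a nonzero coefficient one could solve for \<open>w\<close> and
            place it in B + C.\<close>
          have "a = 0"
          proof (rule ccontr)
            assume "a \<noteq> 0"
            have "b \<ominus> c = a \<odot> w" using b(1) w cl by (simp add: a_comm[of c] add_minus_cancel)
            then have "w = inverse a \<odot> (b \<oplus> (- 1) \<odot> c)"
              using \<open>a \<noteq> 0\<close> smult_cancel[OF w] cl by (simp add: minus_smult1)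
            then have "w = (inverse a \<odot> b) \<oplus> (- inverse a) \<odot> c"
              using cl by (simp add: smult_r_distr smult_smult)
            then show False
              using nw B'(4)[OF that(1)] C'(4)[OF b(2)] by (force simp: set_add_def set_mult_def)
          qed
          then have "b = c" using b w cl by simp
          then show ?thesis using Cs(3) that(1) b(2) by auto
        qed
        note zero = this
        have lC: "lin_subspace W ?C" by (rule subspace_sum_line[OF Cs(1) w])
        have "B \<inter> ?C = {\<zero>}"
        proof (intro equalityI subsetI)
          show "b \<in> {\<zero>}" if "b \<in> B \<inter> ?C" for b using zero that by blast
          show "b \<in> B \<inter> ?C" if "b \<in> {\<zero>}" for b using that B'(2) subspaceD(2)[OF lC] by blast
        qed
        with lC sub have "?C \<in> ?S" by blast
        then have "card ?C \<le> card C" by (rule max)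
        moreover have "C \<subseteq> ?C"
        proof
          fix c assume "c \<in> C"
          then show "c \<in> ?C" using w C'(6) by (intro CollectI exI[of _ c] exI[of _ 0]) auto
        qed
        moreover have "finite ?C" using sub A'(1) fin by (meson finite_subset)
        ultimately have "C = ?C" by (meson card_seteq)
        moreover have "\<zero> \<oplus> 1 \<odot> w \<in> ?C" using C'(2) by blast
        ultimately have "w \<in> C" using w by simp
        then show False using nw B'(2) w by (force simp: set_add_def set_mult_def)
      qed
    qed
  qed
  then show ?thesis using Cs by (auto simp: complement_in_def)
qed

text \<open>Composition with \<open>p\<close> extends a linear map from \<open>B\<close> to the
  whole space; this is how a deformation on a kernel is continued outside it.\<close>

lemma exists_projection:
  assumes fin: "finite (carrier W)" and B: "lin_subspace W B"
  obtains p where "p \<in> lin_hom W W" "\<And>x. x \<in> carrier W \<Longrightarrow> p x \<in> B" "\<And>x. x \<in> B \<Longrightarrow> p x = x"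
proof -
  obtain C where C: "complement_in W (carrier W) B C"
    using exists_complement[OF fin subspace_carrier B] subspaceD[OF B] by auto
  then have Cs: "lin_subspace W C" "B \<inter> C = {\<zero>}" by (auto simp: complement_in_def)
  note B' = subspaceD[OF B] and C' = subspaceD[OF Cs(1)]
  have uniq: "b = b'" if "b \<in> B" "b' \<in> B" "c \<in> C" "c' \<in> C" "b \<oplus> c = b' \<oplus> c'" for b b' c c'
  proof -
    have cl: "b \<in> carrier W" "b' \<in> carrier W" "c \<in> carrier W" "c' \<in> carrier W"
      using that B'(6) C'(6) by auto
    have "b \<ominus> b' = c' \<ominus> c"
      using diff_eq_diff that(5) cl by simp
    then have "b \<ominus> b' \<in> B \<inter> C" using B'(5)[OF that(1,2)] C'(5)[OF that(4,3)] by simp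
    then show ?thesis using Cs(2) cl minus_zero_iff by auto
  qed
  define p where "p x = (THE b. b \<in> B \<and> (\<exists>c\<in>C. x = b \<oplus> c))" for x
  have p: "p (b \<oplus> c) = b" if "b \<in> B" "c \<in> C" for b c
    unfolding p_def by (rule the_equality) (use that uniq in blast)+
  have pc: "p x \<in> B" if "x \<in> carrier W" for x
    using complement_decomp[OF C that] p by metis
  show ?thesis
  proof
    show "p x \<in> B" if "x \<in> carrier W" for x by (rule pc[OF that])
    show "p x = x" if "x \<in> B" for x using p[OF that C'(2)] B'(6)[OF that] by simp
    have "p (x \<oplus> y) = p x \<oplus> p y" if xy: "x \<in> carrier W" "y \<in> carrier W" for x y
    proof -
      obtain b c where x: "b \<in> B" "c \<in> C" "x = b \<oplus> c" by (rule complement_decomp[OF C xy(1)])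
      obtain b' c' where y: "b' \<in> B" "c' \<in> C" "y = b' \<oplus> c'" by (rule complement_decomp[OF C xy(2)])
      have "x \<oplus> y = (b \<oplus> b') \<oplus> (c \<oplus> c')" using x y B'(6) C'(6) by (simp add: a_ac)
      then show ?thesis using p[OF B'(3)[OF x(1) y(1)] C'(3)[OF x(2) y(2)]] p x y by simp
    qed
    moreover have "p (a \<odot> x) = a \<odot> p x" if xy: "x \<in> carrier W" for a x
    proof -
      obtain b c where x: "b \<in> B" "c \<in> C" "x = b \<oplus> c" by (rule complement_decomp[OF C xy(1)])
      have "a \<odot> x = (a \<odot> b) \<oplus> (a \<odot> c)" using x B'(6) C'(6) by (simp add: smult_r_distr)
      then show ?thesis using p[OF B'(4)[OF x(1)] C'(4)[OF x(2)]] p x by simp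
    qed
    ultimately show "p \<in> lin_hom W W" using pc B'(6) by (auto simp: lin_hom_iff)
  qed
qed

end

section \<open>Dimension over a finite field\<close>

text \<open>Coordinates with respect to a basis are a bijection. Dimensions are later compared by
  counting elements.\<close>

lemma (in vsp) finite_carrier_card:
  assumes fd: "vectorspace.fin_dim (class_ring :: 'f ring) W" and "finite (UNIV :: 'f set)"
  shows "finite (carrier W)" and "card (carrier W) = CARD('f) ^ vectorspace.dim (class_ring :: 'f ring) W"
proof -
  interpret V: vectorspace "class_ring :: 'f ring" W by (rule vs)
  obtain B where B: "finite B" "V.basis B" using V.finite_basis_exists[OF fd] by blast
  then have sub: "B \<subseteq> carrier W" by (simp add: V.basis_def)
  let ?F = "B \<rightarrow>\<^sub>E (UNIV :: 'f set)"
  have ex: "\<exists>!a. a \<in> ?F \<and> V.lincomb a B = v" if "v \<in> carrier W" for v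
    using V.basis_criterion[OF B(1) sub] B(2) that by simp
  have "bij_betw (\<lambda>a. V.lincomb a B) ?F (carrier W)"
  proof (rule bij_betw_imageI)
    have cl: "V.lincomb a B \<in> carrier W" for a by (rule V.lincomb_closed) (use sub in auto)
    show "inj_on (\<lambda>a. V.lincomb a B) ?F"
    proof (rule inj_onI)
      fix a b assume "a \<in> ?F" "b \<in> ?F" "V.lincomb a B = V.lincomb b B"
      then show "a = b" using ex[OF cl[of b]] by blast
    qed
    show "(\<lambda>a. V.lincomb a B) ` ?F = carrier W"
    proof (intro equalityI subsetI)
      fix v assume "v \<in> carrier W"
      from ex[OF this] show "v \<in> (\<lambda>a. V.lincomb a B) ` ?F" by blast
    qed (use cl in blast)
  qed
  moreover have "finite ?F" using B(1) assms(2) by (intro finite_PiE) auto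
  moreover have "card ?F = CARD('f) ^ card B" using B(1) by (simp add: card_PiE)
  ultimately show "finite (carrier W)" "card (carrier W) = CARD('f) ^ vectorspace.dim class_ring W"
    using V.dim_basis[OF B] by (simp_all add: bij_betw_same_card[symmetric] bij_betw_finite)
qed

lemma (in vsp) fin_dim_finite:
  assumes "finite (carrier W)" shows "vectorspace.fin_dim (class_ring :: 'f ring) W"
proof -
  interpret V: vectorspace "class_ring :: 'f ring" W by (rule vs)
  have "V.gen_set (carrier W)" using V.in_own_span[of "carrier W"] V.span_is_subset2[of "carrier W"] by auto
  then show ?thesis unfolding V.fin_dim_def using assms by blast
qed

section \<open>Extension of scalars\<close>

lemma free_space_simps:
  "carrier (free_space W) = carrier W \<rightarrow>\<^sub>E UNIV"
  "f \<oplus>\<^bsub>free_space W\<^esub> g = (\<lambda>x\<in>carrier W. f x + g x)"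
  "\<zero>\<^bsub>free_space W\<^esub> = (\<lambda>x\<in>carrier W. 0)"
  "c \<odot>\<^bsub>free_space W\<^esub> f = (\<lambda>x\<in>carrier W. c * f x)"
  by (simp_all add: free_space_def ring.func_space_def[OF class_ring_ring])

lemma vsp_free_space: "vsp (free_space W)"
proof -
  have c: "cring (class_ring :: 'k :: field alg_closure ring)"
    using class_field unfolding field_def domain_def by blast
  show ?thesis
    using cring.func_space_is_module[OF c] class_field
    by (intro vsp.intro) (auto simp: vectorspace_def free_space_def)
qed

definition bc_class :: "('k :: field, 'w) module \<Rightarrow> ('w \<Rightarrow> 'k alg_closure) \<Rightarrow> ('w \<Rightarrow> 'k alg_closure) set" where
  "bc_class W f = relation_span W +>\<^bsub>free_space W\<^esub> f"

lemma vsp_scalar_line: "vsp (scalar_line :: ('f :: field, 'f) module)"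
  by (intro vsp.intro vs_criteria[OF class_field])
     (auto simp: scalar_line_def algebra_simps intro: exI[of _ "- x" for x :: 'f])

lemma scalar_line_simps:
  "carrier (scalar_line :: ('f :: field, 'f) module) = UNIV"
  "x \<oplus>\<^bsub>scalar_line\<^esub> y = (x + y :: 'f)" "c \<odot>\<^bsub>scalar_line\<^esub> x = (c * x :: 'f)" "\<zero>\<^bsub>scalar_line\<^esub> = (0 :: 'f)"
  by (simp_all add: scalar_line_def)

locale fvsp = vsp W for W :: "('k :: {field, finite}, 'w) module" (structure) +
  assumes fin: "finite (carrier W)"
begin

abbreviation "Fr \<equiv> carrier W \<rightarrow>\<^sub>E (UNIV :: 'k alg_closure set)"
abbreviation "B \<equiv> base_change W"

lemma free_gen_in: "free_gen W w a \<in> Fr"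
  by (auto simp: free_gen_def)

lemma relations_subset: "tensor_relations W \<subseteq> Fr"
  by (auto simp: tensor_relations_def)

lemma relation_span_subspace: "lin_subspace (free_space W) (relation_span W)"
  unfolding relation_span_def
  by (rule vectorspace.span_is_subspace[OF vsp.vs[OF vsp_free_space]])
     (simp add: free_space_simps relations_subset)

lemma relation_in_span: "f \<in> tensor_relations W \<Longrightarrow> f \<in> relation_span W"
  unfolding relation_span_def
  using LinearCombinations.module.in_own_span[OF vsp.module[OF vsp_free_space], of "tensor_relations W" W] relations_subset
  by (auto simp: free_space_simps)

lemmas bc_quot = vsp.quot_simps[OF vsp_free_space relation_span_subspace, folded base_change_def bc_class_def,
    unfolded free_space_simps]

lemma vsp_bc: "vsp B"
  unfolding base_change_def by (rule vsp.vsp_quot[OF vsp_free_space relation_span_subspace])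

sublocale B: vsp B by (rule vsp_bc)

lemma bc_closed [simp, intro]: "f \<in> Fr \<Longrightarrow> bc_class W f \<in> carrier B"
  using bc_quot(1) by blast

lemma bc_cases:
  assumes "x \<in> carrier B"
  obtains f where "f \<in> Fr" "x = bc_class W f"
  using assms unfolding bc_quot(1) by blast

lemma bc_eq_iff:
  assumes "f \<in> Fr" "g \<in> Fr"
  shows "bc_class W f = bc_class W g \<longleftrightarrow> (\<lambda>x\<in>carrier W. f x - g x) \<in> relation_span W"
proof -
  interpret F: vsp "free_space W" by (rule vsp_free_space)
  have "f \<ominus>\<^bsub>free_space W\<^esub> g = (\<lambda>x\<in>carrier W. f x - g x)"
    using assms by (subst F.minus_smult1) (auto simp: free_space_simps cong: restrict_cong)
  then show ?thesis
    using F.coset_eq_iff[OF relation_span_subspace, of f g] assms by (simp add: free_space_simps bc_class_def)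
qed

lemma tensor_bc: "tensor W w a = bc_class W (free_gen W w a)"
  by (simp add: tensor_def bc_class_def)

lemma tensor_closed [simp, intro]: "tensor W w a \<in> carrier B"
  unfolding tensor_bc by (rule bc_closed) (rule free_gen_in)

lemma tensor_add_right: "tensor W w (a + b) = tensor W w a \<oplus>\<^bsub>B\<^esub> tensor W w b"
  unfolding tensor_bc bc_quot(2)[OF free_gen_in free_gen_in]
  by (rule arg_cong[of _ _ "bc_class W"]) (auto simp: free_gen_def)

lemma smult_tensor: "b \<odot>\<^bsub>B\<^esub> tensor W w a = tensor W w (b * a)"
  unfolding tensor_bc bc_quot(3)[OF free_gen_in]
  by (rule arg_cong[of _ _ "bc_class W"]) (auto simp: free_gen_def)

lemma tensor_0: "tensor W w 0 = \<zero>\<^bsub>B\<^esub>"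
  unfolding tensor_bc bc_quot(4)
  by (rule arg_cong[of _ _ "bc_class W"]) (auto simp: free_gen_def)

text \<open>The relations are imposed only for the scalar 1; a general scalar is reached by
  multiplying the relation by \<open>a\<close>.\<close>

lemma tensor_add_left:
  assumes "w \<in> carrier W" "w' \<in> carrier W"
  shows "tensor W (w \<oplus> w') a = tensor W w a \<oplus>\<^bsub>B\<^esub> tensor W w' a"
proof -
  have "tensor W (w \<oplus> w') 1 = tensor W w 1 \<oplus>\<^bsub>B\<^esub> tensor W w' 1"
    unfolding tensor_bc bc_quot(2)[OF free_gen_in free_gen_in]
  proof (subst bc_eq_iff)
    have "(\<lambda>x\<in>carrier W. free_gen W (w \<oplus> w') 1 x - free_gen W w 1 x - free_gen W w' 1 x) \<in> relation_span W"
      by (rule relation_in_span) (use assms in \<open>auto simp: tensor_relations_def\<close>)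
    then show "(\<lambda>x\<in>carrier W. free_gen W (w \<oplus> w') 1 x - (\<lambda>x\<in>carrier W. free_gen W w 1 x + free_gen W w' 1 x) x) \<in> relation_span W"
      by (simp add: diff_diff_eq cong: restrict_cong)
  qed (auto simp: free_gen_in)
  then have "a \<odot>\<^bsub>B\<^esub> tensor W (w \<oplus> w') 1 = a \<odot>\<^bsub>B\<^esub> (tensor W w 1 \<oplus>\<^bsub>B\<^esub> tensor W w' 1)" by simp
  then show ?thesis by (simp add: smult_tensor B.smult_r_distr)
qed

lemma tensor_smult_left:
  assumes "w \<in> carrier W"
  shows "tensor W (c \<odot> w) a = tensor W w (to_ac c * a)"
proof -
  have "tensor W (c \<odot> w) 1 = tensor W w (to_ac c)"
    unfolding tensor_bc
  proof (subst bc_eq_iff)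
    show "(\<lambda>x\<in>carrier W. free_gen W (c \<odot> w) 1 x - free_gen W w (to_ac c) x) \<in> relation_span W"
      by (rule relation_in_span) (use assms in \<open>auto simp: tensor_relations_def\<close>)
  qed (auto simp: free_gen_in)
  then have "a \<odot>\<^bsub>B\<^esub> tensor W (c \<odot> w) 1 = a \<odot>\<^bsub>B\<^esub> tensor W w (to_ac c)" by simp
  then show ?thesis by (simp add: smult_tensor mult.commute)
qed

text \<open>Since W is finite, a function on it is the sum of its one-point restrictions, and the
  induction adds one point at a time.\<close>

lemma free_induct [consumes 1, case_names zero gen add]:
  assumes f: "f \<in> Fr" and 0: "P (\<lambda>x\<in>carrier W. 0)"
    and g: "\<And>w a. w \<in> carrier W \<Longrightarrow> P (free_gen W w a)"
    and add: "\<And>f g. f \<in> Fr \<Longrightarrow> g \<in> Fr \<Longrightarrow> P f \<Longrightarrow> P g \<Longrightarrow> P (\<lambda>x\<in>carrier W. f x + g x)"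
  shows "P f"
proof -
  have "P (\<lambda>x\<in>carrier W. if x \<in> A then f x else 0)" if "A \<subseteq> carrier W" for A
    using finite_subset[OF that fin] that
  proof (induction A rule: finite_induct)
    case empty
    then show ?case using 0 by (simp add: restrict_def)
  next
    case (insert w A)
    have "P (\<lambda>x\<in>carrier W. free_gen W w (f w) x + (\<lambda>x\<in>carrier W. if x \<in> A then f x else 0) x)"
      by (rule add) (use insert g free_gen_in in auto)
    moreover have "(\<lambda>x\<in>carrier W. free_gen W w (f w) x + (\<lambda>x\<in>carrier W. if x \<in> A then f x else 0) x) =
        (\<lambda>x\<in>carrier W. if x \<in> insert w A then f x else 0)"
      using insert.hyps(2) by (auto simp: free_gen_def fun_eq_iff)
    ultimately show ?case by (simp add: restrict_def)
  qed
  from this[of "carrier W"] have "P (\<lambda>x\<in>carrier W. f x)"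
    by (simp cong: restrict_cong)
  then show ?thesis using f by (simp add: PiE_iff extensional_restrict)
qed

lemma bc_induct [consumes 1, case_names tensor add]:
  assumes x: "x \<in> carrier B" and t: "\<And>w a. w \<in> carrier W \<Longrightarrow> P (tensor W w a)"
    and add: "\<And>x y. x \<in> carrier B \<Longrightarrow> y \<in> carrier B \<Longrightarrow> P x \<Longrightarrow> P y \<Longrightarrow> P (x \<oplus>\<^bsub>B\<^esub> y)"
  shows "P x"
proof -
  obtain f where f: "f \<in> Fr" "x = bc_class W f" by (rule bc_cases[OF x])
  have "P (bc_class W f)" using f(1)
  proof (induction rule: free_induct)
    case zero
    then show ?case using t[OF zero_closed, of 0] by (simp add: tensor_0 bc_quot(4) restrict_def)
  next
    case (add f g)
    then show ?case using assms(3)[of "bc_class W f" "bc_class W g"] by (simp add: bc_quot(2) restrict_def)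
  qed (use t in \<open>simp add: tensor_bc\<close>)
  then show ?thesis using f by simp
qed

text \<open>Additivity and the values on pure tensors determine a map. The target addition
  \<open>add'\<close> is left open so that linear maps, forms and the semilinear Frobenius are all
  covered.\<close>

lemma bc_ext:
  assumes "f \<in> extensional (carrier B)" "f' \<in> extensional (carrier B)"
    and "\<And>x y. x \<in> carrier B \<Longrightarrow> y \<in> carrier B \<Longrightarrow> f (x \<oplus>\<^bsub>B\<^esub> y) = add' (f x) (f y)"
    and "\<And>x y. x \<in> carrier B \<Longrightarrow> y \<in> carrier B \<Longrightarrow> f' (x \<oplus>\<^bsub>B\<^esub> y) = add' (f' x) (f' y)"
    and "\<And>w a. w \<in> carrier W \<Longrightarrow> f (tensor W w a) = f' (tensor W w a)"
  shows "f = f'"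
proof (rule extensionalityI[OF assms(1,2)])
  show "f x = f' x" if "x \<in> carrier B" for x
    using that by (induction rule: bc_induct) (simp_all add: assms)
qed

text \<open>Universal property of base change in semilinear form: \<sigma> is the identity for
  base-changed maps and forms, and Frobenius for \<open>frob_space\<close>.\<close>

lemma bc_lift:
  fixes N :: "('k alg_closure, 'n) module"
  assumes N: "vsp N" and \<sigma>: "\<And>x y. \<sigma> (x + y) = \<sigma> x + \<sigma> y" "\<And>x y. \<sigma> (x * y) = \<sigma> x * \<sigma> y"
    "\<And>c. \<sigma> (to_ac c) = to_ac (c :: 'k)"
    and T: "T \<in> carrier W \<rightarrow> carrier N"
    "\<And>x y. x \<in> carrier W \<Longrightarrow> y \<in> carrier W \<Longrightarrow> T (x \<oplus> y) = T x \<oplus>\<^bsub>N\<^esub> T y"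
    "\<And>c x. x \<in> carrier W \<Longrightarrow> T (c \<odot> x) = to_ac c \<odot>\<^bsub>N\<^esub> T x"
  obtains h where "h \<in> extensional (carrier B)" "h \<in> carrier B \<rightarrow> carrier N"
    "\<And>x y. x \<in> carrier B \<Longrightarrow> y \<in> carrier B \<Longrightarrow> h (x \<oplus>\<^bsub>B\<^esub> y) = h x \<oplus>\<^bsub>N\<^esub> h y"
    "\<And>c x. x \<in> carrier B \<Longrightarrow> h (c \<odot>\<^bsub>B\<^esub> x) = \<sigma> c \<odot>\<^bsub>N\<^esub> h x"
    "\<And>w a. w \<in> carrier W \<Longrightarrow> h (tensor W w a) = \<sigma> a \<odot>\<^bsub>N\<^esub> T w"
proof -
  interpret N: vsp N by (rule N)
  have Tc: "T x \<in> carrier N" if "x \<in> carrier W" for x using T(1) that by blast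
  have \<sigma>': "\<sigma> 0 = 0" "\<sigma> 1 = 1" "\<sigma> (-1) = -1"
    using \<sigma>(3)[of 0] \<sigma>(3)[of 1] \<sigma>(3)[of "-1"] by simp_all
  define g where "g f = finsum N (\<lambda>x. \<sigma> (f x) \<odot>\<^bsub>N\<^esub> T x) (carrier W)" for f
  have gc: "g f \<in> carrier N" for f unfolding g_def by (rule N.finsum_closed) (use Tc in auto)
  have gcong: "g (\<lambda>x\<in>carrier W. f x) = g f" for f
    unfolding g_def by (rule N.finsum_cong') (use Tc in auto)
  have ga: "g (\<lambda>x\<in>carrier W. f x + f' x) = g f \<oplus>\<^bsub>N\<^esub> g f'" for f f'
  proof -
    have "g (\<lambda>x. f x + f' x) = finsum N (\<lambda>x. \<sigma> (f x) \<odot>\<^bsub>N\<^esub> T x \<oplus>\<^bsub>N\<^esub> \<sigma> (f' x) \<odot>\<^bsub>N\<^esub> T x) (carrier W)"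
      unfolding g_def by (rule N.finsum_cong') (use Tc in \<open>auto simp: \<sigma> N.smult_l_distr\<close>)
    also have "\<dots> = g f \<oplus>\<^bsub>N\<^esub> g f'"
      unfolding g_def by (rule N.finsum_addf) (use Tc in auto)
    finally show ?thesis by (simp add: gcong)
  qed
  have gs: "g (\<lambda>x\<in>carrier W. c * f x) = \<sigma> c \<odot>\<^bsub>N\<^esub> g f" for c f
  proof -
    have "\<sigma> c \<odot>\<^bsub>N\<^esub> g f = finsum N (\<lambda>x. \<sigma> c \<odot>\<^bsub>N\<^esub> (\<sigma> (f x) \<odot>\<^bsub>N\<^esub> T x)) (carrier W)"
      unfolding g_def by (rule MonoidSums.module.finsum_smult[OF N.module]) (use Tc in auto)
    also have "\<dots> = g (\<lambda>x. c * f x)"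
      unfolding g_def by (rule N.finsum_cong') (use Tc in \<open>auto simp: \<sigma> N.smult_smult\<close>)
    finally show ?thesis by (simp add: gcong)
  qed
  have gg: "g (free_gen W w a) = \<sigma> a \<odot>\<^bsub>N\<^esub> T w" if "w \<in> carrier W" for w a
  proof -
    have "g (free_gen W w a) = finsum N (\<lambda>x. if w = x then \<sigma> a \<odot>\<^bsub>N\<^esub> T x else \<zero>\<^bsub>N\<^esub>) (carrier W)"
      unfolding g_def by (rule N.finsum_cong') (use Tc in \<open>auto simp: free_gen_def \<sigma>'\<close>)
    also have "\<dots> = \<sigma> a \<odot>\<^bsub>N\<^esub> T w"
      by (rule N.add.finprod_singleton[OF that fin]) (use Tc in auto)
    finally show ?thesis .
  qed
  have gdiff: "g (\<lambda>x\<in>carrier W. f x - f' x) = g f \<oplus>\<^bsub>N\<^esub> (- 1) \<odot>\<^bsub>N\<^esub> g f'" for f f'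
    using ga[of f "\<lambda>x\<in>carrier W. (- 1) * f' x"] gs[of "- 1" f'] \<sigma>' by (simp cong: restrict_cong)
  let ?ker = "{f \<in> Fr. g f = \<zero>\<^bsub>N\<^esub>}"
  have g0: "g (\<lambda>x\<in>carrier W. 0) = \<zero>\<^bsub>N\<^esub>"
    using gs[of 0 "\<lambda>x. 0"] \<sigma>' gc by simp
  \<comment> \<open>Although \<open>g\<close> is only \<sigma>-semilinear, its kernel is closed
    under all scalars. Once it contains the relations it contains their span, so \<open>g\<close>
    descends to the quotient.\<close>
  have "lin_subspace (free_space W) ?ker"
    by (subst vsp.subspace_iff[OF vsp_free_space]) (auto simp: free_space_simps g0 ga gs)
  then have "submodule class_ring ?ker (free_space W)" by (simp add: VectorSpace.subspace_def)
  moreover have "tensor_relations W \<subseteq> ?ker"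
  proof
    fix f assume f: "f \<in> tensor_relations W"
    then consider (a) w w' where "w \<in> carrier W" "w' \<in> carrier W"
        "f = (\<lambda>x\<in>carrier W. free_gen W (w \<oplus> w') 1 x - free_gen W w 1 x - free_gen W w' 1 x)"
      | (b) c w where "w \<in> carrier W" "f = (\<lambda>x\<in>carrier W. free_gen W (c \<odot> w) 1 x - free_gen W w (to_ac c) x)"
      unfolding tensor_relations_def by blast
    then have "g f = \<zero>\<^bsub>N\<^esub>"
    proof cases
      case a
      have "f = (\<lambda>x\<in>carrier W. free_gen W (w \<oplus> w') 1 x - (\<lambda>x\<in>carrier W. free_gen W w 1 x + free_gen W w' 1 x) x)"
        unfolding a(3) by (auto simp: fun_eq_iff)
      then have "g f = g (free_gen W (w \<oplus> w') 1) \<oplus>\<^bsub>N\<^esub> (- 1) \<odot>\<^bsub>N\<^esub> (g (free_gen W w 1) \<oplus>\<^bsub>N\<^esub> g (free_gen W w' 1))"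
        by (simp only: gdiff ga)
      then show ?thesis using a(1,2) by (simp add: gg \<sigma>' T Tc N.smult_minus1 N.r_neg)
    next
      case b
      have "g f = g (free_gen W (c \<odot> w) 1) \<oplus>\<^bsub>N\<^esub> (- 1) \<odot>\<^bsub>N\<^esub> g (free_gen W w (to_ac c))"
        unfolding b(2) by (rule gdiff)
      then show ?thesis using b(1) by (simp add: gg \<sigma> \<sigma>' T Tc N.smult_minus1 N.r_neg)
    qed
    then show "f \<in> ?ker" using f relations_subset by blast
  qed
  ultimately have ker: "relation_span W \<subseteq> ?ker"
    unfolding relation_span_def
    by (intro LinearCombinations.module.span_is_subset[OF vsp.module[OF vsp_free_space]])
  define h where "h = restrict (\<lambda>Y. g (SOME f. f \<in> Fr \<and> bc_class W f = Y)) (carrier B)"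
  have hbc: "h (bc_class W f) = g f" if f: "f \<in> Fr" for f
  proof -
    let ?f = "SOME f'. f' \<in> Fr \<and> bc_class W f' = bc_class W f"
    have f': "?f \<in> Fr \<and> bc_class W ?f = bc_class W f" by (rule someI[of _ f]) (use f in simp)
    then have "g (\<lambda>x\<in>carrier W. ?f x - f x) = \<zero>\<^bsub>N\<^esub>" using bc_eq_iff[of ?f f] f ker by blast
    then have "g ?f \<ominus>\<^bsub>N\<^esub> g f = \<zero>\<^bsub>N\<^esub>" by (simp add: gdiff N.minus_smult1 gc)
    then have "g ?f = g f" using gc N.minus_zero_iff by blast
    then show ?thesis using f by (simp add: h_def)
  qed
  show ?thesis
  proof (rule that[of h])
    show "h \<in> extensional (carrier B)" by (simp add: h_def)
    show "h \<in> carrier B \<rightarrow> carrier N" by (auto simp: h_def gc)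
    show "h (x \<oplus>\<^bsub>B\<^esub> y) = h x \<oplus>\<^bsub>N\<^esub> h y" if xy: "x \<in> carrier B" "y \<in> carrier B" for x y
    proof -
      obtain f where f: "f \<in> Fr" "x = bc_class W f" by (rule bc_cases[OF xy(1)])
      obtain f' where "f' \<in> Fr" "y = bc_class W f'" by (rule bc_cases[OF xy(2)])
      with f show ?thesis using hbc[of "\<lambda>x\<in>carrier W. f x + f' x"] by (simp add: bc_quot(2) hbc ga)
    qed
    show "h (c \<odot>\<^bsub>B\<^esub> x) = \<sigma> c \<odot>\<^bsub>N\<^esub> h x" if x: "x \<in> carrier B" for c x
    proof -
      obtain f where "f \<in> Fr" "x = bc_class W f" by (rule bc_cases[OF x])
      then show ?thesis using hbc[of "\<lambda>x\<in>carrier W. c * f x"] by (simp add: bc_quot(3) hbc gs)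
    qed
    show "h (tensor W w a) = \<sigma> a \<odot>\<^bsub>N\<^esub> T w" if "w \<in> carrier W" for w a
      unfolding tensor_bc by (simp add: hbc free_gen_in gg that)
  qed
qed

end

text \<open>Resolves the definite description in the definition: existence by
  \<open>bc_lift\<close>, uniqueness by \<open>bc_ext\<close>.\<close>

lemma base_change_map:
  fixes W :: "('k :: {field, finite}, 'w) module" and W' :: "('k, 'x) module"
  assumes W: "fvsp W" and W': "fvsp W'" and T: "T \<in> lin_hom W W'"
  shows "base_change_map W W' T \<in> lin_hom (base_change W) (base_change W')"
    "base_change_map W W' T \<in> extensional (carrier (base_change W))"
    "\<And>w a. w \<in> carrier W \<Longrightarrow> base_change_map W W' T (tensor W w a) = tensor W' (T w) a"
proof -
  interpret W: fvsp W by (rule W)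
  interpret W': fvsp W' by (rule W')
  have T': "\<And>x. x \<in> carrier W \<Longrightarrow> T x \<in> carrier W'" using T by (auto simp: lin_hom_iff)
  obtain h where h: "h \<in> extensional (carrier (base_change W))" "h \<in> carrier (base_change W) \<rightarrow> carrier (base_change W')"
    "\<And>x y. x \<in> carrier (base_change W) \<Longrightarrow> y \<in> carrier (base_change W) \<Longrightarrow> h (x \<oplus>\<^bsub>base_change W\<^esub> y) = h x \<oplus>\<^bsub>base_change W'\<^esub> h y"
    "\<And>c x. x \<in> carrier (base_change W) \<Longrightarrow> h (c \<odot>\<^bsub>base_change W\<^esub> x) = c \<odot>\<^bsub>base_change W'\<^esub> h x"
    "\<And>w a. w \<in> carrier W \<Longrightarrow> h (tensor W w a) = a \<odot>\<^bsub>base_change W'\<^esub> tensor W' (T w) 1"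
    by (rule W.bc_lift[OF W'.vsp_bc, of "\<lambda>x. x" "\<lambda>w. tensor W' (T w) 1"])
       (use T in \<open>auto simp: lin_hom_iff W'.tensor_add_left W'.tensor_smult_left W'.smult_tensor T'\<close>)
  let ?P = "\<lambda>f. f \<in> lin_hom (base_change W) (base_change W') \<inter> extensional (carrier (base_change W)) \<and>
    (\<forall>w\<in>carrier W. \<forall>a. f (tensor W w a) = tensor W' (T w) a)"
  have "?P h" using h by (auto simp: lin_hom_iff W'.smult_tensor)
  moreover have "f = h" if "?P f" for f
    by (rule W.bc_ext[where add' = "\<lambda>x y. x \<oplus>\<^bsub>base_change W'\<^esub> y"])
       (use that h in \<open>auto simp: lin_hom_iff W'.smult_tensor\<close>)
  ultimately have "?P (THE f. ?P f)" by (rule theI)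
  then show "base_change_map W W' T \<in> lin_hom (base_change W) (base_change W')"
    "base_change_map W W' T \<in> extensional (carrier (base_change W))"
    "\<And>w a. w \<in> carrier W \<Longrightarrow> base_change_map W W' T (tensor W w a) = tensor W' (T w) a"
    unfolding base_change_map_def by blast+
qed

context fvsp
begin

lemma frob_space:
  "frob_space W \<in> carrier B \<rightarrow> carrier B"
  "\<And>x y. x \<in> carrier B \<Longrightarrow> y \<in> carrier B \<Longrightarrow> frob_space W (x \<oplus>\<^bsub>B\<^esub> y) = frob_space W x \<oplus>\<^bsub>B\<^esub> frob_space W y"
  "\<And>w a. w \<in> carrier W \<Longrightarrow> frob_space W (tensor W w a) = tensor W w (frob a)"
proof -
  obtain h where h: "h \<in> extensional (carrier B)" "h \<in> carrier B \<rightarrow> carrier B"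
    "\<And>x y. x \<in> carrier B \<Longrightarrow> y \<in> carrier B \<Longrightarrow> h (x \<oplus>\<^bsub>B\<^esub> y) = h x \<oplus>\<^bsub>B\<^esub> h y"
    "\<And>w a. w \<in> carrier W \<Longrightarrow> h (tensor W w a) = frob a \<odot>\<^bsub>B\<^esub> tensor W w 1"
    by (rule bc_lift[OF vsp_bc, of frob "\<lambda>w. tensor W w 1"])
       (auto simp: tensor_add_left tensor_smult_left smult_tensor frob_add frob_mult)
  let ?P = "\<lambda>f. f \<in> extensional (carrier (base_change W)) \<and>
             f \<in> carrier (base_change W) \<rightarrow> carrier (base_change W) \<and>
             (\<forall>x\<in>carrier (base_change W). \<forall>y\<in>carrier (base_change W).
                f (x \<oplus>\<^bsub>base_change W\<^esub> y) = f x \<oplus>\<^bsub>base_change W\<^esub> f y) \<and>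
             (\<forall>w\<in>carrier W. \<forall>a. f (tensor W w a) = tensor W w (frob a))"
  have "?P h" using h by (auto simp: smult_tensor)
  moreover have "f = h" if "?P f" for f
    by (rule bc_ext[where add' = "\<lambda>x y. x \<oplus>\<^bsub>B\<^esub> y"])
       (use that h in \<open>auto simp: smult_tensor\<close>)
  ultimately have "?P (THE f. ?P f)" by (rule theI)
  then have "?P (frob_space W)" unfolding frob_space_def .
  then show "frob_space W \<in> carrier B \<rightarrow> carrier B"
  "\<And>x y. x \<in> carrier B \<Longrightarrow> y \<in> carrier B \<Longrightarrow> frob_space W (x \<oplus>\<^bsub>B\<^esub> y) = frob_space W x \<oplus>\<^bsub>B\<^esub> frob_space W y"
  "\<And>w a. w \<in> carrier W \<Longrightarrow> frob_space W (tensor W w a) = tensor W w (frob a)" by blast+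
qed

lemma frob_space_pow:
  "(frob_space W ^^ i) \<in> carrier B \<rightarrow> carrier B"
  "\<And>x y. x \<in> carrier B \<Longrightarrow> y \<in> carrier B \<Longrightarrow>
     (frob_space W ^^ i) (x \<oplus>\<^bsub>B\<^esub> y) = (frob_space W ^^ i) x \<oplus>\<^bsub>B\<^esub> (frob_space W ^^ i) y"
  "\<And>w a. w \<in> carrier W \<Longrightarrow> (frob_space W ^^ i) (tensor W w a) = tensor W w ((frob ^^ i) a)"
proof (induction i)
  case (Suc i)
  have c: "(frob_space W ^^ i) x \<in> carrier B" if "x \<in> carrier B" for x using Suc(1) that by blast
  { case 1 show ?case using c frob_space(1) by auto }
  { case 2 then show ?case using Suc c by (simp add: frob_space) }
  { case 3 then show ?case using Suc by (simp add: frob_space) }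
qed auto

end

section \<open>Linear forms as \<open>k\<close>-linear maps\<close>

lemma dual_simps:
  "carrier (dual M) = lin_hom M scalar_line \<inter> extensional (carrier M)"
  "u \<oplus>\<^bsub>dual M\<^esub> u' = (\<lambda>x\<in>carrier M. u x + u' x)"
  "c \<odot>\<^bsub>dual M\<^esub> u = (\<lambda>x\<in>carrier M. c * u x)"
  "\<zero>\<^bsub>dual M\<^esub> = (\<lambda>x\<in>carrier M. 0)"
  by (simp_all add: dual_def)

lemma form_iff:
  "u \<in> carrier (dual M) \<longleftrightarrow> u \<in> extensional (carrier M) \<and>
     (\<forall>x\<in>carrier M. \<forall>y\<in>carrier M. u (x \<oplus>\<^bsub>M\<^esub> y) = u x + u y) \<and> (\<forall>c. \<forall>x\<in>carrier M. u (c \<odot>\<^bsub>M\<^esub> x) = c * u x)"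
  by (auto simp: dual_def lin_hom_iff scalar_line_simps)

lemma vsp_dual:
  assumes "vsp M" shows "vsp (dual M)"
proof -
  interpret vsp M by (rule assms)
  have z: "\<zero>\<^bsub>dual M\<^esub> = (\<lambda>x\<in>carrier M. 0)" "\<And>u u'. u \<oplus>\<^bsub>dual M\<^esub> u' = (\<lambda>x\<in>carrier M. u x + u' x)"
    "\<And>c u. c \<odot>\<^bsub>dual M\<^esub> u = (\<lambda>x\<in>carrier M. c * u x)" by (simp_all add: dual_def)
  show ?thesis
  proof (intro vsp.intro vs_criteria[OF class_field])
    show "\<forall>v\<in>carrier (dual M). \<exists>w\<in>carrier (dual M). v \<oplus>\<^bsub>dual M\<^esub> w = \<zero>\<^bsub>dual M\<^esub>"
    proof
      fix v assume "v \<in> carrier (dual M)"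
      then show "\<exists>w\<in>carrier (dual M). v \<oplus>\<^bsub>dual M\<^esub> w = \<zero>\<^bsub>dual M\<^esub>"
        by (intro bexI[of _ "\<lambda>x\<in>carrier M. - v x"]) (auto simp: form_iff z fun_eq_iff)
    qed
    show "\<forall>v\<in>carrier (dual M). v \<oplus>\<^bsub>dual M\<^esub> \<zero>\<^bsub>dual M\<^esub> = v"
      by (auto simp: form_iff z fun_eq_iff extensional_def)
    show "\<forall>v\<in>carrier (dual M). \<one>\<^bsub>class_ring\<^esub> \<odot>\<^bsub>dual M\<^esub> v = v"
      by (auto simp: form_iff z fun_eq_iff extensional_def)
  qed (auto simp: form_iff z fun_eq_iff algebra_simps)
qed

text \<open>These values determine the form, and by \<open>form_exists\<close> every k-linear map
  arises from a form; later arguments use them in place of tensors.\<close>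

definition val :: "('k :: field, 'w) module \<Rightarrow> (('w \<Rightarrow> 'k alg_closure) set \<Rightarrow> 'k alg_closure) \<Rightarrow> 'w \<Rightarrow> 'k alg_closure" where
  "val W l w = l (tensor W w 1)"

definition klin :: "('k :: field, 'w) module \<Rightarrow> ('w \<Rightarrow> 'k alg_closure) \<Rightarrow> bool" where
  "klin W lam \<longleftrightarrow> (\<forall>x\<in>carrier W. \<forall>y\<in>carrier W. lam (x \<oplus>\<^bsub>W\<^esub> y) = lam x + lam y) \<and>
     (\<forall>c. \<forall>x\<in>carrier W. lam (c \<odot>\<^bsub>W\<^esub> x) = to_ac c * lam x)"

lemma klinD:
  assumes "klin W lam"
  shows "x \<in> carrier W \<Longrightarrow> y \<in> carrier W \<Longrightarrow> lam (x \<oplus>\<^bsub>W\<^esub> y) = lam x + lam y"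
    "x \<in> carrier W \<Longrightarrow> lam (c \<odot>\<^bsub>W\<^esub> x) = to_ac c * lam x"
  using assms by (auto simp: klin_def)

lemma (in vsp) klin_0: "klin W lam \<Longrightarrow> lam \<zero> = 0"
  using klinD(2)[of W lam "\<zero>" 0] by simp

lemma (in vsp) klin_diff: "klin W lam \<Longrightarrow> x \<in> carrier W \<Longrightarrow> y \<in> carrier W \<Longrightarrow> lam (x \<ominus> y) = lam x - lam y"
  by (simp add: minus_smult1 klinD)

lemma (in vsp) klin_kernel_subspace: "klin W lam \<Longrightarrow> lin_subspace W {x \<in> carrier W. lam x = 0}"
  by (auto simp: subspace_iff klinD klin_0)

lemma (in vsp) klin_inj:
  assumes "klin W lam" "\<And>w. w \<in> carrier W \<Longrightarrow> lam w = 0 \<Longrightarrow> w = \<zero>"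
  shows "inj_on lam (carrier W)"
proof (rule inj_onI)
  fix x y assume "x \<in> carrier W" "y \<in> carrier W" "lam x = lam y"
  then show "x = y" using assms(2)[of "x \<ominus> y"] by (simp add: klin_diff[OF assms(1)])
qed

context fvsp
begin

lemma frob_space_smult: "x \<in> carrier B \<Longrightarrow> frob_space W (c \<odot>\<^bsub>B\<^esub> x) = frob c \<odot>\<^bsub>B\<^esub> frob_space W x"
proof (induction rule: bc_induct)
  case (add x y)
  then show ?case using frob_space(1) by (simp add: B.smult_r_distr frob_space Pi_iff)
qed (simp add: smult_tensor frob_space frob_mult)

lemma frob_space_pow_smult:
  "x \<in> carrier B \<Longrightarrow> (frob_space W ^^ i) (c \<odot>\<^bsub>B\<^esub> x) = (frob ^^ i) c \<odot>\<^bsub>B\<^esub> (frob_space W ^^ i) x"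
proof (induction i)
  case (Suc i)
  then show ?case using frob_space_pow(1)[of i] by (simp add: frob_space_smult Pi_iff)
qed auto

abbreviation "F \<equiv> forms W"

lemma vsp_forms: "vsp F" by (rule vsp_dual[OF vsp_bc])

sublocale F: vsp F by (rule vsp_forms)

lemma form_tensor:
  assumes "l \<in> carrier F" shows "l (tensor W w a) = a * val W l w"
proof -
  have "l (a \<odot>\<^bsub>B\<^esub> tensor W w 1) = a * val W l w" using assms by (simp add: form_iff val_def)
  then show ?thesis by (simp add: smult_tensor)
qed

lemma val_klin: "l \<in> carrier F \<Longrightarrow> klin W (val W l)"
  using form_tensor unfolding klin_def val_def
  by (simp add: tensor_add_left tensor_smult_left form_iff val_def)

lemma form_eqI:
  assumes "l \<in> carrier F" "l' \<in> carrier F" "\<And>w. w \<in> carrier W \<Longrightarrow> val W l w = val W l' w"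
  shows "l = l'"
  by (rule bc_ext[where add' = "(+)"]) (use assms in \<open>auto simp: form_iff form_tensor\<close>)

lemma form_exists:
  assumes "klin W lam"
  obtains l where "l \<in> carrier F" "\<And>w. w \<in> carrier W \<Longrightarrow> val W l w = lam w"
proof -
  obtain h where h: "h \<in> extensional (carrier B)"
    "\<And>x y. x \<in> carrier B \<Longrightarrow> y \<in> carrier B \<Longrightarrow> h (x \<oplus>\<^bsub>B\<^esub> y) = h x \<oplus>\<^bsub>scalar_line\<^esub> h y"
    "\<And>c x. x \<in> carrier B \<Longrightarrow> h (c \<odot>\<^bsub>B\<^esub> x) = c \<odot>\<^bsub>scalar_line\<^esub> h x"
    "\<And>w a. w \<in> carrier W \<Longrightarrow> h (tensor W w a) = a \<odot>\<^bsub>scalar_line\<^esub> lam w"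
    by (rule bc_lift[OF vsp_scalar_line, of "\<lambda>x. x" lam])
       (use assms in \<open>auto simp: scalar_line_simps klinD\<close>)
  show ?thesis by (rule that[of h]) (use h in \<open>auto simp: form_iff scalar_line_simps val_def\<close>)
qed

lemma val_simps:
  "val W (c \<odot>\<^bsub>F\<^esub> l) w = c * val W l w"
  "val W (l \<oplus>\<^bsub>F\<^esub> l') w = val W l w + val W l' w"
  "val W (\<zero>\<^bsub>F\<^esub>) w = 0"
  by (simp_all add: val_def dual_simps)

text \<open>The coefficients do not depend on the form. Hence if the values of a form are
  polynomials in t, so is its value at any fixed vector of the base change.\<close>

lemma form_coords:
  assumes "x \<in> carrier B"
  obtains f where "\<And>l. l \<in> carrier F \<Longrightarrow> l x = (\<Sum>w\<in>carrier W. f w * val W l w)"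
proof -
  obtain f where f: "f \<in> Fr" "x = bc_class W f" by (rule bc_cases[OF assms])
  have "\<forall>l\<in>carrier F. l (bc_class W f) = (\<Sum>w\<in>carrier W. f w * val W l w)" using f(1)
  proof (induction rule: free_induct)
    case zero
    then show ?case using tensor_0[of "\<zero>"] form_tensor[of _ "\<zero>" 0] by (simp add: bc_quot(4) restrict_def)
  next
    case (gen w a)
    have "(\<Sum>x\<in>carrier W. free_gen W w a x * val W l x) = a * val W l w" for l
      using gen fin by (subst sum.mono_neutral_cong_right[where S = "{w}" and h = "\<lambda>x. a * val W l x"]) (auto simp: free_gen_def)
    then show ?case by (simp add: tensor_bc[symmetric] form_tensor)
  next
    case (add f g)
    have "l (bc_class W (\<lambda>x\<in>carrier W. f x + g x)) = l (bc_class W f) + l (bc_class W g)" if "l \<in> carrier F" for l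
      using add that by (simp add: bc_quot(2)[symmetric] form_iff)
    then show ?case using add by (simp add: algebra_simps sum.distrib restrict_def)
  qed
  then show ?thesis using that f(2) by blast
qed

text \<open>Lets a linear combination of forms be given as an identity of scalar sums, with no
  finite sums taken in the dual module.\<close>

lemma form_sum_in_subspace:
  assumes D: "lin_subspace F D" and "finite I" "u \<in> carrier F" "\<And>i. i \<in> I \<Longrightarrow> v i \<in> D"
    and "\<And>w. w \<in> carrier W \<Longrightarrow> val W u w = (\<Sum>i\<in>I. b i * val W (v i) w)"
  shows "u \<in> D"
  using assms(2-)
proof (induction I arbitrary: u rule: finite_induct)
  case empty
  then have "u = \<zero>\<^bsub>F\<^esub>" by (intro form_eqI) (auto simp: val_simps)
  then show ?case using F.subspaceD(2)[OF D] by simp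
next
  case (insert i I)
  define u' where "u' = u \<oplus>\<^bsub>F\<^esub> (- b i) \<odot>\<^bsub>F\<^esub> v i"
  have vi: "v i \<in> D" "v i \<in> carrier F" using insert.prems(2)[of i] F.subspaceD(6)[OF D] by auto
  have "u' \<in> D"
  proof (rule insert.IH)
    show "u' \<in> carrier F" using insert.prems(1) vi by (simp add: u'_def)
    show "val W u' w = (\<Sum>i\<in>I. b i * val W (v i) w)" if "w \<in> carrier W" for w
      using insert.prems(3)[OF that] insert.hyps by (simp add: u'_def val_simps)
  qed (use insert.prems in auto)
  moreover have "u = u' \<oplus>\<^bsub>F\<^esub> b i \<odot>\<^bsub>F\<^esub> v i"
    by (rule form_eqI) (use insert.prems(1) vi in \<open>auto simp: u'_def val_simps\<close>)
  ultimately show ?case using F.subspaceD(3,4)[OF D] vi by simp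
qed

text \<open>Frobenius on W \<otimes> K fixes each w \<otimes> 1, so only the inverse Frobenius on
  the value remains. The result is linear because the two semilinear factors cancel.\<close>

lemma frob_twist:
  assumes l: "l \<in> carrier F"
  shows "frob_twist W i l \<in> carrier F" "val W (frob_twist W i l) w = (ifrob ^^ i) (val W l w)"
proof -
  note c = frob_space_pow(1)[of i, unfolded Pi_iff, rule_format]
  have frob: "(ifrob ^^ i) ((frob ^^ i) c) = c" for c :: "'k alg_closure"
    by (induction i) (simp_all add: funpow_swap1[of ifrob])
  show "frob_twist W i l \<in> carrier F"
    using l c by (auto simp: form_iff frob_twist_def frob_space_pow frob_space_pow_smult ifrob_pow_add ifrob_pow_mult frob)
  have "(frob ^^ i) (1 :: 'k alg_closure) = 1" by (induction i) auto
  then have "(frob_space W ^^ i) (tensor W w 1) = tensor W w 1" if "w \<in> carrier W"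
    using that by (simp add: frob_space_pow)
  \<comment> \<open>Outside the carrier the generator is the zero function, so the formula holds for
    every \<open>w\<close>.\<close>
  moreover have "tensor W w 1 = \<zero>\<^bsub>B\<^esub>" if "w \<notin> carrier W"
    unfolding tensor_bc bc_quot(4) using that by (auto simp: free_gen_def intro!: arg_cong[of _ _ "bc_class W"])
  moreover have "(frob_space W ^^ i) \<zero>\<^bsub>B\<^esub> = \<zero>\<^bsub>B\<^esub>"
  proof -
    have "(frob ^^ i) (0 :: 'k alg_closure) = 0" by (induction i) auto
    then show ?thesis using frob_space_pow(3)[of "\<zero>" i 0] by (simp add: tensor_0)
  qed
  ultimately show "val W (frob_twist W i l) w = (ifrob ^^ i) (val W l w)"
    by (cases "w \<in> carrier W") (auto simp: val_def frob_twist_def)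
qed

lemma fvsp_quot:
  assumes "lin_subspace W U" shows "fvsp (quot W U)"
  using vsp_quot[OF assms] fin by (simp add: fvsp_def fvsp_axioms_def quot_simps[OF assms])

lemma fvsp_on:
  assumes "lin_subspace W U" shows "fvsp (on W U)"
  using vsp_on[OF assms] fin subspaceD(1)[OF assms] by (auto simp: fvsp_def fvsp_axioms_def intro: finite_subset)

end

lemma pull_form:
  fixes W :: "('k :: {field, finite}, 'w) module" and W' :: "('k, 'x) module"
  assumes W: "fvsp W" and W': "fvsp W'" and T: "T \<in> lin_hom W W'" and l: "l \<in> carrier (forms W')"
  shows "pull_form W W' T l \<in> carrier (forms W)"
    and "w \<in> carrier W \<Longrightarrow> val W (pull_form W W' T l) w = val W' l (T w)"
proof -
  interpret W: fvsp W by (rule W)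
  note b = base_change_map[OF W W' T]
  show "pull_form W W' T l \<in> carrier (forms W)"
    using b(1) l by (auto simp: pull_form_def form_iff lin_hom_iff compose_def Pi_iff)
  show "w \<in> carrier W \<Longrightarrow> val W (pull_form W W' T l) w = val W' l (T w)"
    by (simp add: val_def pull_form_def compose_def b(3))
qed

context fvsp
begin

lemma klin_quot_exists:
  assumes U: "lin_subspace W U" and k: "klin W lam" and 0: "\<And>u. u \<in> U \<Longrightarrow> lam u = 0"
  obtains \<mu> where "klin (quot W U) \<mu>" "\<And>w. w \<in> carrier W \<Longrightarrow> \<mu> (U +> w) = lam w"
proof -
  define \<mu> where "\<mu> Y = lam (SOME w. w \<in> carrier W \<and> U +> w = Y)" for Y
  have \<mu>: "\<mu> (U +> w) = lam w" if w: "w \<in> carrier W" for w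
  proof -
    let ?w = "SOME w'. w' \<in> carrier W \<and> U +> w' = U +> w"
    have *: "?w \<in> carrier W \<and> U +> ?w = U +> w" by (rule someI[of _ w]) (use w in simp)
    then have "?w \<ominus> w \<in> U" using coset_eq_iff[OF U, of ?w w] w by blast
    then have "lam (?w \<ominus> w) = 0" by (rule 0)
    then show ?thesis using * w by (simp add: klin_diff[OF k] \<mu>_def)
  qed
  show ?thesis
    by (rule that[of \<mu>]) (auto simp: klin_def quot_simps[OF U] \<mu> klinD[OF k])
qed

lemma induced_form:
  assumes U: "lin_subspace W U" and l: "l \<in> carrier F" and 0: "\<And>u. u \<in> U \<Longrightarrow> val W l u = 0"
  shows "induced_form W U l \<in> carrier (forms (quot W U))"
    "\<And>w. w \<in> carrier W \<Longrightarrow> val (quot W U) (induced_form W U l) (U +> w) = val W l w"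
proof -
  interpret Q: fvsp "quot W U" by (rule fvsp_quot[OF U])
  obtain \<mu> where \<mu>: "klin (quot W U) \<mu>" "\<And>w. w \<in> carrier W \<Longrightarrow> \<mu> (U +> w) = val W l w"
    using klin_quot_exists[OF U val_klin[OF l] 0] by blast
  obtain m where m: "m \<in> carrier (forms (quot W U))" "\<And>y. y \<in> carrier (quot W U) \<Longrightarrow> val (quot W U) m y = \<mu> y"
    using Q.form_exists[OF \<mu>(1)] by blast
  note pull = pull_form[OF fvsp_axioms Q.fvsp_axioms quot_hom[OF U]]
  let ?P = "\<lambda>l'. l' \<in> carrier (forms (quot W U)) \<and> pull_form W (quot W U) (\<lambda>w. U +> w) l' = l"
  have qc: "U +> w \<in> carrier (quot W U)" if "w \<in> carrier W" for w using that by (auto simp: quot_simps[OF U])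
  have "?P m"
    using m pull l qc by (auto intro!: form_eqI simp: \<mu>(2))
  moreover have "l' = m" if "?P l'" for l'
  proof (rule Q.form_eqI)
    fix y assume "y \<in> carrier (quot W U)"
    then obtain w where w: "w \<in> carrier W" "y = U +> w" by (auto simp: quot_simps[OF U])
    then have "val (quot W U) l' y = val W l w" using that pull(2)[of l' w] by simp
    then show "val (quot W U) l' y = val (quot W U) m y" using w m(2) qc \<mu>(2) by simp
  qed (use that m in auto)
  ultimately have "induced_form W U l = m" unfolding induced_form_def by (rule the_equality)
  then show "induced_form W U l \<in> carrier (forms (quot W U))"
    "\<And>w. w \<in> carrier W \<Longrightarrow> val (quot W U) (induced_form W U l) (U +> w) = val W l w"
    using m qc \<mu>(2) by simp_all
qed

end

section \<open>General and projective linear groups\<close>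

lemma GL_iff: "f \<in> carrier (GL M) \<longleftrightarrow> f \<in> extensional (carrier M) \<and> bij_betw f (carrier M) (carrier M) \<and> f \<in> lin_hom M M"
  by (auto simp: GL_def Bij_def)

lemma GL_mult:
  assumes "f \<in> carrier (GL M)" "g \<in> carrier (GL M)"
  shows "f \<otimes>\<^bsub>GL M\<^esub> g = compose (carrier M) f g"
  using assms by (simp add: GL_def BijGroup_def)

context vsp
begin

lemma GL_D:
  assumes "f \<in> carrier (GL W)"
  shows "f \<in> lin_hom W W" "\<And>x. x \<in> carrier W \<Longrightarrow> f x \<in> carrier W" "f ` carrier W = carrier W" "inj_on f (carrier W)"
    "\<And>x y. x \<in> carrier W \<Longrightarrow> y \<in> carrier W \<Longrightarrow> f (x \<oplus> y) = f x \<oplus> f y"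
    "\<And>c x. x \<in> carrier W \<Longrightarrow> f (c \<odot> x) = c \<odot> f x" "f \<in> extensional (carrier W)"
  using assms by (auto simp: GL_iff bij_betw_def lin_hom_iff)

lemma GL_I:
  assumes "f \<in> extensional (carrier W)" "f ` carrier W = carrier W" "inj_on f (carrier W)"
    "\<And>x y. x \<in> carrier W \<Longrightarrow> y \<in> carrier W \<Longrightarrow> f (x \<oplus> y) = f x \<oplus> f y"
    "\<And>c x. x \<in> carrier W \<Longrightarrow> f (c \<odot> x) = c \<odot> f x"
  shows "f \<in> carrier (GL W)"
  using assms by (auto simp: GL_iff bij_betw_def lin_hom_iff)

lemma GL_inv:
  assumes f: "f \<in> carrier (GL W)"
  defines "f' \<equiv> restrict (inv_into (carrier W) f) (carrier W)"
  shows "f' \<in> carrier (GL W)" "\<And>x. x \<in> carrier W \<Longrightarrow> f (f' x) = x" "\<And>x. x \<in> carrier W \<Longrightarrow> f' (f x) = x"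
proof -
  note d = GL_D[OF f]
  show 1: "\<And>x. x \<in> carrier W \<Longrightarrow> f (f' x) = x" using d(3) by (simp add: f'_def f_inv_into_f)
  show 2: "\<And>x. x \<in> carrier W \<Longrightarrow> f' (f x) = x" using d by (simp add: f'_def)
  have c: "\<And>x. x \<in> carrier W \<Longrightarrow> f' x \<in> carrier W" using d(3) by (simp add: f'_def inv_into_into)
  show "f' \<in> carrier (GL W)"
  proof (rule GL_I)
    show "f' ` carrier W = carrier W"
      using c 2 d(2) by (auto simp: image_iff) metis
    show "inj_on f' (carrier W)" by (rule inj_on_inverseI[where g = f]) (rule 1)
    show "f' (x \<oplus> y) = f' x \<oplus> f' y" if "x \<in> carrier W" "y \<in> carrier W" for x y
      using d(5)[OF c[OF that(1)] c[OF that(2)]] 2[of "f' x \<oplus> f' y"] that c by (simp add: 1)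
    show "f' (a \<odot> x) = a \<odot> f' x" if "x \<in> carrier W" for a x
      using d(6)[OF c[OF that], of a] 2[of "a \<odot> f' x"] that c by (simp add: 1)
  qed (simp add: f'_def)
qed

lemma GL_scale:
  assumes f: "f \<in> carrier (GL W)" and "c \<noteq> 0"
  shows "(\<lambda>x\<in>carrier W. c \<odot> f x) \<in> carrier (GL W)"
proof (rule GL_I)
  note d = GL_D[OF f]
  show "inj_on (\<lambda>x\<in>carrier W. c \<odot> f x) (carrier W)"
  proof (rule inj_onI)
    fix x y assume xy: "x \<in> carrier W" "y \<in> carrier W"
      "(\<lambda>x\<in>carrier W. c \<odot> f x) x = (\<lambda>x\<in>carrier W. c \<odot> f x) y"
    then have "inverse c \<odot> (c \<odot> f x) = inverse c \<odot> (c \<odot> f y)" by simp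
    then have "f x = f y" using xy(1,2) d(2) assms(2) by (simp add: smult_smult)
    then show "x = y" using xy d(4) by (auto dest: inj_onD)
  qed
  show "(\<lambda>x\<in>carrier W. c \<odot> f x) ` carrier W = carrier W"
  proof (intro equalityI subsetI)
    fix y assume y: "y \<in> carrier W"
    then obtain x where x: "x \<in> carrier W" "f x = inverse c \<odot> y" using d(3) by (metis imageE smult_closed)
    then have "c \<odot> f x = y" using y assms(2) by (simp add: smult_smult)
    then show "y \<in> (\<lambda>x\<in>carrier W. c \<odot> f x) ` carrier W" using x(1) by force
  qed (use d(2) in auto)
qed (use GL_D[OF f] in \<open>auto simp: smult_r_distr smult_smult mult.commute\<close>)

lemma GL_id: "(\<lambda>x\<in>carrier W. x) \<in> carrier (GL W)"
  by (rule GL_I) (auto simp: inj_on_def)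

lemma pgl_class_eq:
  assumes f: "f \<in> carrier (GL W)"
  shows "pgl_class W f = {\<lambda>x\<in>carrier W. c \<odot> f x | c. c \<noteq> 0}"
proof -
  have "(\<lambda>x\<in>carrier W. c \<odot> x) \<otimes>\<^bsub>GL W\<^esub> f = (\<lambda>x\<in>carrier W. c \<odot> f x)" if "c \<noteq> 0" for c
  proof -
    have "(\<lambda>x\<in>carrier W. c \<odot> x) = (\<lambda>x\<in>carrier W. c \<odot> (\<lambda>x\<in>carrier W. x) x)" by (auto simp: fun_eq_iff)
    then have "(\<lambda>x\<in>carrier W. c \<odot> x) \<in> carrier (GL W)" using GL_scale[OF GL_id that] by simp
    then show ?thesis using f GL_D[OF f] by (auto simp: GL_mult compose_def fun_eq_iff)
  qed
  then show ?thesis unfolding pgl_class_def r_coset_def scalars_def by auto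
qed

lemma pgl_class_GL: "f \<in> carrier (GL W) \<Longrightarrow> h \<in> pgl_class W f \<Longrightarrow> h \<in> carrier (GL W)"
  by (auto simp: pgl_class_eq intro: GL_scale)

lemma pgl_class_self: "f \<in> carrier (GL W) \<Longrightarrow> f \<in> pgl_class W f"
  unfolding pgl_class_eq by (intro CollectI exI[of _ 1]) (auto simp: fun_eq_iff GL_iff extensional_def lin_hom_iff Pi_iff)

end

lemma PGL_cases:
  assumes "g \<in> carrier (PGL M)"
  obtains f where "f \<in> carrier (GL M)" "g = pgl_class M f"
  using assms by (auto simp: PGL_def FactGroup_def RCOSETS_def pgl_class_def)

text \<open>Conjugation by \<psi> commutes with scalars, so transporting all representatives of a
  class gives all representatives of one class.\<close>

lemma pgl_transport_class:
  fixes M :: "('f :: field, 'v) module" and N :: "('f, 'w) module"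
  assumes M: "vsp M" and N: "vsp N" and \<psi>: "\<psi> \<in> lin_hom M N" "bij_betw \<psi> (carrier M) (carrier N)"
    and f: "f \<in> carrier (GL M)"
  obtains f' where "f' \<in> carrier (GL N)" "\<And>x. x \<in> carrier M \<Longrightarrow> f' (\<psi> x) = \<psi> (f x)"
    "pgl_transport M N \<psi> (pgl_class M f) = pgl_class N f'"
proof -
  interpret M: vsp M by (rule M)
  interpret N: vsp N by (rule N)
  let ?i = "inv_into (carrier M) \<psi>"
  have i: "?i (\<psi> x) = x" if "x \<in> carrier M" for x using \<psi>(2) that by (simp add: bij_betw_def)
  have im: "\<psi> ` carrier M = carrier N" using \<psi>(2) by (simp add: bij_betw_def)
  have p: "\<psi> x \<in> carrier N" if "x \<in> carrier M" for x using im that by blast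
  have pa: "\<psi> (x \<oplus>\<^bsub>M\<^esub> y) = \<psi> x \<oplus>\<^bsub>N\<^esub> \<psi> y" "\<psi> (c \<odot>\<^bsub>M\<^esub> x) = c \<odot>\<^bsub>N\<^esub> \<psi> x" if "x \<in> carrier M" "y \<in> carrier M" for x y c
    using \<psi>(1) that by (auto simp: lin_hom_iff)
  define f' where "f' = (\<lambda>y\<in>carrier N. \<psi> (f (?i y)))"
  have f': "f' (\<psi> x) = \<psi> (f x)" if "x \<in> carrier M" for x using that by (simp add: f'_def p i)
  note d = M.GL_D[OF f]
  have G: "f' \<in> carrier (GL N)"
  proof (rule N.GL_I)
    show "f' ` carrier N = carrier N"
      unfolding im[symmetric] image_image by (simp add: f' cong: image_cong) (metis d(3) image_image)
    show "inj_on f' (carrier N)"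
      unfolding im[symmetric]
    proof (rule inj_onI, clarify)
      fix x y assume xy: "x \<in> carrier M" "y \<in> carrier M" "f' (\<psi> x) = f' (\<psi> y)"
      then have "f x = f y" using d(2) i by (metis f')
      then show "\<psi> x = \<psi> y" using xy d(4) by (auto dest: inj_onD)
    qed
    show "f' (x \<oplus>\<^bsub>N\<^esub> y) = f' x \<oplus>\<^bsub>N\<^esub> f' y" if xy: "x \<in> carrier N" "y \<in> carrier N" for x y
    proof -
      obtain x' y' where *: "x' \<in> carrier M" "y' \<in> carrier M" "x = \<psi> x'" "y = \<psi> y'" using xy im by blast
      then show ?thesis using f'[of "x' \<oplus>\<^bsub>M\<^esub> y'"] by (simp add: pa d f')
    qed
    show "f' (c \<odot>\<^bsub>N\<^esub> x) = c \<odot>\<^bsub>N\<^esub> f' x" if xy: "x \<in> carrier N" for x c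
    proof -
      obtain x' where *: "x' \<in> carrier M" "x = \<psi> x'" using xy im by blast
      then show ?thesis using f'[of "c \<odot>\<^bsub>M\<^esub> x'"] by (simp add: pa d f')
    qed
  qed (simp add: f'_def)
  have eq: "(\<lambda>y\<in>carrier N. \<psi> ((\<lambda>x\<in>carrier M. c \<odot>\<^bsub>M\<^esub> f x) (?i y))) = (\<lambda>y\<in>carrier N. c \<odot>\<^bsub>N\<^esub> f' y)" for c
  proof (rule restrict_ext)
    fix y assume "y \<in> carrier N"
    then obtain x where x: "x \<in> carrier M" "y = \<psi> x" using im by blast
    then show "\<psi> ((\<lambda>x\<in>carrier M. c \<odot>\<^bsub>M\<^esub> f x) (?i y)) = c \<odot>\<^bsub>N\<^esub> f' y"
      by (simp add: i f' pa d)
  qed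
  have "pgl_transport M N \<psi> (pgl_class M f) = pgl_class N f'"
    unfolding pgl_transport_def M.pgl_class_eq[OF f] N.pgl_class_eq[OF G] eq[symmetric] by blast
  then show ?thesis using that G f' by blast
qed

text \<open>Pullback along the inverse of \<open>f\<close> is a two-sided inverse, which is checked
  on values.\<close>

lemma pull_GL:
  fixes W :: "('k :: {field, finite}, 'w) module"
  assumes W: "fvsp W" and f: "f \<in> carrier (GL W)"
  shows "(\<lambda>u\<in>carrier (forms W). pull_form W W f u) \<in> carrier (GL (forms W))"
proof -
  interpret W: fvsp W by (rule W)
  obtain f' where f': "f' \<in> carrier (GL W)" "\<And>x. x \<in> carrier W \<Longrightarrow> f (f' x) = x" "\<And>x. x \<in> carrier W \<Longrightarrow> f' (f x) = x"
    using W.GL_inv[OF f] by blast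
  note p = pull_form[OF W W W.GL_D(1)[OF f]] and p' = pull_form[OF W W W.GL_D(1)[OF f'(1)]]
  note d = W.GL_D[OF f] and d' = W.GL_D[OF f'(1)]
  have pp: "pull_form W W f' (pull_form W W f u) = u" "pull_form W W f (pull_form W W f' u) = u" if "u \<in> carrier (forms W)" for u
    using that by (auto intro!: W.form_eqI simp: p p' d d' f')
  show ?thesis
  proof (rule W.F.GL_I)
    show "(\<lambda>u\<in>carrier (forms W). pull_form W W f u) ` carrier (forms W) = carrier (forms W)"
    proof (intro equalityI subsetI)
      fix u assume "u \<in> carrier (forms W)"
      then show "u \<in> (\<lambda>u\<in>carrier (forms W). pull_form W W f u) ` carrier (forms W)"
        by (intro image_eqI[of _ _ "pull_form W W f' u"]) (simp_all add: pp p')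
    qed (use p in auto)
    show "inj_on (\<lambda>u\<in>carrier (forms W). pull_form W W f u) (carrier (forms W))"
      by (rule inj_on_inverseI[where g = "pull_form W W f'"]) (simp add: pp)
  qed (auto intro!: W.form_eqI simp: p d W.val_simps)
qed

section \<open>Condition (F)\<close>

context fvsp
begin

lemma frob_twist_0: "l \<in> carrier F \<Longrightarrow> frob_twist W 0 l = l"
  by (rule form_eqI) (simp_all add: frob_twist)

text \<open>The predicate \<open>P\<close> covers both spans in condition (F), that of all twists
  and the truncated one.\<close>

lemma span_twists:
  assumes "l \<in> carrier F"
  shows "lin_subspace F (LinearCombinations.module.span class_ring F {frob_twist W (j * d) l | j. P j})"
    "P j \<Longrightarrow> frob_twist W (j * d) l \<in> LinearCombinations.module.span class_ring F {frob_twist W (j * d) l | j. P j}"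
    "lin_subspace F D \<Longrightarrow> (\<And>j. P j \<Longrightarrow> frob_twist W (j * d) l \<in> D) \<Longrightarrow>
       LinearCombinations.module.span class_ring F {frob_twist W (j * d) l | j. P j} \<subseteq> D"
proof -
  have s: "{frob_twist W (j * d) l | j. P j} \<subseteq> carrier F" using frob_twist(1)[OF assms] by blast
  show "lin_subspace F (LinearCombinations.module.span class_ring F {frob_twist W (j * d) l | j. P j})"
    by (rule vectorspace.span_is_subspace[OF F.vs s])
  show "P j \<Longrightarrow> frob_twist W (j * d) l \<in> LinearCombinations.module.span class_ring F {frob_twist W (j * d) l | j. P j}"
    using LinearCombinations.module.in_own_span[OF F.module s] by blast
  assume D: "lin_subspace F D" "\<And>j. P j \<Longrightarrow> frob_twist W (j * d) l \<in> D"
  have 1: "{frob_twist W (j * d) l | j. P j} \<subseteq> D" using D(2) by blast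
  have 2: "submodule class_ring D F" using D(1) by (simp add: VectorSpace.subspace_def)
  show "LinearCombinations.module.span class_ring F {frob_twist W (j * d) l | j. P j} \<subseteq> D"
    by (rule LinearCombinations.module.span_is_subset[OF F.module 1 2])
qed

text \<open>The form \<open>l\<close> is its own twist with index 0, so it lies in \<open>U\<close>,
  and the clause i = 0 makes it an eigenvector of a representative of the transpose. Changing that
  representative changes only the eigenvalue.\<close>

lemma condition_F_imp_eigenform:
  assumes l: "l \<in> carrier F" and f: "f \<in> carrier (GL W)" and cF: "condition_F W l (pgl_class W f)"
  obtains c where "c \<noteq> 0" "\<And>w. w \<in> carrier W \<Longrightarrow> val W l (f w) = c * val W l w"
proof -
  from cF obtain d U where d: "0 < d" and U: "U = LinearCombinations.module.span class_ring F {frob_twist W (j * d) l | j. True}"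
    and ex: "\<exists>a\<in>subfield_of_degree d - {0}. \<exists>\<phi>\<in>pgl_transpose W (pgl_class W f).
        \<forall>i<d. \<forall>u\<in>frob_twist W i ` U. \<phi> u = (ifrob ^^ i) a \<odot>\<^bsub>F\<^esub> u"
    unfolding condition_F_def Let_def by (elim exE conjE) (rule that, assumption+)
  from ex obtain a \<phi> where a: "a \<noteq> 0" and \<phi>: "\<phi> \<in> pgl_transpose W (pgl_class W f)"
    and *: "\<And>i u. i < d \<Longrightarrow> u \<in> frob_twist W i ` U \<Longrightarrow> \<phi> u = (ifrob ^^ i) a \<odot>\<^bsub>F\<^esub> u"
    by (elim bexE) auto
  have "l \<in> U" using span_twists(2)[OF l, of "\<lambda>_. True" 0 d] frob_twist_0[OF l] by (simp add: U)
  then have "l \<in> frob_twist W 0 ` U" using frob_twist_0[OF l] by force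
  then have \<phi>l: "\<phi> l = a \<odot>\<^bsub>F\<^esub> l" using *[OF d] by simp
  obtain f' where f': "f' \<in> pgl_class W f" "\<phi> \<in> pgl_class F (\<lambda>u\<in>carrier F. pull_form W W f' u)"
    using \<phi> unfolding pgl_transpose_def by blast
  note G = pgl_class_GL[OF f f'(1)]
  obtain c' where c': "c' \<noteq> 0" "\<phi> = (\<lambda>u\<in>carrier F. c' \<odot>\<^bsub>F\<^esub> (\<lambda>u\<in>carrier F. pull_form W W f' u) u)"
    using f'(2) unfolding F.pgl_class_eq[OF pull_GL[OF fvsp_axioms G]] by blast
  obtain c'' where c'': "c'' \<noteq> 0" "f' = (\<lambda>x\<in>carrier W. c'' \<odot> f x)"
    using f'(1) unfolding pgl_class_eq[OF f] by blast
  \<comment> \<open>\<open>c'\<close> comes from the choice of representative in the class on forms,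
    \<open>c''\<close> from the representative \<open>f'\<close> of the class of
    \<open>f\<close>.\<close>
  have "val W l (f w) = (a / (c' * to_ac c'')) * val W l w" if w: "w \<in> carrier W" for w
  proof -
    have "a * val W l w = val W (\<phi> l) w" by (simp add: \<phi>l val_simps)
    also have "\<dots> = c' * val W l (f' w)"
      using l w by (simp add: c'(2) val_simps pull_form[OF fvsp_axioms fvsp_axioms GL_D(1)[OF G]])
    also have "\<dots> = c' * to_ac c'' * val W l (f w)"
      using w GL_D(2)[OF f w] by (simp add: c''(2) klinD[OF val_klin[OF l]])
    finally show ?thesis using c'(1) c''(1) by (simp add: field_simps)
  qed
  then show ?thesis using that[of "a / (c' * to_ac c'')"] a c'(1) c''(1) by simp
qed

text \<open>\<open>E\<close> is \<open>{e. e L \<subseteq> L}\<close> for \<open>L = lam W\<close>.\<close>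

lemma multiplier_field:
  assumes k: "klin W lam" and inj: "\<And>w. w \<in> carrier W \<Longrightarrow> lam w = 0 \<Longrightarrow> w = \<zero>"
    and nt: "carrier W \<noteq> {\<zero>}"
  obtains E d e where "subfield E class_ring" "range to_ac \<subseteq> E" "finite E" "0 < d"
    "ring.dimension class_ring d (range to_ac) E" "card E = CARD('k) ^ d"
    "ring.dimension class_ring e E (lam ` carrier W)" "card (carrier W) = CARD('k) ^ (d * e)"
    "\<And>c. (\<And>w. w \<in> carrier W \<Longrightarrow> c * lam w \<in> lam ` carrier W) \<Longrightarrow> c \<in> E"
proof -
  define L where "L = lam ` carrier W"
  define E where "E = {e. \<forall>x\<in>L. e * x \<in> L}"
  have finL: "finite L" using fin by (simp add: L_def)
  have L0: "0 \<in> L" unfolding L_def using klin_0[OF k] zero_closed by (metis image_eqI)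
  have Lp: "x + y \<in> L" if "x \<in> L" "y \<in> L" for x y
    using that unfolding L_def by (auto simp: klinD[OF k, symmetric])
  have Lm: "x - y \<in> L" if "x \<in> L" "y \<in> L" for x y
    using that unfolding L_def by (auto simp: klin_diff[OF k, symmetric])
  obtain w0 where w0: "w0 \<in> carrier W" "w0 \<noteq> \<zero>" using nt zero_closed by blast
  then have x0: "lam w0 \<in> L" "lam w0 \<noteq> 0" using inj[of w0] by (auto simp: L_def)
  \<comment> \<open>Evaluating multipliers at one nonzero element of \<open>L\<close> embeds
    \<open>E\<close> into the finite set \<open>L\<close>.\<close>
  have "inj_on (\<lambda>e. e * lam w0) E" "(\<lambda>e. e * lam w0) ` E \<subseteq> L"
    using x0 by (auto simp: inj_on_def E_def)
  then have finE: "finite E" using finL by (meson inj_on_finite)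
  have E1: "1 \<in> E" by (simp add: E_def)
  have Em: "x * y \<in> E" if "x \<in> E" "y \<in> E" for x y
    using that by (auto simp: E_def mult.assoc)
  have E: "subfield E class_ring"
  proof (rule subfield_class_ringI[OF E1 _ Em])
    show "x - y \<in> E" if "x \<in> E" "y \<in> E" for x y
      using that Lm by (auto simp: E_def left_diff_distrib)
    show "inverse x \<in> E" if "x \<in> E" for x
      by (rule finite_subring_inverse[OF finE E1 Em that])
  qed
  have sub: "range to_ac \<subseteq> E"
    by (auto simp: E_def L_def klinD[OF k, symmetric])
  obtain d where d: "ring.dimension class_ring d (range to_ac) E"
    by (rule finite_subalgebra_dimension[OF range_to_ac_subfield finE])
       (use subfield_class_ringD[OF E] sub in auto)
  have cE: "card E = CARD('k) ^ d"
    using card_eq_power_dimension[OF range_to_ac_subfield _ d] by (simp add: card_range_to_ac)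
  have "d \<noteq> 0"
  proof
    assume "d = 0"
    then have "card E = 1" using cE by simp
    then show False using E1 subfield_class_ringD(1)[OF E] by (metis card_1_singletonE singletonD zero_neq_one)
  qed
  obtain e where e: "ring.dimension class_ring e E L"
    by (rule finite_subalgebra_dimension[OF E finL L0 Lp]) (auto simp: E_def)
  have "card L = card (carrier W)"
    unfolding L_def by (rule card_image[OF klin_inj[OF k inj]])
  then have "card (carrier W) = CARD('k) ^ (d * e)"
    using card_eq_power_dimension[OF E finE e] cE by (simp add: power_mult)
  then show ?thesis
    using that[OF E sub finE _ d cE] e \<open>d \<noteq> 0\<close> unfolding L_def E_def by blast
qed

text \<open>The witnesses are the degree \<open>d\<close> of the multiplier field, the span
  \<open>D\<close> of the first \<open>e\<close> twists by multiples of \<open>d\<close>, and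
  \<open>c\<close> itself, which lies in \<open>E\<close> because c L is contained in L.\<close>

lemma eigenform_imp_condition_F:
  assumes l: "l \<in> carrier F" and inj: "\<And>w. w \<in> carrier W \<Longrightarrow> val W l w = 0 \<Longrightarrow> w = \<zero>"
    and nt: "carrier W \<noteq> {\<zero>}" and f: "f \<in> carrier (GL W)"
    and c: "c \<noteq> 0" "\<And>w. w \<in> carrier W \<Longrightarrow> val W l (f w) = c * val W l w"
  shows "condition_F W l (pgl_class W f)"
proof -
  let ?span = "LinearCombinations.module.span class_ring F"
  define m where "m = vectorspace.dim (class_ring :: 'k ring) W"
  let ?L = "val W l ` carrier W"
  obtain E d e where E: "subfield E class_ring" "range to_ac \<subseteq> E" "finite E" "0 < d"
    "ring.dimension class_ring d (range to_ac) E" "card E = CARD('k) ^ d"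
    "ring.dimension class_ring e E ?L" "card (carrier W) = CARD('k) ^ (d * e)"
    and cE: "\<And>c. (\<And>w. w \<in> carrier W \<Longrightarrow> c * val W l w \<in> ?L) \<Longrightarrow> c \<in> E"
    using multiplier_field[OF val_klin[OF l] inj nt] by blast
  have "c \<in> E" by (rule cE) (use c(2) GL_D(2)[OF f] in \<open>metis image_eqI\<close>)
  have fixd: "(ifrob ^^ d) x = x" "(ifrob ^^ (j * d)) x = x" if "x \<in> E" for x j
    using ifrob_pow_fixed[where d = d and x = x] finite_subfield_power_card(1)[OF E(1,3) that] E(6) by auto
  \<comment> \<open>Both exponents count the elements of W to the base q.\<close>
  have m: "m = d * e"
  proof -
    have "CARD('k) ^ m = CARD('k) ^ (d * e)"
      using finite_carrier_card(2)[OF fin_dim_finite[OF fin]] E(8) by (simp add: m_def)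
    then show ?thesis using power_inject_exp[OF card_field_gt_1] by blast
  qed
  obtain Us where Us: "length Us = e" "ring.Span class_ring E Us = ?L"
    using ring.exists_base[OF class_ring_ring E(1,7)] by blast
  obtain b where b: "b e = 1" "\<And>x. x \<in> ?L \<Longrightarrow> (\<Sum>i\<le>e. b i * ((ifrob ^^ d) ^^ i) x) = 0"
    using Span_annihilator[OF E(1), of "ifrob ^^ d" Us] Us fixd(1) by (auto simp: ifrob_pow_add ifrob_pow_mult)
  define D where "D = ?span {frob_twist W (j * d) l | j. j * d \<le> m - d}"
  have D: "lin_subspace F D" unfolding D_def by (rule span_twists(1)[OF l])
  \<comment> \<open>Below \<open>e\<close> the twist is one of the generators. From \<open>e\<close>
    on, the annihilating relation twisted s = j - e times expresses it by twists of smaller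
    index.\<close>
  have twD: "frob_twist W (j * d) l \<in> D" for j
  proof (induction j rule: less_induct)
    case (less j)
    show ?case
    proof (cases "j < e")
      case True
      \<comment> \<open>The truncation in (F) ends at m - d = (e - 1) d, which is exactly the index
        j = e - 1.\<close>
      then have "j * d \<le> m - d" using E(4) by (cases e) (auto simp: m mult.commute)
      then show ?thesis unfolding D_def by (rule span_twists(2)[OF l])
    next
      case False
      then obtain s where j: "j = e + s" by (metis le_Suc_ex not_less)
      show ?thesis
      proof (rule form_sum_in_subspace[OF D, where I = "{..<e}" and v = "\<lambda>i. frob_twist W ((i + s) * d) l"
              and b = "\<lambda>i. - (ifrob ^^ (s * d)) (b i)"])
        fix w assume w: "w \<in> carrier W"
        let ?x = "val W l w"
        have s0: "(ifrob ^^ n) (sum h A) = (\<Sum>i\<in>A. (ifrob ^^ n) (h i))" for n h and A :: "nat set"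
          by (induction A rule: infinite_finite_induct) (auto simp: ifrob_pow_add)
        have pow: "(ifrob ^^ (s * d)) (((ifrob ^^ d) ^^ i) y) = (ifrob ^^ ((i + s) * d)) y" for i and y :: "'k alg_closure"
        proof -
          have "(i + s) * d = s * d + d * i" by (simp add: algebra_simps)
          then show ?thesis by (simp only: funpow_mult funpow_add comp_apply)
        qed
        have "0 = (ifrob ^^ (s * d)) (\<Sum>i\<le>e. b i * ((ifrob ^^ d) ^^ i) ?x)"
          using b(2)[of ?x] w by simp
        also have "\<dots> = (\<Sum>i\<le>e. (ifrob ^^ (s * d)) (b i) * (ifrob ^^ ((i + s) * d)) ?x)"
          by (simp only: s0 ifrob_pow_mult pow)
        \<comment> \<open>Twisting the relation alters its coefficients but fixes the leading
          coefficient 1, so it can still be solved for the last term.\<close>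
        also have "\<dots> = (\<Sum>i<e. (ifrob ^^ (s * d)) (b i) * (ifrob ^^ ((i + s) * d)) ?x) + (ifrob ^^ (j * d)) ?x"
          using fixd(2)[of 1 s] subfield_class_ringD(2)[OF E(1)] b(1)
          by (simp only: lessThan_Suc_atMost[symmetric] sum.lessThan_Suc j mult_1)
        finally show "val W (frob_twist W (j * d) l) w =
           (\<Sum>i<e. - (ifrob ^^ (s * d)) (b i) * val W (frob_twist W ((i + s) * d) l) w)"
          by (simp add: frob_twist(2)[OF l] sum_negf eq_neg_iff_add_eq_0 add.commute)
      next
        show "frob_twist W ((i + s) * d) l \<in> D" if "i \<in> {..<e}" for i
          using that by (intro less) (simp add: j)
      qed (simp_all add: frob_twist(1)[OF l])
    qed
  qed
  have DU: "D = ?span {frob_twist W (j * d) l | j. True}"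
  proof (rule equalityI)
    show "D \<subseteq> ?span {frob_twist W (j * d) l | j. True}"
      unfolding D_def by (rule span_twists(3)[OF l span_twists(1)[OF l]]) (rule span_twists(2)[OF l], simp)
    show "?span {frob_twist W (j * d) l | j. True} \<subseteq> D"
      by (rule span_twists(3)[OF l D]) (rule twD)
  qed
  \<comment> \<open>The forms with eigenvalue exactly \<open>c\<close> are a subspace, and it
    contains every twist by a multiple of \<open>d\<close> because such twists fix elements of
    \<open>E\<close>.\<close>
  define Z where "Z = {u \<in> carrier F. \<forall>w\<in>carrier W. val W u (f w) = c * val W u w}"
  have "lin_subspace F Z"
    by (subst F.subspace_iff) (auto simp: Z_def val_simps algebra_simps)
  then have DZ: "D \<subseteq> Z"
    unfolding D_def by (rule span_twists(3)[OF l])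
      (auto simp: Z_def frob_twist[OF l] c(2) ifrob_pow_mult fixd(2)[OF \<open>c \<in> E\<close>])
  define \<phi> where "\<phi> = (\<lambda>u\<in>carrier F. pull_form W W f u)"
  have eig: "\<phi> u = (ifrob ^^ i) c \<odot>\<^bsub>F\<^esub> u" if u: "u \<in> frob_twist W i ` D" for i u
  proof -
    obtain u0 where u0: "u0 \<in> Z" "u = frob_twist W i u0" using u DZ by blast
    then have u0F: "u0 \<in> carrier F" by (simp add: Z_def)
    then have uF: "u \<in> carrier F" using frob_twist(1) u0(2) by simp
    note p = pull_form[OF fvsp_axioms fvsp_axioms GL_D(1)[OF f] uF]
    show ?thesis
    proof (rule form_eqI)
      show "val W (\<phi> u) w = val W ((ifrob ^^ i) c \<odot>\<^bsub>F\<^esub> u) w" if "w \<in> carrier W" for w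
        using that u0 uF GL_D(2)[OF f]
        by (simp add: \<phi>_def p[unfolded u0(2)] val_simps frob_twist(2)[OF u0F] Z_def ifrob_pow_mult)
    qed (use uF p in \<open>simp_all add: \<phi>_def\<close>)
  qed
  have \<phi>: "\<phi> \<in> pgl_transpose W (pgl_class W f)"
    unfolding pgl_transpose_def \<phi>_def
    by (rule UN_I[OF pgl_class_self[OF f]]) (rule F.pgl_class_self[OF pull_GL[OF fvsp_axioms f]])
  have cd: "c \<in> subfield_of_degree d - {0}"
    using subfield_of_degree_eqI[OF E(1,2,5,4)] \<open>c \<in> E\<close> c(1) by simp
  have "d dvd m" using m by simp
  show ?thesis
    unfolding condition_F_def Let_def
    by (rule exI[of _ d], rule exI[of _ D], fold m_def, intro conjI bexI[OF _ cd] bexI[OF _ \<phi>] allI impI ballI)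
       (rule E(4), rule \<open>d dvd m\<close>, rule DU, rule D_def, erule eig)
qed

section \<open>Semi-simplicity\<close>

text \<open>
  As \<open>f\<^sup>N = id\<close> for \<open>N = |E| - 1\<close>, the sum \<open>S z w\<close> of the \<open>f\<^sup>i w \<otimes> z\<^sup>i\<close> for \<open>i < N\<close> is an eigenvector for every
  nonzero \<open>z\<close> in \<open>E\<close>, and summing it over \<open>z\<close> gives \<open>w \<otimes> N\<close> because the power sums of \<open>E\<close> vanish.
\<close>

lemma eigenform_imp_eigenbasis:
  assumes k: "klin W lam" and inj: "\<And>w. w \<in> carrier W \<Longrightarrow> lam w = 0 \<Longrightarrow> w = \<zero>"
    and nt: "carrier W \<noteq> {\<zero>}" and f: "f \<in> carrier (GL W)"
    and c: "c \<noteq> 0" "\<And>w. w \<in> carrier W \<Longrightarrow> lam (f w) = c * lam w"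
  shows "\<exists>E. vectorspace.basis class_ring B E \<and>
        (\<forall>e\<in>E. \<exists>c. base_change_map W W f e = c \<odot>\<^bsub>B\<^esub> e)"
proof -
  obtain E d where E: "subfield E class_ring" "finite E" "0 < d" "card E = CARD('k) ^ d"
    and cE: "\<And>c. (\<And>w. w \<in> carrier W \<Longrightarrow> c * lam w \<in> lam ` carrier W) \<Longrightarrow> c \<in> E"
    using multiplier_field[OF k inj nt] by metis
  have "c \<in> E" by (rule cE) (use c(2) GL_D(2)[OF f] in \<open>metis image_eqI\<close>)
  note Ef = subfield_class_ringD[OF E(1)]
  define N where "N = card E - 1"
  have "1 < card E" using one_less_power[OF card_field_gt_1 E(3)] E(4) by metis
  then have N: "0 < N" by (simp add: N_def)
  have pw: "z ^ N = 1" if "z \<in> E" "z \<noteq> 0" for z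
    unfolding N_def by (rule finite_subfield_power_card(2)[OF E(1,2) that])
  have fc: "(f ^^ i) w \<in> carrier W" if "w \<in> carrier W" for i w
    using that GL_D(2)[OF f] by (induction i) auto
  have "lam ((f ^^ i) w) = c ^ i * lam w" if "w \<in> carrier W" for i w
    using that fc c(2) by (induction i) auto
  \<comment> \<open>The map \<open>lam\<close> is injective and turns \<open>f\<close> into
    multiplication by \<open>c\<close>, whose N-th power is 1.\<close>
  then have fN: "(f ^^ N) w = w" if "w \<in> carrier W" for w
    using klin_inj[OF k inj] that fc[OF that] pw[OF \<open>c \<in> E\<close> c(1)] by (metis inj_onD mult_1)
  let ?E = "E - {0}"
  have cardE: "card ?E = N" using E(2) Ef(1) by (simp add: N_def)
  \<comment> \<open>The order of \<open>E\<close> is a positive power of the characteristic, so N is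
    -1 in K.\<close>
  have Nz: "of_nat N \<noteq> (0 :: 'k alg_closure)"
  proof -
    obtain n where n: "CARD('k) = CHAR('k) ^ n" by (rule card_finite_field_eq_CHAR_power)
    with card_field_gt_1[where 'k = 'k] have "n \<noteq> 0" by (cases n) auto
    then have "of_nat (card E) = (0 :: 'k alg_closure)"
      using E(3,4) n of_nat_CHAR[where 'a = "'k alg_closure"] by (simp add: zero_power)
    moreover have "card E = N + 1" using \<open>1 < card E\<close> by (simp add: N_def)
    ultimately show ?thesis by auto
  qed
  \<comment> \<open>X^i - 1 has fewer than N roots, so some \<open>y\<close> in \<open>E\<close> has
    a nontrivial i-th power; reindexing by \<open>y\<close> multiplies the sum by
    \<open>y ^ i\<close>.\<close>
  have psum: "(\<Sum>z\<in>?E. z ^ i) = 0" if i: "0 < i" "i < N" for i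
  proof -
    define p :: "'k alg_closure poly" where "p = Polynomial.monom 1 i - 1"
    have p: "poly p x = x ^ i - 1" for x by (simp add: p_def poly_monom)
    have "poly p 0 \<noteq> 0" using i by (simp add: p power_0_left)
    then have p0: "p \<noteq> 0" by auto
    have "Polynomial.degree p \<le> i" by (auto simp: p_def intro!: degree_diff_le degree_monom_le)
    then have "card {x. poly p x = 0} < card ?E" using card_poly_roots_bound[OF p0] i cardE by simp
    then obtain y where y: "y \<in> ?E" "y ^ i \<noteq> 1"
      using card_mono[OF poly_roots_finite[OF p0], of ?E] by (force simp: p)
    have inj: "inj_on ((*) y) ?E" using y by (auto simp: inj_on_def)
    have im: "(*) y ` ?E = ?E" by (rule endo_inj_surj) (use E(2) inj y Ef(5) in auto)
    have "(\<Sum>z\<in>?E. z ^ i) = (\<Sum>z\<in>?E. (y * z) ^ i)"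
      by (subst (1) im[symmetric], subst sum.reindex[OF inj]) simp
    also have "\<dots> = y ^ i * (\<Sum>z\<in>?E. z ^ i)" by (simp add: power_mult_distrib sum_distrib_left)
    finally show ?thesis using y(2) by simp
  qed
  let ?T = "base_change_map W W f"
  note T = base_change_map[OF fvsp_axioms fvsp_axioms GL_D(1)[OF f]]
  have Ta: "?T (x \<oplus>\<^bsub>B\<^esub> y) = ?T x \<oplus>\<^bsub>B\<^esub> ?T y" "?T (a \<odot>\<^bsub>B\<^esub> x) = a \<odot>\<^bsub>B\<^esub> ?T x" "?T x \<in> carrier B"
    if "x \<in> carrier B" "y \<in> carrier B" for x y a
    using T(1) that by (auto simp: lin_hom_iff)
  \<comment> \<open>Partial sums by recursion, so that the shift identity becomes a plain induction
    on \<open>n\<close>.\<close>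
  define S where "S z w n = rec_nat \<zero>\<^bsub>B\<^esub> (\<lambda>i s. s \<oplus>\<^bsub>B\<^esub> tensor W ((f ^^ i) w) (z ^ i)) n" for z w n
  have S: "S z w 0 = \<zero>\<^bsub>B\<^esub>" "S z w (Suc n) = S z w n \<oplus>\<^bsub>B\<^esub> tensor W ((f ^^ n) w) (z ^ n)" for z w n
    by (simp_all add: S_def)
  have Sc: "S z w n \<in> carrier B" for z w n by (induction n) (simp_all add: S)
  \<comment> \<open>Applying f and multiplying by \<open>z\<close> moves each summand up one place;
    the vacated place i = 0 is filled by w \<otimes> 1.\<close>
  have shift: "z \<odot>\<^bsub>B\<^esub> ?T (S z w n) \<oplus>\<^bsub>B\<^esub> tensor W w 1 = S z w (Suc n)" if w: "w \<in> carrier W" for z w n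
  proof (induction n)
    case 0
    have "?T \<zero>\<^bsub>B\<^esub> = \<zero>\<^bsub>B\<^esub>" using Ta(2)[of "\<zero>\<^bsub>B\<^esub>" "\<zero>\<^bsub>B\<^esub>" 0] Ta(3)[of "\<zero>\<^bsub>B\<^esub>" "\<zero>\<^bsub>B\<^esub>"] by simp
    then show ?case by (simp add: S)
  next
    case (Suc n)
    have Tc: "?T (S z w n) \<in> carrier B" by (rule Ta(3)[OF Sc Sc])
    have "?T (S z w (Suc n)) = ?T (S z w n) \<oplus>\<^bsub>B\<^esub> tensor W ((f ^^ Suc n) w) (z ^ n)"
      using T(3)[OF fc[OF w, of n], of "z ^ n"] by (simp add: S(2) Ta(1)[OF Sc tensor_closed])
    then have "z \<odot>\<^bsub>B\<^esub> ?T (S z w (Suc n)) \<oplus>\<^bsub>B\<^esub> tensor W w 1 =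
        (z \<odot>\<^bsub>B\<^esub> ?T (S z w n) \<oplus>\<^bsub>B\<^esub> tensor W ((f ^^ Suc n) w) (z ^ Suc n)) \<oplus>\<^bsub>B\<^esub> tensor W w 1"
      using Tc by (simp add: B.smult_r_distr smult_tensor)
    also have "\<dots> = (z \<odot>\<^bsub>B\<^esub> ?T (S z w n) \<oplus>\<^bsub>B\<^esub> tensor W w 1) \<oplus>\<^bsub>B\<^esub> tensor W ((f ^^ Suc n) w) (z ^ Suc n)"
      using Tc by (simp add: B.a_ac)
    also have "\<dots> = S z w (Suc (Suc n))" by (simp only: Suc S(2)[of z w "Suc n"])
    finally show ?case .
  qed
  \<comment> \<open>At n = N the summand gained at the top is again w \<otimes> 1, since both f^N
    and z^N are trivial; cancelling it gives the eigenvalue 1/z.\<close>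
  have eigen: "?T (S z w N) = inverse z \<odot>\<^bsub>B\<^esub> S z w N" if "z \<in> ?E" "w \<in> carrier W" for z w
  proof -
    have "z \<odot>\<^bsub>B\<^esub> ?T (S z w N) \<oplus>\<^bsub>B\<^esub> tensor W w 1 = S z w N \<oplus>\<^bsub>B\<^esub> tensor W w 1"
      unfolding shift[OF that(2)] S using fN[OF that(2)] pw that(1) by simp
    then have "z \<odot>\<^bsub>B\<^esub> ?T (S z w N) = S z w N" using Ta(3)[OF Sc Sc] by (simp add: Sc)
    then show ?thesis using B.smult_cancel[OF Ta(3)[OF Sc Sc]] that(1) by blast
  qed
  define Ev where "Ev = {S z w N | z w. z \<in> ?E \<and> w \<in> carrier W}"
  have EvB: "Ev \<subseteq> carrier B" using Sc by (auto simp: Ev_def)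
  interpret BV: vectorspace "class_ring :: 'k alg_closure ring" B by (rule B.vs)
  have D: "lin_subspace B (BV.span Ev)" by (rule BV.span_is_subspace[OF EvB])
  note D' = B.subspaceD[OF D]
  have sumD: "finsum B h A \<in> BV.span Ev" if "\<And>a. a \<in> A \<Longrightarrow> h a \<in> BV.span Ev" for h and A :: "'k alg_closure set"
    using that
  proof (induction A rule: infinite_finite_induct)
    case (insert a A)
    then have "finsum B h (insert a A) = h a \<oplus>\<^bsub>B\<^esub> finsum B h A"
      using D'(6) by (intro B.finsum_insert) auto
    then show ?case using insert D'(3) by auto
  qed (use D'(2) in auto)
  have sumt: "finsum B (\<lambda>z. tensor W x (h z)) A = tensor W x (\<Sum>z\<in>A. h z)" if "finite A" for x h and A :: "'k alg_closure set"
    using that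
  proof (induction A rule: finite_induct)
    case (insert a A)
    then have "finsum B (\<lambda>z. tensor W x (h z)) (insert a A) = tensor W x (h a) \<oplus>\<^bsub>B\<^esub> finsum B (\<lambda>z. tensor W x (h z)) A"
      by (intro B.finsum_insert) auto
    then show ?case using insert by (simp add: tensor_add_right)
  qed (simp add: tensor_0)
  \<comment> \<open>Only the summand with i = 0 survives the summation over \<open>z\<close>, where
    it is counted N times.\<close>
  have total: "finsum B (\<lambda>z. S z w n) ?E = tensor W w (of_nat N)" if "0 < n" "n \<le> N" "w \<in> carrier W" for w n
    using that
  proof (induction n)
    case (Suc n)
    have "finsum B (\<lambda>z. S z w (Suc n)) ?E = finsum B (\<lambda>z. S z w n) ?E \<oplus>\<^bsub>B\<^esub> finsum B (\<lambda>z. tensor W ((f ^^ n) w) (z ^ n)) ?E"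
      unfolding S by (rule B.finsum_addf) (auto simp: Sc)
    also have "finsum B (\<lambda>z. tensor W ((f ^^ n) w) (z ^ n)) ?E = tensor W ((f ^^ n) w) (\<Sum>z\<in>?E. z ^ n)"
      using E(2) by (intro sumt) auto
    finally have *: "finsum B (\<lambda>z. S z w (Suc n)) ?E = finsum B (\<lambda>z. S z w n) ?E \<oplus>\<^bsub>B\<^esub> tensor W ((f ^^ n) w) (\<Sum>z\<in>?E. z ^ n)" .
    show ?case
    proof (cases "n = 0")
      case True
      then show ?thesis using * cardE by (simp add: S)
    next
      case False
      then show ?thesis using * Suc psum[of n] by (simp add: tensor_0)
    qed
  qed simp
  have tD: "tensor W w a \<in> BV.span Ev" if w: "w \<in> carrier W" for w a
  proof -
    have "finsum B (\<lambda>z. S z w N) ?E \<in> BV.span Ev"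
    proof (rule sumD)
      fix z assume "z \<in> ?E"
      then have "S z w N \<in> Ev" using w unfolding Ev_def by blast
      then show "S z w N \<in> BV.span Ev" using BV.in_own_span[OF EvB] by blast
    qed
    then have "tensor W w (of_nat N) \<in> BV.span Ev" using total[OF N order_refl w] by simp
    then have "(a / of_nat N) \<odot>\<^bsub>B\<^esub> tensor W w (of_nat N) \<in> BV.span Ev" by (rule D'(4))
    then show ?thesis using Nz by (simp add: smult_tensor)
  qed
  have "x \<in> BV.span Ev" if "x \<in> carrier B" for x
    using that by (induction rule: bc_induct) (use tD D'(3) in auto)
  then have gen: "BV.span Ev = carrier B" using D'(1) by blast
  have "finite Ev"
  proof -
    have "Ev = (\<lambda>(z, w). S z w N) ` (?E \<times> carrier W)" by (force simp: Ev_def)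
    then show ?thesis using E(2) fin by simp
  qed
  \<comment> \<open>A minimal generating subset of the finite set of eigenvectors is a
    basis.\<close>
  then have "\<exists>\<beta>. \<beta> \<subseteq> Ev \<and> minimal \<beta> (\<lambda>S. S \<subseteq> carrier B \<and> BV.gen_set S)"
    by (intro minimal_exists) (use EvB gen in auto)
  then obtain \<beta> where \<beta>: "\<beta> \<subseteq> Ev" "minimal \<beta> (\<lambda>S. S \<subseteq> carrier B \<and> BV.gen_set S)" by blast
  have "BV.basis \<beta>" by (rule BV.min_gen_is_basis[OF \<beta>(2)])
  moreover have "\<exists>c. ?T e = c \<odot>\<^bsub>B\<^esub> e" if "e \<in> \<beta>" for e
    using that \<beta>(1) eigen unfolding Ev_def by blast
  ultimately show ?thesis by blast
qed

lemma eigenform_imp_semisimple: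
  assumes k: "klin W lam" and inj: "\<And>w. w \<in> carrier W \<Longrightarrow> lam w = 0 \<Longrightarrow> w = \<zero>"
    and nt: "carrier W \<noteq> {\<zero>}" and f: "f \<in> carrier (GL W)"
    and c: "c \<noteq> 0" "\<And>w. w \<in> carrier W \<Longrightarrow> lam (f w) = c * lam w"
  shows "pgl_semisimple W (pgl_class W f)"
  unfolding pgl_semisimple_def
proof
  fix f' assume f': "f' \<in> pgl_class W f"
  then obtain a where a: "a \<noteq> 0" "f' = (\<lambda>x\<in>carrier W. a \<odot> f x)" unfolding pgl_class_eq[OF f] by blast
  show "\<exists>E. vectorspace.basis class_ring B E \<and> (\<forall>e\<in>E. \<exists>c. base_change_map W W f' e = c \<odot>\<^bsub>B\<^esub> e)"
    by (rule eigenform_imp_eigenbasis[OF k inj nt pgl_class_GL[OF f f'], of "to_ac a * c"])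
       (use a c GL_D(2)[OF f] in \<open>auto simp: klinD[OF k]\<close>)
qed

lemma condition_F_iff:
  assumes l: "l \<in> carrier F" and inj: "\<And>w. w \<in> carrier W \<Longrightarrow> val W l w = 0 \<Longrightarrow> w = \<zero>"
    and nt: "carrier W \<noteq> {\<zero>}" and f: "f \<in> carrier (GL W)"
  shows "condition_F W l (pgl_class W f) \<longleftrightarrow> (\<exists>c. c \<noteq> 0 \<and> (\<forall>w\<in>carrier W. val W l (f w) = c * val W l w))"
  using condition_F_imp_eigenform[OF l f] eigenform_imp_condition_F[OF l inj nt f] by metis

end

section \<open>Blocks with respect to a complement\<close>

lemma on_carrier [simp]: "on V (carrier V) = V"
  by simp

lemma coset_on [simp]: "U +>\<^bsub>on V A\<^esub> x = U +>\<^bsub>V\<^esub> x"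
  by (simp add: a_r_coset_def r_coset_def)

context fvsp
begin

lemma klin_on: "klin W lam \<Longrightarrow> lin_subspace W U \<Longrightarrow> klin (on W U) lam"
  using subspaceD(6) by (auto simp: klin_def)

lemma coset_hom_complement:
  assumes A: "lin_subspace W A" and N: "lin_subspace W N" and "N \<subseteq> A" and C: "complement_in W A N C"
  shows "(\<lambda>v. N +> v) \<in> lin_hom (on W C) (quot (on W A) N)"
    "bij_betw (\<lambda>v. N +> v) C (carrier (quot (on W A) N))"
proof -
  interpret A: fvsp "on W A" by (rule fvsp_on[OF A])
  have BA: "lin_subspace (on W A) N" using N \<open>N \<subseteq> A\<close> by (simp add: subspace_on_iff[OF A])
  have Cs: "lin_subspace W C" "C \<subseteq> A" "N \<inter> C = {\<zero>}" using C by (auto simp: complement_in_def)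
  note C' = subspaceD[OF Cs(1)] and B' = subspaceD[OF N]
  have CA: "x \<in> A" if "x \<in> C" for x using Cs(2) that by blast
  note q = A.quot_simps[OF BA, unfolded coset_on]
  show "(\<lambda>v. N +> v) \<in> lin_hom (on W C) (quot (on W A) N)"
    using CA q by (auto simp: lin_hom_iff)
  show "bij_betw (\<lambda>v. N +> v) C (carrier (quot (on W A) N))"
  proof (rule bij_betw_imageI)
    show "inj_on (\<lambda>v. N +> v) C"
    proof (rule inj_onI)
      fix x y assume xy: "x \<in> C" "y \<in> C" "N +> x = N +> y"
      then have "x \<ominus> y \<in> N \<inter> C" using coset_eq_iff[OF N] C'(5,6) by auto
      then show "x = y" using Cs(3) xy C'(6) by auto
    qed
    show "(\<lambda>v. N +> v) ` C = carrier (quot (on W A) N)"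
    proof (intro equalityI subsetI)
      fix y assume "y \<in> carrier (quot (on W A) N)"
      then obtain a where a: "a \<in> A" "y = N +> a" using q(1) by auto
      obtain b c where bc: "b \<in> N" "c \<in> C" "a = b \<oplus> c" by (rule complement_decomp[OF C a(1)])
      then have "N +> a = N +> c"
        using C'(6) B'(6) by (subst coset_eq_iff[OF N]) (auto simp: add_minus_cancel)
      then show "y \<in> (\<lambda>v. N +> v) ` C" using a bc by blast
    qed (use CA q in auto)
  qed
qed

lemma complement_nontrivial:
  assumes "N \<subset> A" "complement_in W A N C" "lin_subspace W N"
  shows "C \<noteq> {\<zero>}"
proof
  assume "C = {\<zero>}"
  then have "A \<subseteq> N"
    using complement_decomp[OF assms(2)] subspaceD(6)[OF assms(3)] by (metis r_zero singletonD subsetI)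
  then show False using assms(1) by blast
qed

text \<open>Since the kernel of \<open>l\<close> on \<open>A\<close> is exactly \<open>N\<close>,
  the induced form on A/N has no nonzero rational zeros, so \<open>condition_F_iff\<close> applies
  there; its equation is then read on \<open>C\<close> along the isomorphism of \<open>C\<close>
  with A/N.\<close>

lemma condition_F_quot_iff:
  assumes A: "lin_subspace W A" and N: "lin_subspace W N" and BA: "N \<subset> A" and C: "complement_in W A N C"
    and l: "l \<in> carrier (forms (on W A))"
    and ker: "\<And>a. a \<in> A \<Longrightarrow> val (on W A) l a = 0 \<longleftrightarrow> a \<in> N"
    and S: "S \<in> carrier (GL (on W C))"
  shows "condition_F_quot W A N C l S \<longleftrightarrow>
    (\<exists>c. c \<noteq> 0 \<and> (\<forall>v\<in>C. val (on W A) l (S v) = c * val (on W A) l v))"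
proof -
  interpret A: fvsp "on W A" by (rule fvsp_on[OF A])
  have Cs: "lin_subspace W C" "C \<subseteq> A" using C by (auto simp: complement_in_def)
  interpret C: fvsp "on W C" by (rule fvsp_on[OF Cs(1)])
  have BA': "lin_subspace (on W A) N" using N BA by (auto simp: subspace_on_iff[OF A])
  interpret Q: fvsp "quot (on W A) N" by (rule A.fvsp_quot[OF BA'])
  let ?Q = "quot (on W A) N" and ?\<psi> = "\<lambda>v. N +> v"
  note \<psi> = coset_hom_complement[OF A N _ C]
  have im: "?\<psi> ` C = carrier ?Q" using \<psi>(2) BA by (auto simp: bij_betw_def)
  obtain f' where f': "f' \<in> carrier (GL ?Q)" "\<And>x. x \<in> C \<Longrightarrow> f' (?\<psi> x) = ?\<psi> (S x)"
    "pgl_transport (on W C) ?Q ?\<psi> (pgl_class (on W C) S) = pgl_class ?Q f'"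
    by (rule pgl_transport_class[OF C.vsp_axioms Q.vsp_axioms _ _ S, of ?\<psi>]) (use \<psi> BA in auto)
  have "val (on W A) l u = 0" if "u \<in> N" for u using that ker BA by blast
  note ind = A.induced_form[OF BA' l this, unfolded coset_on]
  let ?m = "induced_form (on W A) N l"
  have nz: "y = \<zero>\<^bsub>?Q\<^esub>" if y: "y \<in> carrier ?Q" "val ?Q ?m y = 0" for y
  proof -
    obtain a where a: "a \<in> A" "y = N +> a" using y(1) A.quot_simps(1)[OF BA'] by auto
    then have "a \<in> N" using ind(2)[of a] y(2) ker by simp
    then show ?thesis using a A.quot_simps(4)[OF BA'] A.coset_eq_iff[OF BA', of a "\<zero>"] subspaceD[OF A] subspaceD(2,5)[OF N]
      by (simp add: minus_on[OF A])
  qed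
  have nt: "carrier ?Q \<noteq> {\<zero>\<^bsub>?Q\<^esub>}"
  proof
    assume triv: "carrier ?Q = {\<zero>\<^bsub>?Q\<^esub>}"
    obtain a where a: "a \<in> A" "a \<notin> N" using BA by blast
    then have "N +> a \<in> carrier ?Q" using A.quot_simps(1)[OF BA'] by auto
    then have "val ?Q ?m (N +> a) = 0" using triv Q.klin_0[OF Q.val_klin[OF ind(1)]] by simp
    then show False using a ind(2)[of a] ker by simp
  qed
  have "condition_F_quot W A N C l S \<longleftrightarrow> (\<exists>c. c \<noteq> 0 \<and> (\<forall>y\<in>carrier ?Q. val ?Q ?m (f' y) = c * val ?Q ?m y))"
    unfolding condition_F_quot_def f'(3) by (rule Q.condition_F_iff[OF ind(1) nz nt f'(1)])
  also have "\<dots> \<longleftrightarrow> (\<exists>c. c \<noteq> 0 \<and> (\<forall>v\<in>C. val (on W A) l (S v) = c * val (on W A) l v))"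
  proof -
    have "val ?Q ?m (f' (N +> v)) = val (on W A) l (S v)" "val ?Q ?m (N +> v) = val (on W A) l v" if "v \<in> C" for v
      using that f'(2) C.GL_D(2)[OF S, of v] Cs(2) ind(2) by auto
    then show ?thesis unfolding im[symmetric] by simp
  qed
  finally show ?thesis .
qed

lemma condition_F_quot_semisimple:
  assumes A: "lin_subspace W A" and N: "lin_subspace W N" and BA: "N \<subset> A" and C: "complement_in W A N C"
    and l: "l \<in> carrier (forms (on W A))"
    and ker: "\<And>a. a \<in> A \<Longrightarrow> val (on W A) l a = 0 \<longleftrightarrow> a \<in> N"
    and S: "S \<in> carrier (GL (on W C))" and cF: "condition_F_quot W A N C l S"
  shows "pgl_semisimple (on W C) (pgl_class (on W C) S)"
proof -
  interpret A: fvsp "on W A" by (rule fvsp_on[OF A])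
  have Cs: "lin_subspace W C" "C \<subseteq> A" "N \<inter> C = {\<zero>}" using C by (auto simp: complement_in_def)
  interpret C: fvsp "on W C" by (rule fvsp_on[OF Cs(1)])
  obtain c where c: "c \<noteq> 0" "\<And>v. v \<in> C \<Longrightarrow> val (on W A) l (S v) = c * val (on W A) l v"
    using cF condition_F_quot_iff[OF A N BA C l ker S] by blast
  have "klin (on (on W A) C) (val (on W A) l)"
    by (rule A.klin_on[OF A.val_klin[OF l]]) (simp add: subspace_on_iff[OF A] Cs)
  then have k: "klin (on W C) (val (on W A) l)" by simp
  show ?thesis
    by (rule C.eigenform_imp_semisimple[OF k _ _ S c(1)])
       (use c Cs ker complement_nontrivial[OF BA C N] in auto)
qed

text \<open>An injective self-map of the finite set \<open>U\<close> is onto, and injectivity on W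
  then excludes preimages outside \<open>U\<close>.\<close>

lemma GL_stable_subspace:
  assumes U: "lin_subspace W U" and f: "f \<in> carrier (GL W)" and "\<And>u. u \<in> U \<Longrightarrow> f u \<in> U"
  shows "f ` U = U" "\<And>x. x \<in> carrier W \<Longrightarrow> f x \<in> U \<Longrightarrow> x \<in> U"
proof -
  have i: "inj_on f U" using GL_D(4)[OF f] subspaceD(1)[OF U] by (rule inj_on_subset)
  have "finite U" using subspaceD(1)[OF U] fin by (rule finite_subset)
  then show *: "f ` U = U" by (intro endo_inj_surj) (use i assms(3) in auto)
  fix x assume x: "x \<in> carrier W" "f x \<in> U"
  then obtain u where "u \<in> U" "f x = f u" using * by (metis imageE)
  then show "x \<in> U" using GL_D(4)[OF f] x(1) subspaceD(6)[OF U] by (auto dest: inj_onD)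
qed

text \<open>\<open>S\<close> is the component of \<open>f\<close> along \<open>C\<close>. If it
  kills d in \<open>C\<close>, then f d lies in \<open>N\<close>, hence so does d by
  \<open>GL_stable_subspace\<close>, and d = 0; injectivity and finiteness give bijectivity.\<close>

lemma GL_block:
  assumes A: "lin_subspace W A" and N: "lin_subspace W N" and BA: "N \<subseteq> A" and C: "complement_in W A N C"
    and f: "f \<in> carrier (GL W)" and fA: "\<And>a. a \<in> A \<Longrightarrow> f a \<in> A" and fB: "\<And>b. b \<in> N \<Longrightarrow> f b \<in> N"
  obtains S where "S \<in> carrier (GL (on W C))" "\<And>v. v \<in> C \<Longrightarrow> f v \<ominus> S v \<in> N"
proof -
  have Cs: "lin_subspace W C" "C \<subseteq> A" "N \<inter> C = {\<zero>}" using C by (auto simp: complement_in_def)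
  interpret C: fvsp "on W C" by (rule fvsp_on[OF Cs(1)])
  note C' = subspaceD[OF Cs(1)] and B' = subspaceD[OF N] and f' = GL_D[OF f]
  have "\<exists>c. c \<in> C \<and> f v \<ominus> c \<in> N" if v: "v \<in> C" for v
  proof -
    have "f v \<in> A" using fA Cs(2) v by blast
    then obtain b c where "b \<in> N" "c \<in> C" "f v = b \<oplus> c" by (rule complement_decomp[OF C])
    then show ?thesis using B'(6) C'(6) add_minus_cancel by auto
  qed
  then obtain s where s: "\<And>v. v \<in> C \<Longrightarrow> s v \<in> C" "\<And>v. v \<in> C \<Longrightarrow> f v \<ominus> s v \<in> N" by metis
  have uniq: "c = c'" if "c \<in> C" "c' \<in> C" "x \<ominus> c \<in> N" "x \<ominus> c' \<in> N" "x \<in> carrier W" for c c' x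
  proof -
    have cl: "c \<in> carrier W" "c' \<in> carrier W" using that C'(6) by auto
    have "c \<ominus> c' = (x \<ominus> c') \<ominus> (x \<ominus> c)"
    proof (rule diff_eq_diff)
      have "c \<oplus> (x \<ominus> c) = x" "c' \<oplus> (x \<ominus> c') = x"
        using cl that(5) by (simp_all add: minus_add_cancel a_comm[of c] a_comm[of c'])
      then show "c \<oplus> (x \<ominus> c) = c' \<oplus> (x \<ominus> c')" by simp
    qed (use cl that(5) in auto)
    then have "c \<ominus> c' \<in> N \<inter> C" using B'(5)[OF that(4,3)] C'(5)[OF that(1,2)] by simp
    then show ?thesis using Cs(3) cl by auto
  qed
  define S where "S = restrict s C"
  have Sa: "s (x \<oplus> y) = s x \<oplus> s y" if "x \<in> C" "y \<in> C" for x y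
  proof (rule uniq[of _ _ "f (x \<oplus> y)"])
    have cl: "f x \<in> carrier W" "f y \<in> carrier W" "s x \<in> carrier W" "s y \<in> carrier W"
      using that s(1) C'(6) f'(2) by auto
    have "f (x \<oplus> y) \<ominus> (s x \<oplus> s y) = (f x \<ominus> s x) \<oplus> (f y \<ominus> s y)"
      using that C'(6) cl by (simp add: f'(5) minus_eq minus_add a_ac)
    then show "f (x \<oplus> y) \<ominus> (s x \<oplus> s y) \<in> N" using s(2) that B'(3) by simp
  qed (use that s C'(3,6) f'(2) in auto)
  have Ss: "s (a \<odot> x) = a \<odot> s x" if "x \<in> C" for a x
  proof (rule uniq[of _ _ "f (a \<odot> x)"])
    have cl: "f x \<in> carrier W" "s x \<in> carrier W"
      using that s(1) C'(6) f'(2) by auto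
    have "f (a \<odot> x) \<ominus> (a \<odot> s x) = a \<odot> (f x \<ominus> s x)"
      using that C'(6) cl by (simp add: f'(6) minus_smult1 smult_r_distr smult_smult)
    then show "f (a \<odot> x) \<ominus> (a \<odot> s x) \<in> N" using s(2) that B'(4) by simp
  qed (use that s C'(4,6) f'(2) in auto)
  have "inj_on S C"
  proof (rule inj_onI)
    fix x y assume xy: "x \<in> C" "y \<in> C" "S x = S y"
    have d: "x \<ominus> y \<in> C" by (rule C'(5)[OF xy(1,2)])
    have "s (x \<ominus> y) = s x \<oplus> (-1) \<odot> s y"
      using xy(1,2) C'(4,6) by (simp add: minus_smult1 Sa Ss)
    also have "\<dots> = \<zero>" using xy s(1) C'(6) by (simp add: S_def smult_minus1 r_neg)
    finally have "f (x \<ominus> y) \<ominus> \<zero> \<in> N" using s(2)[OF d] by simp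
    then have "f (x \<ominus> y) \<in> N" using f'(2)[OF C'(6)[OF d]] minus_smult1[of "f (x \<ominus> y)" "\<zero>"] by simp
    with GL_stable_subspace(2)[OF N f fB C'(6)[OF d]] have "x \<ominus> y \<in> N" by blast
    then have "x \<ominus> y \<in> {\<zero>}" using d Cs(3) by blast
    then show "x = y" using xy C'(6) by simp
  qed
  moreover have "S ` C = C"
    by (rule endo_inj_surj) (use \<open>inj_on S C\<close> C.fin s(1) in \<open>auto simp: S_def\<close>)
  ultimately have "S \<in> carrier (GL (on W C))"
    using s(1) C'(3,4) by (intro C.GL_I) (auto simp: S_def Sa Ss)
  then show ?thesis using that[of S] s(2) by (simp add: S_def)
qed

text \<open>On \<open>C\<close> the maps \<open>f\<close> and \<open>S\<close> differ by elements of
  \<open>N\<close>, where \<open>lam\<close> vanishes, so they have the same values under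
  \<open>lam\<close>. The first conclusion carries stability from \<open>N\<close> to
  \<open>A\<close> and lets it climb a flag.\<close>

lemma block_eigenform:
  assumes A: "lin_subspace W A" and N: "lin_subspace W N" and BA: "N \<subseteq> A" and C: "complement_in W A N C"
    and k: "klin (on W A) lam" and ker: "\<And>b. b \<in> N \<Longrightarrow> lam b = 0"
    and f: "f \<in> carrier (GL W)" and fB: "\<And>b. b \<in> N \<Longrightarrow> f b \<in> N"
    and S: "\<And>v. v \<in> C \<Longrightarrow> S v \<in> C" "\<And>v. v \<in> C \<Longrightarrow> f v \<ominus> S v \<in> N"
  shows "a \<in> A \<Longrightarrow> f a \<in> A"
    and "(\<And>v. v \<in> C \<Longrightarrow> lam (S v) = c * lam v) \<Longrightarrow> a \<in> A \<Longrightarrow> lam (f a) = c * lam a"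
    and "(\<And>a. a \<in> A \<Longrightarrow> lam (f a) = c * lam a) \<Longrightarrow> v \<in> C \<Longrightarrow> lam (S v) = c * lam v"
proof -
  have Cs: "lin_subspace W C" "C \<subseteq> A" using C by (auto simp: complement_in_def)
  note A' = subspaceD[OF A] and B' = subspaceD[OF N] and C' = subspaceD[OF Cs(1)] and f' = GL_D[OF f]
  have fv: "f v \<in> A" "lam (f v) = lam (S v)" if v: "v \<in> C" for v
  proof -
    have eq: "f v = (f v \<ominus> S v) \<oplus> S v" using S(1)[OF v] C'(6) v f'(2) by (simp add: minus_add_cancel)
    have m: "f v \<ominus> S v \<in> A" "S v \<in> A" using S[OF v] BA Cs(2) by auto
    then show "f v \<in> A" using A'(3) eq by metis
    have "lam (f v) = lam (f v \<ominus> S v) + lam (S v)" by (subst eq) (use klinD(1)[OF k] m in simp)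
    then show "lam (f v) = lam (S v)" using ker S(2)[OF v] by simp
  qed
  have dec: "\<exists>b v. b \<in> N \<and> v \<in> C \<and> a = b \<oplus> v \<and> f a = f b \<oplus> f v \<and> f b \<in> N \<and> f v \<in> A" if aA: "a \<in> A" for a
  proof -
    obtain b v where bv: "b \<in> N" "v \<in> C" "a = b \<oplus> v" by (rule complement_decomp[OF C aA])
    then have "f a = f b \<oplus> f v" using f'(5) B'(6) C'(6) by simp
    then show ?thesis using bv fB fv by blast
  qed
  show "f a \<in> A" if "a \<in> A" using dec[OF that] A'(3) BA by auto
  show "lam (f a) = c * lam a" if c: "\<And>v. v \<in> C \<Longrightarrow> lam (S v) = c * lam v" and a: "a \<in> A"
  proof -
    obtain b v where bv: "b \<in> N" "v \<in> C" "a = b \<oplus> v" "f a = f b \<oplus> f v" "f b \<in> N" "f v \<in> A" using dec[OF a] by blast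
    then have "lam (f a) = lam (f b) + lam (f v)" "lam a = lam b + lam v"
      using klinD(1)[OF k] BA Cs(2) by auto
    then show ?thesis using ker bv fv(2)[OF bv(2)] c by simp
  qed
  show "lam (S v) = c * lam v" if "\<And>a. a \<in> A \<Longrightarrow> lam (f a) = c * lam a" "v \<in> C"
    using that fv(2)[OF that(2)] Cs(2) by auto
qed

text \<open>The matrix criteria quantify over representatives \<gamma> of g; this allows \<gamma> to
  take the place of the representative first chosen.\<close>

lemma pgl_class_rep:
  assumes f: "f \<in> carrier (GL W)" and \<gamma>: "\<gamma> \<in> pgl_class W f"
  shows "pgl_class W f = pgl_class W \<gamma>"
proof -
  obtain b where b: "b \<noteq> 0" "\<gamma> = (\<lambda>x\<in>carrier W. b \<odot> f x)" using \<gamma> unfolding pgl_class_eq[OF f] by blast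
  have G: "\<gamma> \<in> carrier (GL W)" by (rule pgl_class_GL[OF f \<gamma>])
  have "(\<lambda>x\<in>carrier W. a \<odot> f x) = (\<lambda>x\<in>carrier W. (a / b) \<odot> \<gamma> x)"
    "(\<lambda>x\<in>carrier W. a \<odot> \<gamma> x) = (\<lambda>x\<in>carrier W. (a * b) \<odot> f x)" for a
    using b GL_D(2)[OF f] by (auto simp: fun_eq_iff smult_smult)
  moreover have "a \<noteq> 0 \<Longrightarrow> a * b \<noteq> 0 \<and> a / b \<noteq> 0" for a using b by simp
  ultimately show ?thesis unfolding pgl_class_eq[OF f] pgl_class_eq[OF G] by (blast 8)
qed

section \<open>Points of the projective space\<close>

lemma P_class_self: "l \<in> carrier F \<Longrightarrow> l \<in> P_class W l"
  unfolding P_class_def by (intro CollectI exI[of _ 1]) simp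

lemma P_class_eq_iff:
  assumes "l \<in> carrier F" "u \<in> carrier F"
  shows "P_class W u = P_class W l \<longleftrightarrow> (\<exists>c. c \<noteq> 0 \<and> u = c \<odot>\<^bsub>F\<^esub> l)"
proof
  assume "P_class W u = P_class W l"
  then show "\<exists>c. c \<noteq> 0 \<and> u = c \<odot>\<^bsub>F\<^esub> l" using P_class_self[OF assms(2)] unfolding P_class_def by blast
next
  assume "\<exists>c. c \<noteq> 0 \<and> u = c \<odot>\<^bsub>F\<^esub> l"
  then obtain c where c: "c \<noteq> 0" "u = c \<odot>\<^bsub>F\<^esub> l" by blast
  have "a \<odot>\<^bsub>F\<^esub> u = (a * c) \<odot>\<^bsub>F\<^esub> l" "a \<odot>\<^bsub>F\<^esub> l = (a / c) \<odot>\<^bsub>F\<^esub> u" for a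
    using c assms by (auto simp: F.smult_smult)
  moreover have "a \<noteq> 0 \<Longrightarrow> a * c \<noteq> 0 \<and> a / c \<noteq> 0" for a using c by simp
  ultimately show "P_class W u = P_class W l" unfolding P_class_def by (blast 8)
qed

lemma P_points_rep:
  assumes "x \<in> P_points W" "l \<in> x"
  shows "l \<in> carrier F" "x = P_class W l" "\<exists>v\<in>carrier W. val W l v \<noteq> 0"
proof -
  obtain l0 where l0: "x = P_class W l0" "l0 \<in> carrier F" "l0 \<noteq> \<zero>\<^bsub>F\<^esub>" using assms(1) unfolding P_points_def by blast
  then obtain c where c: "c \<noteq> 0" "l = c \<odot>\<^bsub>F\<^esub> l0" using assms(2) unfolding P_class_def by blast
  then show l: "l \<in> carrier F" using l0 by simp
  show "x = P_class W l" using P_class_eq_iff[OF l0(2) l] c l0(1) by blast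
  show "\<exists>v\<in>carrier W. val W l v \<noteq> 0"
  proof (rule ccontr)
    assume "\<not> ?thesis"
    then have "l0 = \<zero>\<^bsub>F\<^esub>" using c l0(2) by (intro form_eqI) (auto simp: val_simps)
    then show False using l0(3) by blast
  qed
qed

lemma P_locus_iff:
  assumes "l \<in> carrier F" "\<exists>v\<in>carrier W. val W l v \<noteq> 0"
  shows "P_class W l \<in> P_locus W U \<longleftrightarrow> (\<forall>v\<in>U. val W l v = 0)"
proof -
  have "l \<noteq> \<zero>\<^bsub>F\<^esub>" using assms(2) by (auto simp: val_simps)
  then have "P_class W l \<in> P_points W" using assms(1) unfolding P_points_def by blast
  then show ?thesis using P_class_self[OF assms(1)]
    unfolding P_locus_def val_def[symmetric] by (auto simp: P_class_def val_simps)
qed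

text \<open>The rational kernel of \<open>l\<close> is a proper subspace. If it were larger than
  \<open>U\<close>, the point would lie in the locus of that kernel, which the stratum
  removes.\<close>

lemma P_stratum_iff:
  assumes U: "lin_subspace W U" and l: "l \<in> carrier F" and nz: "\<exists>v\<in>carrier W. val W l v \<noteq> 0"
  shows "P_class W l \<in> P_stratum W U \<longleftrightarrow> (\<forall>v\<in>carrier W. val W l v = 0 \<longleftrightarrow> v \<in> U)"
proof
  let ?K = "{v \<in> carrier W. val W l v = 0}"
  assume x: "P_class W l \<in> P_stratum W U"
  then have UK: "U \<subseteq> ?K" using P_locus_iff[OF l nz] subspaceD(1)[OF U] unfolding P_stratum_def by auto
  have K: "lin_subspace W ?K" by (rule klin_kernel_subspace[OF val_klin[OF l]])
  have "P_class W l \<in> P_locus W ?K" using P_locus_iff[OF l nz] by simp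
  moreover have "?K \<subset> carrier W" using nz by blast
  ultimately have "\<not> U \<subset> ?K" using x K unfolding P_stratum_def by blast
  then show "\<forall>v\<in>carrier W. val W l v = 0 \<longleftrightarrow> v \<in> U" using UK by blast
next
  assume *: "\<forall>v\<in>carrier W. val W l v = 0 \<longleftrightarrow> v \<in> U"
  show "P_class W l \<in> P_stratum W U"
    unfolding P_stratum_def
  proof (intro DiffI notI)
    show "P_class W l \<in> P_locus W U" using * P_locus_iff[OF l nz] subspaceD(6)[OF U] by blast
    assume "P_class W l \<in> \<Union> {P_locus W W' |W'. lin_subspace W W' \<and> U \<subset> W' \<and> W' \<subset> carrier W}"
    then obtain W' where "P_class W l \<in> P_locus W W'" "U \<subset> W'" "W' \<subset> carrier W" by blast
    then show False using * P_locus_iff[OF l nz] by blast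
  qed
qed

text \<open>Letting all representatives of the point and of g act only rescales the form l \<circ>
  f, so the result is one class, and fixing means proportionality of l \<circ> f and
  \<open>l\<close>.\<close>

lemma P_act_fixed_iff:
  assumes f: "f \<in> carrier (GL W)" and l: "l \<in> carrier F"
  shows "P_act W (P_class W l) (pgl_class W f) = P_class W l \<longleftrightarrow>
    (\<exists>c. c \<noteq> 0 \<and> (\<forall>v\<in>carrier W. val W l (f v) = c * val W l v))"
proof -
  note pull = pull_form[OF fvsp_axioms fvsp_axioms]
  note pf = pull[OF GL_D(1)[OF f] l]
  have *: "pull_form W W (\<lambda>x\<in>carrier W. b \<odot> f x) (a \<odot>\<^bsub>F\<^esub> l) = (a * to_ac b) \<odot>\<^bsub>F\<^esub> pull_form W W f l"
    if "b \<noteq> 0" for a b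
    by (rule form_eqI)
       (use l pf pull[OF GL_D(1)[OF GL_scale[OF f that]]] GL_D(2)[OF f] in
        \<open>auto simp: val_simps klinD(2)[OF val_klin[OF l]]\<close>)
  have "P_act W (P_class W l) (pgl_class W f) = P_class W (pull_form W W f l)"
    unfolding P_act_def
  proof (intro equalityI subsetI)
    fix u assume "u \<in> {pull_form W W \<gamma> l' |l' \<gamma>. l' \<in> P_class W l \<and> \<gamma> \<in> pgl_class W f}"
    then obtain l' \<gamma> where u: "u = pull_form W W \<gamma> l'" "l' \<in> P_class W l" "\<gamma> \<in> pgl_class W f" by blast
    obtain a where a: "a \<noteq> 0" "l' = a \<odot>\<^bsub>F\<^esub> l" using u(2) unfolding P_class_def by blast
    obtain b where b: "b \<noteq> 0" "\<gamma> = (\<lambda>x\<in>carrier W. b \<odot> f x)" using u(3) unfolding pgl_class_eq[OF f] by blast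
    have "u = (a * to_ac b) \<odot>\<^bsub>F\<^esub> pull_form W W f l" unfolding u(1) a(2) b(2) by (rule *[OF b(1)])
    with a(1) b(1) show "u \<in> P_class W (pull_form W W f l)"
      unfolding P_class_def by (intro CollectI exI[of _ "a * to_ac b"]) auto
  next
    fix u assume "u \<in> P_class W (pull_form W W f l)"
    then obtain a where a: "a \<noteq> 0" "u = a \<odot>\<^bsub>F\<^esub> pull_form W W f l" unfolding P_class_def by blast
    have "u = pull_form W W (\<lambda>x\<in>carrier W. 1 \<odot> f x) (a \<odot>\<^bsub>F\<^esub> l)" using *[of 1 a] a(2) by simp
    moreover have "(\<lambda>x\<in>carrier W. 1 \<odot> f x) \<in> pgl_class W f"
      unfolding pgl_class_eq[OF f] by (intro CollectI exI[of _ 1]) simp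
    moreover have "a \<odot>\<^bsub>F\<^esub> l \<in> P_class W l" using a(1) unfolding P_class_def by blast
    ultimately show "u \<in> {pull_form W W \<gamma> l' |l' \<gamma>. l' \<in> P_class W l \<and> \<gamma> \<in> pgl_class W f}" by blast
  qed
  then have "P_act W (P_class W l) (pgl_class W f) = P_class W l \<longleftrightarrow> (\<exists>c. c \<noteq> 0 \<and> pull_form W W f l = c \<odot>\<^bsub>F\<^esub> l)"
    using P_class_eq_iff[OF l pf(1)] by simp
  also have "\<dots> \<longleftrightarrow> (\<exists>c. c \<noteq> 0 \<and> (\<forall>v\<in>carrier W. val W l (f v) = c * val W l v))"
  proof (intro iff_exI conj_cong refl)
    fix c
    show "pull_form W W f l = c \<odot>\<^bsub>F\<^esub> l \<longleftrightarrow> (\<forall>v\<in>carrier W. val W l (f v) = c * val W l v)"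
    proof
      assume eq: "pull_form W W f l = c \<odot>\<^bsub>F\<^esub> l"
      show "\<forall>v\<in>carrier W. val W l (f v) = c * val W l v"
      proof
        fix v assume "v \<in> carrier W"
        then show "val W l (f v) = c * val W l v" using pf(2) eq by (metis val_simps(1))
      qed
    next
      assume "\<forall>v\<in>carrier W. val W l (f v) = c * val W l v"
      then show "pull_form W W f l = c \<odot>\<^bsub>F\<^esub> l"
        by (intro form_eqI) (use pf l in \<open>auto simp: val_simps\<close>)
    qed
  qed
  finally show ?thesis .
qed

text \<open>The stratum makes \<open>V'\<close> the exact rational kernel of \<open>l\<close>. An
  eigenvector equation preserves this kernel, which gives the zero block, and passes to the diagonal
  block on the complement and back.\<close>

theorem P_part:
  assumes g: "g \<in> carrier (PGL W)" and V': "lin_subspace W V'" "V' \<subset> carrier W"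
    and x: "x \<in> P_stratum W V'" and lx: "l \<in> x"
  shows "(P_act W x g = x \<longleftrightarrow>
        (\<exists>\<gamma>\<in>g. \<exists>V''. complement_in W (carrier W) V' V'' \<and>
          (\<exists>S\<in>carrier (GL (on W V'')).
            (\<forall>v\<in>V'. \<gamma> v \<in> V') \<and> (\<forall>v\<in>V''. \<gamma> v \<ominus> S v \<in> V') \<and>
            condition_F_quot W (carrier W) V' V'' l S))) \<and>
      (\<forall>V''. complement_in W (carrier W) V' V'' \<longrightarrow>
        (\<forall>S\<in>carrier (GL (on W V'')). condition_F_quot W (carrier W) V' V'' l S \<longrightarrow>
          pgl_semisimple (on W V'') (pgl_class (on W V'') S)))"
proof -
  have "x \<in> P_points W" using x unfolding P_stratum_def P_locus_def by blast
  note l = P_points_rep[OF this lx]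
  have ker: "val W l v = 0 \<longleftrightarrow> v \<in> V'" if "v \<in> carrier W" for v
    using x P_stratum_iff[OF V'(1) l(1,3)] l(2) that by simp
  obtain f where f: "f \<in> carrier (GL W)" "g = pgl_class W f" by (rule PGL_cases[OF g])
  have g_eq: "g = pgl_class W \<gamma>" if "\<gamma> \<in> g" for \<gamma>
    using pgl_class_rep[OF f(1)] f(2) that by simp
  have cF: "condition_F_quot W (carrier W) V' C l S \<longleftrightarrow> (\<exists>c. c \<noteq> 0 \<and> (\<forall>v\<in>C. val W l (S v) = c * val W l v))"
    if "complement_in W (carrier W) V' C" "S \<in> carrier (GL (on W C))" for C S
    using condition_F_quot_iff[OF subspace_carrier V'(1,2) that(1) _ _ that(2)] l(1) ker by simp
  have "P_act W x g = x \<longleftrightarrow>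
        (\<exists>\<gamma>\<in>g. \<exists>V''. complement_in W (carrier W) V' V'' \<and>
          (\<exists>S\<in>carrier (GL (on W V'')).
            (\<forall>v\<in>V'. \<gamma> v \<in> V') \<and> (\<forall>v\<in>V''. \<gamma> v \<ominus> S v \<in> V') \<and>
            condition_F_quot W (carrier W) V' V'' l S))" (is "?L \<longleftrightarrow> ?R")
  proof
    assume ?L
    then obtain c where c: "c \<noteq> 0" "\<And>v. v \<in> carrier W \<Longrightarrow> val W l (f v) = c * val W l v"
      using P_act_fixed_iff[OF f(1) l(1)] l(2) f(2) by metis
    have fV': "f v \<in> V'" if "v \<in> V'" for v
      using that c(2)[of v] ker[of v] ker[of "f v"] subspaceD(6)[OF V'(1)] GL_D(2)[OF f(1)] by simp
    obtain C where C: "complement_in W (carrier W) V' C"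
      using exists_complement[OF fin subspace_carrier V'(1)] V'(2) by blast
    obtain S where S: "S \<in> carrier (GL (on W C))" "\<And>v. v \<in> C \<Longrightarrow> f v \<ominus> S v \<in> V'"
      by (rule GL_block[OF subspace_carrier V'(1) _ C f(1)]) (use V'(2) fV' GL_D(2)[OF f(1)] in auto)
    have "lin_subspace W C" using C by (simp add: complement_in_def)
    then have SC: "S v \<in> C" if "v \<in> C" for v using vsp.GL_D(2)[OF vsp_on S(1)] that by simp
    have "val W l (S v) = c * val W l v" if "v \<in> C" for v
      by (rule block_eigenform(3)[OF subspace_carrier V'(1) _ C _ _ f(1) fV', where lam = "val W l" and S = S, unfolded on_carrier])
         (use V'(2) val_klin[OF l(1)] ker S SC c that subspaceD(6)[OF V'(1)] in auto)
    then have "condition_F_quot W (carrier W) V' C l S" using cF[OF C S(1)] c(1) by blast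
    then show ?R using pgl_class_self[OF f(1)] f(2) C S fV' by blast
  next
    assume ?R
    then obtain \<gamma> C S where \<gamma>: "\<gamma> \<in> g" and C: "complement_in W (carrier W) V' C" and S: "S \<in> carrier (GL (on W C))"
      and b: "\<And>v. v \<in> V' \<Longrightarrow> \<gamma> v \<in> V'" "\<And>v. v \<in> C \<Longrightarrow> \<gamma> v \<ominus> S v \<in> V'"
      and F: "condition_F_quot W (carrier W) V' C l S" by blast
    have G: "\<gamma> \<in> carrier (GL W)" using pgl_class_GL[OF f(1)] \<gamma> f(2) by simp
    obtain c where c: "c \<noteq> 0" "\<And>v. v \<in> C \<Longrightarrow> val W l (S v) = c * val W l v" using F cF[OF C S] by blast
    have "lin_subspace W C" using C by (simp add: complement_in_def)
    then have SC: "S v \<in> C" if "v \<in> C" for v using vsp.GL_D(2)[OF vsp_on S(1)] that by simp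
    have "val W l (\<gamma> v) = c * val W l v" if "v \<in> carrier W" for v
      by (rule block_eigenform(2)[OF subspace_carrier V'(1) _ C _ _ G b(1), where lam = "val W l" and S = S, unfolded on_carrier])
         (use V'(2) val_klin[OF l(1)] ker S SC c that subspaceD(6)[OF V'(1)] b in auto)
    then show ?L using P_act_fixed_iff[OF G l(1)] g_eq[OF \<gamma>] c(1) l(2) by metis
  qed
  moreover have "pgl_semisimple (on W C) (pgl_class (on W C) S)"
    if "complement_in W (carrier W) V' C" "S \<in> carrier (GL (on W C))" "condition_F_quot W (carrier W) V' C l S" for C S
    using condition_F_quot_semisimple[OF subspace_carrier V'(1,2) that(1) _ _ that(2,3)] l(1) ker by simp
  ultimately show ?thesis by blast
qed

end

section \<open>Reciprocal maps\<close>

context fvsp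
begin

definition Q_class :: "('w \<Rightarrow> 'k alg_closure) \<Rightarrow> ('w \<Rightarrow> 'k alg_closure) set" where
  "Q_class r = {\<lambda>v\<in>carrier W - {\<zero>}. c * r v | c. c \<noteq> 0}"

lemma reciprocal_scale:
  assumes "reciprocal W r" "c \<noteq> 0"
  shows "reciprocal W (\<lambda>v\<in>carrier W - {\<zero>}. c * r v)"
proof -
  have 0: "a \<odot> v \<noteq> \<zero>" if "a \<noteq> 0" "v \<in> carrier W" "v \<noteq> \<zero>" for a v
    using smult_cancel[OF that(2,1), of "\<zero>"] that(3) by auto
  show ?thesis
    unfolding reciprocal_def
  proof (intro conjI allI ballI impI)
    show "(\<lambda>v\<in>carrier W - {\<zero>}. c * r v) \<in> extensional (carrier W - {\<zero>})" by simp
    show "(\<lambda>v\<in>carrier W - {\<zero>}. c * r v) (a \<odot> v) = inverse (to_ac a) * (\<lambda>v\<in>carrier W - {\<zero>}. c * r v) v"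
      if "a \<noteq> 0" "v \<in> carrier W - {\<zero>}" for a v
      using that 0 assms(1) by (simp add: reciprocal_def)
    fix v v' assume v: "v \<in> carrier W - {\<zero>}" "v' \<in> carrier W - {\<zero>}" "v \<oplus> v' \<noteq> \<zero>"
    then have "r v * r v' = r (v \<oplus> v') * (r v + r v')" using assms(1) by (simp add: reciprocal_def)
    then have "(c * c) * (r v * r v') = (c * c) * (r (v \<oplus> v') * (r v + r v'))" by simp
    then show "(\<lambda>v\<in>carrier W - {\<zero>}. c * r v) v * (\<lambda>v\<in>carrier W - {\<zero>}. c * r v) v' =
       (\<lambda>v\<in>carrier W - {\<zero>}. c * r v) (v \<oplus> v') * ((\<lambda>v\<in>carrier W - {\<zero>}. c * r v) v + (\<lambda>v\<in>carrier W - {\<zero>}. c * r v) v')"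
      using v by (simp add: algebra_simps)
  qed
qed

lemma Q_class_scale:
  assumes "c \<noteq> 0"
  shows "Q_class (\<lambda>v\<in>carrier W - {\<zero>}. c * r v) = Q_class r"
proof -
  have "(\<lambda>v\<in>carrier W - {\<zero>}. a * (\<lambda>v\<in>carrier W - {\<zero>}. c * r v) v) = (\<lambda>v\<in>carrier W - {\<zero>}. (a * c) * r v)"
    "(\<lambda>v\<in>carrier W - {\<zero>}. a * r v) = (\<lambda>v\<in>carrier W - {\<zero>}. (a / c) * (\<lambda>v\<in>carrier W - {\<zero>}. c * r v) v)" for a
    using assms by (auto simp: fun_eq_iff)
  moreover have "a \<noteq> 0 \<Longrightarrow> a * c \<noteq> 0 \<and> a / c \<noteq> 0" for a using assms by simp
  ultimately show ?thesis unfolding Q_class_def by (blast 8)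
qed

lemma Q_class_self: "r \<in> extensional (carrier W - {\<zero>}) \<Longrightarrow> r \<in> Q_class r"
  unfolding Q_class_def by (intro CollectI exI[of _ 1]) (auto simp: fun_eq_iff extensional_def)

lemma Q_points_rep:
  assumes "x \<in> Q_points W" "r \<in> x"
  shows "reciprocal W r" "x = Q_class r" "\<exists>v\<in>carrier W - {\<zero>}. r v \<noteq> 0"
proof -
  obtain r0 where r0: "x = Q_class r0" "reciprocal W r0" "\<exists>v\<in>carrier W - {\<zero>}. r0 v \<noteq> 0"
    using assms(1) unfolding Q_points_def Q_class_def by blast
  obtain c where c: "c \<noteq> 0" "r = (\<lambda>v\<in>carrier W - {\<zero>}. c * r0 v)"
    using assms(2) unfolding r0(1) Q_class_def by blast
  show "reciprocal W r" unfolding c(2) by (rule reciprocal_scale[OF r0(2) c(1)])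
  show "x = Q_class r" unfolding c(2) r0(1) by (rule Q_class_scale[OF c(1), symmetric])
  show "\<exists>v\<in>carrier W - {\<zero>}. r v \<noteq> 0" using r0(3) c by auto
qed

lemma reciprocalD:
  assumes "reciprocal W r"
  shows "r \<in> extensional (carrier W - {\<zero>})"
    "\<And>c v. c \<noteq> 0 \<Longrightarrow> v \<in> carrier W \<Longrightarrow> v \<noteq> \<zero> \<Longrightarrow> r (c \<odot> v) = inverse (to_ac c) * r v"
    "\<And>v v'. v \<in> carrier W \<Longrightarrow> v \<noteq> \<zero> \<Longrightarrow> v' \<in> carrier W \<Longrightarrow> v' \<noteq> \<zero> \<Longrightarrow> v \<oplus> v' \<noteq> \<zero> \<Longrightarrow>
        r v * r v' = r (v \<oplus> v') * (r v + r v')"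
  using assms by (auto simp: reciprocal_def)

text \<open>In r(x) r(y) = r(x + y) (r(x) + r(y)) a nonzero left side forces r(x + y) to be
  nonzero.\<close>

lemma reciprocal_support_subspace:
  assumes r: "reciprocal W r"
  shows "lin_subspace W (insert \<zero> {v \<in> carrier W - {\<zero>}. r v \<noteq> 0})" (is "lin_subspace W ?S")
  unfolding subspace_iff
proof (intro conjI ballI allI)
  note d = reciprocalD[OF r]
  fix x assume x: "x \<in> ?S"
  show "c \<odot> x \<in> ?S" for c
  proof (cases "c = 0 \<or> x = \<zero>")
    case False
    then have "c \<odot> x \<noteq> \<zero>" using smult_cancel[of x c "\<zero>"] x by auto
    then show ?thesis using False x d(2) by auto
  qed (use x in auto)
  fix y assume y: "y \<in> ?S"
  show "x \<oplus> y \<in> ?S"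
  proof (cases "x = \<zero> \<or> y = \<zero> \<or> x \<oplus> y = \<zero>")
    case False
    then have "r x * r y = r (x \<oplus> y) * (r x + r y)" using d(3) x y by auto
    then have "r (x \<oplus> y) \<noteq> 0" using x y False by auto
    then show ?thesis using x y False by auto
  qed (use x y in auto)
qed auto

text \<open>The support together with 0 is a nonzero subspace of \<open>V'\<close>. Were it proper,
  the point would lie in the locus of that smaller subspace, which the stratum removes.\<close>

lemma Q_stratum_support:
  assumes V': "lin_subspace W V'" and x: "x \<in> Q_stratum W V'" and r: "r \<in> x"
  shows "v \<in> carrier W - {\<zero>} \<Longrightarrow> r v \<noteq> 0 \<longleftrightarrow> v \<in> V'"
proof -
  have xl: "x \<in> Q_locus W V'" using x by (simp add: Q_stratum_def)
  then have xp: "x \<in> Q_points W" by (simp add: Q_locus_def)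
  note q = Q_points_rep[OF xp r]
  let ?S = "insert \<zero> {v \<in> carrier W - {\<zero>}. r v \<noteq> 0}"
  have S: "lin_subspace W ?S" by (rule reciprocal_support_subspace[OF q(1)])
  have "r v = 0" if "v \<in> carrier W - V'" for v using xl r that by (simp add: Q_locus_def)
  then have sub: "?S \<subseteq> V'" using subspaceD(2)[OF V'] by auto
  have "?S = V'"
  proof (rule ccontr)
    assume "?S \<noteq> V'"
    then have "?S \<subset> V'" using sub by blast
    moreover have "x \<in> Q_locus W ?S"
      unfolding Q_locus_def
    proof (intro CollectI conjI xp ballI)
      fix r' v assume "r' \<in> x" "v \<in> carrier W - ?S"
      moreover then obtain c where "r' = (\<lambda>v\<in>carrier W - {\<zero>}. c * r v)" unfolding q(2) Q_class_def by blast
      ultimately show "r' v = 0" by auto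
    qed
    moreover have "?S \<noteq> {\<zero>}" using q(3) by auto
    ultimately show False using x S unfolding Q_stratum_def by blast
  qed
  then show "v \<in> carrier W - {\<zero>} \<Longrightarrow> r v \<noteq> 0 \<longleftrightarrow> v \<in> V'" by blast
qed

text \<open>Dividing the reciprocal relation by the three values involved is precisely additivity of
  1/r.\<close>

lemma reciprocal_form:
  assumes V': "lin_subspace W V'" and r: "reciprocal W r"
    and nz: "\<And>v. v \<in> V' \<Longrightarrow> v \<noteq> \<zero> \<Longrightarrow> r v \<noteq> 0"
  shows "reciprocal_form W V' r \<in> carrier (forms (on W V'))"
    "\<And>v. v \<in> V' \<Longrightarrow> v \<noteq> \<zero> \<Longrightarrow> val (on W V') (reciprocal_form W V' r) v = 1 / r v"
proof -
  interpret V': fvsp "on W V'" by (rule fvsp_on[OF V'])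
  note s = subspaceD[OF V'] and d = reciprocalD[OF r]
  define lam where "lam v = (if v = \<zero> then 0 else 1 / r v)" for v
  have sm: "lam (c \<odot> v) = to_ac c * lam v" if v: "v \<in> V'" for c v
  proof (cases "c = 0 \<or> v = \<zero>")
    case False
    then have "c \<odot> v \<noteq> \<zero>" using smult_cancel[of v c "\<zero>"] s(6)[OF v] by auto
    then show ?thesis using False s(6)[OF v] d(2)[of c v] by (simp add: lam_def divide_inverse)
  qed (use s(6)[OF v] in \<open>auto simp: lam_def\<close>)
  have "klin (on W V') lam"
  proof -
    have "lam (x \<oplus> y) = lam x + lam y" if xy: "x \<in> V'" "y \<in> V'" for x y
    proof -
      consider "x = \<zero> \<or> y = \<zero>" | "x \<noteq> \<zero>" "y \<noteq> \<zero>" "x \<oplus> y = \<zero>" | "x \<noteq> \<zero>" "y \<noteq> \<zero>" "x \<oplus> y \<noteq> \<zero>" by blast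
      then show ?thesis
      proof cases
        case 1
        then show ?thesis using s(6) xy by (auto simp: lam_def)
      next
        case 2
        \<comment> \<open>The reciprocal relation says nothing when x + y = 0; homogeneity under -1
          takes its place.\<close>
        then have "y = (-1) \<odot> x" using s(6) xy by (metis minus_equality smult_minus1 add.m_comm minus_minus)
        then have "lam y = - lam x" using sm[OF xy(1), of "-1"] by simp
        then show ?thesis using 2 by (simp add: lam_def)
      next
        case 3
        have n: "r x \<noteq> 0" "r y \<noteq> 0" using 3 nz xy by auto
        have eq: "r x * r y = r (x \<oplus> y) * (r x + r y)" using 3 d(3) s(6) xy by auto
        then have "r x + r y \<noteq> 0" using n by (metis mult_eq_0_iff)
        then have "(r x + r y) / (r x * r y) = 1 / r (x \<oplus> y)" unfolding eq by simp
        then show ?thesis using 3 n by (simp add: lam_def add_frac_eq add.commute)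
      qed
    qed
    then show ?thesis using sm by (simp add: klin_def)
  qed
  then obtain l where l: "l \<in> carrier (forms (on W V'))" "\<And>w. w \<in> V' \<Longrightarrow> val (on W V') l w = lam w"
    using V'.form_exists by auto
  have "reciprocal_form W V' r = l"
    unfolding reciprocal_form_def val_def[symmetric]
  proof (rule the_equality)
    show "l \<in> carrier (forms (on W V')) \<and> (\<forall>v\<in>V' - {\<zero>}. val (on W V') l v = 1 / r v)"
      using l by (auto simp: lam_def)
    fix l' assume l': "l' \<in> carrier (forms (on W V')) \<and> (\<forall>v\<in>V' - {\<zero>}. val (on W V') l' v = 1 / r v)"
    show "l' = l"
    proof (rule V'.form_eqI)
      fix w assume "w \<in> carrier (on W V')"
      then show "val (on W V') l' w = val (on W V') l w"
        using l' l(2)[of w] V'.klin_0[OF V'.val_klin, of l'] by (cases "w = \<zero>") (auto simp: lam_def)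
    qed (use l l' in auto)
  qed
  then show "reciprocal_form W V' r \<in> carrier (forms (on W V'))"
    "\<And>v. v \<in> V' \<Longrightarrow> v \<noteq> \<zero> \<Longrightarrow> val (on W V') (reciprocal_form W V' r) v = 1 / r v"
    using l by (auto simp: lam_def)
qed

lemma GL_nonzero: "f \<in> carrier (GL W) \<Longrightarrow> v \<in> carrier W \<Longrightarrow> f v = \<zero> \<longleftrightarrow> v = \<zero>"
  using GL_stable_subspace(2)[OF subspace_zero, of f v] GL_D(6)[of f "\<zero>" 0] GL_D(2)[of f "\<zero>"] by auto

text \<open>Rescaling the representative of g by b multiplies the reciprocal map by the inverse of
  b, so again all representatives give one class.\<close>

lemma Q_act_fixed_iff:
  assumes f: "f \<in> carrier (GL W)" and r: "reciprocal W r"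
  shows "Q_act W (Q_class r) (pgl_class W f) = Q_class r \<longleftrightarrow>
    (\<exists>c. c \<noteq> 0 \<and> (\<forall>v\<in>carrier W - {\<zero>}. r (f v) = c * r v))"
proof -
  let ?V = "carrier W - {\<zero>}"
  let ?r = "\<lambda>v\<in>?V. r (f v)"
  note d = reciprocalD[OF r] and f' = GL_D[OF f]
  have fV: "f v \<in> ?V" if "v \<in> ?V" for v using that GL_nonzero[OF f] f'(2) by auto
  have *: "compose ?V (\<lambda>v\<in>?V. a * r v) (\<lambda>x\<in>carrier W. b \<odot> f x) = (\<lambda>v\<in>?V. (a * inverse (to_ac b)) * ?r v)"
    if "b \<noteq> 0" for a b
  proof (rule ext)
    fix v
    have "b \<odot> f v \<noteq> \<zero>" if "v \<in> ?V"
      using smult_cancel[of "f v" b "\<zero>"] \<open>b \<noteq> 0\<close> fV[OF that] by auto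
    then show "compose ?V (\<lambda>v\<in>?V. a * r v) (\<lambda>x\<in>carrier W. b \<odot> f x) v = (\<lambda>v\<in>?V. (a * inverse (to_ac b)) * ?r v) v"
      using fV[of v] d(2)[OF \<open>b \<noteq> 0\<close>, of "f v"] by (auto simp: compose_def)
  qed
  have act: "Q_act W (Q_class r) (pgl_class W f) = Q_class ?r"
    unfolding Q_act_def
  proof (intro equalityI subsetI)
    fix u assume "u \<in> {compose ?V r' \<gamma> |r' \<gamma>. r' \<in> Q_class r \<and> \<gamma> \<in> pgl_class W f}"
    then obtain r' \<gamma> where u: "u = compose ?V r' \<gamma>" "r' \<in> Q_class r" "\<gamma> \<in> pgl_class W f" by blast
    obtain a where a: "a \<noteq> 0" "r' = (\<lambda>v\<in>?V. a * r v)" using u(2) unfolding Q_class_def by blast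
    obtain b where b: "b \<noteq> 0" "\<gamma> = (\<lambda>x\<in>carrier W. b \<odot> f x)" using u(3) unfolding pgl_class_eq[OF f] by blast
    have "u = (\<lambda>v\<in>?V. (a * inverse (to_ac b)) * ?r v)" unfolding u(1) a(2) b(2) by (rule *[OF b(1)])
    then show "u \<in> Q_class ?r" unfolding Q_class_def using a(1) b(1)
      by (intro CollectI exI[of _ "a * inverse (to_ac b)"]) auto
  next
    fix u assume "u \<in> Q_class ?r"
    then obtain a where a: "a \<noteq> 0" "u = (\<lambda>v\<in>?V. a * ?r v)" unfolding Q_class_def by blast
    have "u = compose ?V (\<lambda>v\<in>?V. a * r v) (\<lambda>x\<in>carrier W. 1 \<odot> f x)" using *[of 1 a] a(2) by simp
    moreover have "(\<lambda>x\<in>carrier W. 1 \<odot> f x) \<in> pgl_class W f"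
      unfolding pgl_class_eq[OF f] by (intro CollectI exI[of _ 1]) simp
    moreover have "(\<lambda>v\<in>?V. a * r v) \<in> Q_class r" using a(1) unfolding Q_class_def by blast
    ultimately show "u \<in> {compose ?V r' \<gamma> |r' \<gamma>. r' \<in> Q_class r \<and> \<gamma> \<in> pgl_class W f}" by blast
  qed
  show ?thesis
    unfolding act
  proof
    assume "Q_class ?r = Q_class r"
    then have "?r \<in> Q_class r" using Q_class_self[of ?r] by simp
    then obtain c where c: "c \<noteq> 0" "?r = (\<lambda>v\<in>?V. c * r v)" unfolding Q_class_def by blast
    have "r (f v) = c * r v" if "v \<in> ?V" for v using fun_cong[OF c(2), of v] that by simp
    then show "\<exists>c. c \<noteq> 0 \<and> (\<forall>v\<in>?V. r (f v) = c * r v)" using c(1) by blast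
  next
    assume "\<exists>c. c \<noteq> 0 \<and> (\<forall>v\<in>?V. r (f v) = c * r v)"
    then obtain c where c: "c \<noteq> 0" "\<And>v. v \<in> ?V \<Longrightarrow> r (f v) = c * r v" by blast
    then have "?r = (\<lambda>v\<in>?V. c * r v)" by (intro restrict_ext)
    then show "Q_class ?r = Q_class r" using Q_class_scale[OF c(1)] by simp
  qed
qed

text \<open>Passing from \<open>r\<close> to l' = 1/r inverts the eigenvalue on \<open>V'\<close>.
  Outside \<open>V'\<close> the map \<open>r\<close> vanishes, and a representative preserving
  \<open>V'\<close> also preserves its complement as a set.\<close>

theorem Q_part:
  assumes g: "g \<in> carrier (PGL W)" and V': "lin_subspace W V'" "V' \<noteq> {\<zero>}"
    and x: "x \<in> Q_stratum W V'" and rx: "r \<in> x"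
  shows "let l' = reciprocal_form W V' r in
      (Q_act W x g = x \<longleftrightarrow>
        (\<exists>\<gamma>\<in>g. \<exists>V''. complement_in W (carrier W) V' V'' \<and>
          (\<exists>S\<in>carrier (GL (on W V')).
            (\<forall>v\<in>V'. \<gamma> v = S v) \<and>
            condition_F (on W V') l' (pgl_class (on W V') S)))) \<and>
      (\<forall>S\<in>carrier (GL (on W V')). condition_F (on W V') l' (pgl_class (on W V') S) \<longrightarrow>
        pgl_semisimple (on W V') (pgl_class (on W V') S))"
proof -
  interpret V': fvsp "on W V'" by (rule fvsp_on[OF V'(1)])
  have xp: "x \<in> Q_points W" using x unfolding Q_stratum_def Q_locus_def by blast
  note r = Q_points_rep[OF xp rx] and s = subspaceD[OF V'(1)]
  note supp = Q_stratum_support[OF V'(1) x rx]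
  have nz: "r v \<noteq> 0" if "v \<in> V'" "v \<noteq> \<zero>" for v using supp[of v] that s(6) by blast
  let ?l = "reciprocal_form W V' r"
  have l: "?l \<in> carrier (forms (on W V'))" "\<And>v. v \<in> V' \<Longrightarrow> v \<noteq> \<zero> \<Longrightarrow> val (on W V') ?l v = 1 / r v"
    using reciprocal_form[OF V'(1) r(1)] nz by auto
  have inj: "w = \<zero>\<^bsub>on W V'\<^esub>" if "w \<in> carrier (on W V')" "val (on W V') ?l w = 0" for w
    using that l(2)[of w] nz[of w] by auto
  have nt: "carrier (on W V') \<noteq> {\<zero>\<^bsub>on W V'\<^esub>}" using V'(2) by simp
  have cF: "condition_F (on W V') ?l (pgl_class (on W V') S) \<longleftrightarrow>
      (\<exists>c. c \<noteq> 0 \<and> (\<forall>w\<in>V'. val (on W V') ?l (S w) = c * val (on W V') ?l w))"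
    if "S \<in> carrier (GL (on W V'))" for S
    using V'.condition_F_iff[OF l(1) inj nt that] by simp
  obtain f where f: "f \<in> carrier (GL W)" "g = pgl_class W f" by (rule PGL_cases[OF g])
  have "Q_act W x g = x \<longleftrightarrow>
        (\<exists>\<gamma>\<in>g. \<exists>V''. complement_in W (carrier W) V' V'' \<and>
          (\<exists>S\<in>carrier (GL (on W V')).
            (\<forall>v\<in>V'. \<gamma> v = S v) \<and>
            condition_F (on W V') ?l (pgl_class (on W V') S)))" (is "?L \<longleftrightarrow> ?R")
  proof
    assume ?L
    then obtain c where c: "c \<noteq> 0" "\<And>v. v \<in> carrier W - {\<zero>} \<Longrightarrow> r (f v) = c * r v"
      using Q_act_fixed_iff[OF f(1) r(1)] r(2) f(2) by metis
    have f0: "f v = \<zero> \<longleftrightarrow> v = \<zero>" if "v \<in> carrier W" for v by (rule GL_nonzero[OF f(1) that])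
    have fV': "f v \<in> V'" if "v \<in> V'" for v
    proof (cases "v = \<zero>")
      case False
      then have "r (f v) \<noteq> 0" using c nz[OF that] s(6)[OF that] by simp
      then show ?thesis using supp[of "f v"] GL_D(2)[OF f(1) s(6)[OF that]] f0[OF s(6)[OF that]] False by simp
    qed (use f0[OF s(6)[OF that]] s(2) in simp)
    define S where "S = restrict f V'"
    have "f ` V' = V'" by (rule GL_stable_subspace(1)[OF V'(1) f(1) fV'])
    then have S: "S \<in> carrier (GL (on W V'))"
      using GL_D(5,6)[OF f(1)] s inj_on_subset[OF GL_D(4)[OF f(1)] s(1)]
      by (intro V'.GL_I) (auto simp: S_def inj_on_restrict_eq)
    have "val (on W V') ?l (S w) = inverse c * val (on W V') ?l w" if w: "w \<in> V'" for w
    proof (cases "w = \<zero>")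
      case True
      then show ?thesis using f0[of w] s(2) V'.klin_0[OF V'.val_klin[OF l(1)]] by (simp add: S_def)
    next
      case False
      then show ?thesis using w f0[of w] s(6) fV' c l(2)[of w] l(2)[of "f w"] by (simp add: S_def field_simps)
    qed
    then have "condition_F (on W V') ?l (pgl_class (on W V') S)" using cF[OF S] c(1) by (metis nonzero_imp_inverse_nonzero)
    \<comment> \<open>Any complement will do, as the block that carries the condition is the
      restriction to \<open>V'\<close>.\<close>
    moreover obtain C where "complement_in W (carrier W) V' C"
      using exists_complement[OF fin subspace_carrier V'(1) s(1)] by blast
    moreover have "\<forall>v\<in>V'. f v = S v" by (simp add: S_def)
    ultimately show ?R using pgl_class_self[OF f(1)] f(2) S by blast
  next
    assume ?R
    then obtain \<gamma> S where \<gamma>: "\<gamma> \<in> g" and S: "S \<in> carrier (GL (on W V'))" and eq: "\<And>v. v \<in> V' \<Longrightarrow> \<gamma> v = S v"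
      and F: "condition_F (on W V') ?l (pgl_class (on W V') S)" by blast
    have G: "\<gamma> \<in> carrier (GL W)" using pgl_class_GL[OF f(1)] \<gamma> f(2) by simp
    have g_eq: "g = pgl_class W \<gamma>" using pgl_class_rep[OF f(1)] f(2) \<gamma> by simp
    obtain c where c: "c \<noteq> 0" "\<And>w. w \<in> V' \<Longrightarrow> val (on W V') ?l (S w) = c * val (on W V') ?l w"
      using F cF[OF S] by blast
    have gV: "\<gamma> v \<in> V'" if "v \<in> V'" for v using eq[OF that] V'.GL_D(2)[OF S, of v] that by simp
    have "r (\<gamma> v) = inverse c * r v" if v: "v \<in> carrier W - {\<zero>}" for v
    proof (cases "v \<in> V'")
      case True
      have "\<gamma> v \<noteq> \<zero>" using GL_nonzero[OF G] v by simp
      then have "1 / r (\<gamma> v) = c * (1 / r v)"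
        using c(2)[OF True] l(2)[OF True] l(2)[OF gV[OF True]] eq[OF True] v by simp
      then have "inverse (1 / r (\<gamma> v)) = inverse (c * (1 / r v))" by simp
      then show ?thesis by (simp add: divide_inverse)
    next
      case False
      then have "\<gamma> v \<notin> V'" using GL_stable_subspace(2)[OF V'(1) G gV] v by blast
      then show ?thesis using supp[of v] supp[of "\<gamma> v"] False v GL_nonzero[OF G] GL_D(2)[OF G] by simp
    qed
    then show ?L using Q_act_fixed_iff[OF G r(1)] g_eq c(1) r(2) by (metis nonzero_imp_inverse_nonzero)
  qed
  moreover have "pgl_semisimple (on W V') (pgl_class (on W V') S)"
    if S: "S \<in> carrier (GL (on W V'))" "condition_F (on W V') ?l (pgl_class (on W V') S)" for S
  proof -
    obtain c where c: "c \<noteq> 0" "\<And>w. w \<in> V' \<Longrightarrow> val (on W V') ?l (S w) = c * val (on W V') ?l w"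
      using S(2) cF[OF S(1)] by blast
    show ?thesis
      by (rule V'.eigenform_imp_semisimple[OF V'.val_klin[OF l(1)] inj nt S(1) c(1)]) (use c(2) in auto)
  qed
  ultimately show ?thesis unfolding Let_def by blast
qed

end

section \<open>Families of forms\<close>

text \<open>In a field with N elements X^N - X + 1 is constantly 1, yet an algebraically closed
  field must contain a root of it.\<close>

lemma infinite_alg_closure: "infinite (UNIV :: 'k :: field alg_closure set)"
proof
  assume fin: "finite (UNIV :: 'k alg_closure set)"
  let ?N = "card (UNIV :: 'k alg_closure set)"
  have N: "1 < ?N" using card_mono[OF fin, of "{0, 1}"] by simp
  define p :: "'k alg_closure poly" where "p = Polynomial.monom 1 ?N - Polynomial.monom 1 1 + 1"
  have p: "poly p x = 1" for x
    using finite_subfield_power_card(1)[OF field_UNIV_subfield fin, of x] by (simp add: p_def poly_monom)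
  have "Polynomial.coeff p ?N = 1" using N by (simp add: p_def)
  then have "0 < Polynomial.degree p" using N le_degree[of p ?N] by simp
  then obtain x where "poly p x = 0" using alg_closed_imp_poly_has_root by blast
  then show False using p[of x] by simp
qed

context fvsp
begin

abbreviation "NS \<equiv> nonzero_subspaces W"
abbreviation "lv l U \<equiv> val (on W U) (l U)"

lemma NS_D:
  assumes "U \<in> NS"
  shows "lin_subspace W U" "\<exists>u\<in>U. u \<noteq> \<zero>" "fvsp (on W U)" "\<And>u. u \<in> U \<Longrightarrow> u \<in> carrier W"
proof -
  show U: "lin_subspace W U" using assms by (simp add: nonzero_subspaces_def)
  show "\<exists>u\<in>U. u \<noteq> \<zero>" using assms subspaceD(2)[OF U] unfolding nonzero_subspaces_def by blast
  show "fvsp (on W U)" by (rule fvsp_on[OF U])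
  show "\<And>u. u \<in> U \<Longrightarrow> u \<in> carrier W" by (rule subspaceD(6)[OF U])
qed

lemma NS_superset: "U \<in> NS \<Longrightarrow> lin_subspace W A \<Longrightarrow> U \<subseteq> A \<Longrightarrow> A \<in> NS"
  using NS_D(2) by (auto simp: nonzero_subspaces_def)

lemma incl_hom: "U' \<subseteq> U \<Longrightarrow> (\<lambda>w. w) \<in> lin_hom (on W U') (on W U)"
  by (auto simp: lin_hom_iff)

lemma B_familyD:
  assumes "B_family W l"
  shows "l \<in> extensional NS" "\<And>U. U \<in> NS \<Longrightarrow> l U \<in> carrier (forms (on W U))"
    "\<And>U. U \<in> NS \<Longrightarrow> \<exists>u\<in>U. lv l U u \<noteq> 0" "\<And>U. U \<in> NS \<Longrightarrow> klin (on W U) (lv l U)"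
    "\<And>U U'. U \<in> NS \<Longrightarrow> U' \<in> NS \<Longrightarrow> U' \<subseteq> U \<Longrightarrow> \<exists>c. \<forall>w\<in>U'. lv l U w = c * lv l U' w"
proof -
  show "l \<in> extensional NS" using assms by (simp add: B_family_def)
  show f: "\<And>U. U \<in> NS \<Longrightarrow> l U \<in> carrier (forms (on W U))" using assms by (simp add: B_family_def)
  show "\<exists>u\<in>U. lv l U u \<noteq> 0" if U: "U \<in> NS" for U
  proof (rule ccontr)
    interpret U: fvsp "on W U" by (rule NS_D(3)[OF U])
    assume "\<not> ?thesis"
    then have "l U = \<zero>\<^bsub>forms (on W U)\<^esub>" by (intro U.form_eqI f U) (auto simp: U.val_simps)
    then show False using assms U by (simp add: B_family_def)
  qed
  show "klin (on W U) (lv l U)" if U: "U \<in> NS" for U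
    by (rule fvsp.val_klin[OF NS_D(3)[OF U] f[OF U]])
  show "\<exists>c. \<forall>w\<in>U'. lv l U w = c * lv l U' w" if U: "U \<in> NS" "U' \<in> NS" "U' \<subseteq> U" for U U'
  proof -
    interpret U': fvsp "on W U'" by (rule NS_D(3)[OF U(2)])
    obtain c where c: "pull_form (on W U') (on W U) (\<lambda>w. w) (l U) = c \<odot>\<^bsub>forms (on W U')\<^esub> l U'"
      using assms U unfolding B_family_def by blast
    have "lv l U w = c * lv l U' w" if "w \<in> U'" for w
      using pull_form(2)[OF NS_D(3)[OF U(2)] NS_D(3)[OF U(1)] incl_hom[OF U(3)] f[OF U(1)], of w] that
      by (simp add: c U'.val_simps)
    then show ?thesis by blast
  qed
qed

lemma B_familyI:
  assumes "l \<in> extensional NS" and f: "\<And>U. U \<in> NS \<Longrightarrow> l U \<in> carrier (forms (on W U))"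
    and nz: "\<And>U. U \<in> NS \<Longrightarrow> \<exists>u\<in>U. lv l U u \<noteq> 0"
    and r: "\<And>U U'. U \<in> NS \<Longrightarrow> U' \<in> NS \<Longrightarrow> U' \<subseteq> U \<Longrightarrow> \<exists>c. \<forall>w\<in>U'. lv l U w = c * lv l U' w"
  shows "B_family W l"
  unfolding B_family_def
proof (intro conjI ballI impI assms(1) f)
  fix U assume U: "U \<in> NS"
  interpret U: fvsp "on W U" by (rule NS_D(3)[OF U])
  show "l U \<noteq> \<zero>\<^bsub>forms (on W U)\<^esub>" using nz[OF U] by (auto simp: U.val_simps)
  fix U' assume U': "U' \<in> NS" "U' \<subseteq> U"
  interpret U': fvsp "on W U'" by (rule NS_D(3)[OF U'(1)])
  note p = pull_form[OF NS_D(3)[OF U'(1)] NS_D(3)[OF U] incl_hom[OF U'(2)] f[OF U]]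
  obtain c where c: "\<And>w. w \<in> U' \<Longrightarrow> lv l U w = c * lv l U' w" using r[OF U U'] by blast
  have "pull_form (on W U') (on W U) (\<lambda>w. w) (l U) = c \<odot>\<^bsub>forms (on W U')\<^esub> l U'"
    by (rule U'.form_eqI) (use p c f[OF U'(1)] in \<open>auto simp: U'.val_simps\<close>)
  then show "\<exists>c. pull_form (on W U') (on W U) (\<lambda>w. w) (l U) = c \<odot>\<^bsub>forms (on W U')\<^esub> l U'" by blast
qed

lemma B_class_iff:
  assumes "\<forall>U\<in>NS. l U \<in> carrier (forms (on W U))"
  shows "u \<in> B_class W l \<longleftrightarrow> u \<in> extensional NS \<and> (\<forall>U\<in>NS. u U \<in> carrier (forms (on W U))) \<and>
    (\<forall>U\<in>NS. \<exists>c. c \<noteq> 0 \<and> (\<forall>w\<in>U. lv u U w = c * lv l U w))"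
proof
  note f = assms[rule_format]
  assume "u \<in> B_class W l"
  then obtain c where c: "\<forall>U\<in>NS. c U \<noteq> 0" "u = (\<lambda>U\<in>NS. c U \<odot>\<^bsub>forms (on W U)\<^esub> l U)"
    unfolding B_class_def by blast
  have "u U \<in> carrier (forms (on W U)) \<and> (\<forall>w\<in>U. lv u U w = c U * lv l U w)" if U: "U \<in> NS" for U
  proof -
    interpret U: fvsp "on W U" by (rule NS_D(3)[OF U])
    show ?thesis using U f[OF U] by (simp add: c(2) U.val_simps)
  qed
  moreover have "u \<in> extensional NS" by (simp add: c(2))
  ultimately show "u \<in> extensional NS \<and> (\<forall>U\<in>NS. u U \<in> carrier (forms (on W U))) \<and>
    (\<forall>U\<in>NS. \<exists>c. c \<noteq> 0 \<and> (\<forall>w\<in>U. lv u U w = c * lv l U w))" using c(1) by blast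
next
  note f = assms[rule_format]
  assume u: "u \<in> extensional NS \<and> (\<forall>U\<in>NS. u U \<in> carrier (forms (on W U))) \<and>
    (\<forall>U\<in>NS. \<exists>c. c \<noteq> 0 \<and> (\<forall>w\<in>U. lv u U w = c * lv l U w))"
  then have "\<forall>U\<in>NS. \<exists>c. c \<noteq> 0 \<and> (\<forall>w\<in>U. lv u U w = c * lv l U w)" by blast
  then obtain c where c: "\<forall>U\<in>NS. c U \<noteq> 0 \<and> (\<forall>w\<in>U. lv u U w = c U * lv l U w)"
    unfolding bchoice_iff by blast
  have "u = (\<lambda>U\<in>NS. c U \<odot>\<^bsub>forms (on W U)\<^esub> l U)"
  proof (rule extensionalityI[of _ NS])
    fix U assume U: "U \<in> NS"
    interpret U: fvsp "on W U" by (rule NS_D(3)[OF U])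
    have "u U = c U \<odot>\<^bsub>forms (on W U)\<^esub> l U"
      by (rule U.form_eqI) (use u c f[OF U] U in \<open>auto simp: U.val_simps\<close>)
    then show "u U = (\<lambda>U\<in>NS. c U \<odot>\<^bsub>forms (on W U)\<^esub> l U) U" using U by simp
  qed (use u in auto)
  then show "u \<in> B_class W l" unfolding B_class_def using c by blast
qed

lemma B_class_self: "B_family W l \<Longrightarrow> l \<in> B_class W l"
  using B_familyD(1,2)[of l] by (subst B_class_iff) (auto intro: exI[of _ 1])

lemma B_points_rep:
  assumes "x \<in> B_points W" "l \<in> x"
  shows "B_family W l" "x = B_class W l"
proof -
  obtain l0 where l0: "x = B_class W l0" "B_family W l0" using assms(1) unfolding B_points_def by blast
  note d = B_familyD[OF l0(2)]
  have d2: "\<forall>U\<in>NS. l0 U \<in> carrier (forms (on W U))" using d(2) by blast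
  have l: "l \<in> extensional NS" "\<And>U. U \<in> NS \<Longrightarrow> l U \<in> carrier (forms (on W U))"
    "\<And>U. U \<in> NS \<Longrightarrow> \<exists>c. c \<noteq> 0 \<and> (\<forall>w\<in>U. lv l U w = c * lv l0 U w)"
    using assms(2) unfolding l0(1) B_class_iff[OF d2] by auto
  have l2: "\<forall>U\<in>NS. l U \<in> carrier (forms (on W U))" using l(2) by blast
  have "\<forall>U\<in>NS. \<exists>c. c \<noteq> 0 \<and> (\<forall>w\<in>U. lv l U w = c * lv l0 U w)" using l(3) by blast
  then obtain c where "\<forall>U\<in>NS. c U \<noteq> 0 \<and> (\<forall>w\<in>U. lv l U w = c U * lv l0 U w)"
    unfolding bchoice_iff by blast
  then have c: "\<And>U. U \<in> NS \<Longrightarrow> c U \<noteq> 0" "\<And>U w. U \<in> NS \<Longrightarrow> w \<in> U \<Longrightarrow> lv l U w = c U * lv l0 U w"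
    by blast+
  show fam: "B_family W l"
  proof (rule B_familyI[OF l(1,2)])
    show "\<exists>u\<in>U. lv l U u \<noteq> 0" if "U \<in> NS" for U using d(3)[OF that] c that by force
    fix U U' assume U: "U \<in> NS" "U' \<in> NS" "U' \<subseteq> U"
    obtain a where a: "\<And>w. w \<in> U' \<Longrightarrow> lv l0 U w = a * lv l0 U' w" using d(5)[OF U] by blast
    have "lv l U w = (c U * a / c U') * lv l U' w" if "w \<in> U'" for w
      using that U a c by (auto simp: subset_iff)
    then show "\<exists>c. \<forall>w\<in>U'. lv l U w = c * lv l U' w" by blast
  qed
  have 1: "(\<exists>a. a \<noteq> 0 \<and> (\<forall>w\<in>U. lv u U w = a * lv l0 U w)) \<longleftrightarrow> (\<exists>a. a \<noteq> 0 \<and> (\<forall>w\<in>U. lv u U w = a * lv l U w))"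
    if U: "U \<in> NS" for U u
  proof
    assume "\<exists>a. a \<noteq> 0 \<and> (\<forall>w\<in>U. lv u U w = a * lv l0 U w)"
    then obtain a where "a \<noteq> 0" "\<forall>w\<in>U. lv u U w = a * lv l0 U w" by blast
    then show "\<exists>a. a \<noteq> 0 \<and> (\<forall>w\<in>U. lv u U w = a * lv l U w)"
      using c U by (intro exI[of _ "a / c U"]) auto
  next
    assume "\<exists>a. a \<noteq> 0 \<and> (\<forall>w\<in>U. lv u U w = a * lv l U w)"
    then obtain a where "a \<noteq> 0" "\<forall>w\<in>U. lv u U w = a * lv l U w" by blast
    then show "\<exists>a. a \<noteq> 0 \<and> (\<forall>w\<in>U. lv u U w = a * lv l0 U w)"
      using c U by (intro exI[of _ "a * c U"]) auto
  qed
  show "x = B_class W l"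
  proof (intro equalityI subsetI)
    show "u \<in> B_class W l" if "u \<in> x" for u
      using that 1 unfolding l0(1) B_class_iff[OF d2] B_class_iff[OF l2] by (metis (no_types, lifting))
    show "u \<in> x" if "u \<in> B_class W l" for u
      using that 1 unfolding l0(1) B_class_iff[OF d2] B_class_iff[OF l2] by (metis (no_types, lifting))
  qed
qed

lemma blow_down_class:
  assumes fam: "B_family W l" and nt: "carrier W \<in> NS"
  shows "blow_down W (B_class W l) = P_class W (l (carrier W))"
proof -
  have l: "l (carrier W) \<in> carrier F" using B_familyD(2)[OF fam nt] by simp
  show ?thesis
  proof (intro equalityI subsetI)
    fix u assume "u \<in> blow_down W (B_class W l)"
    then obtain l' where u: "u = l' (carrier W)" "l' \<in> B_class W l" unfolding blow_down_def by blast
    obtain c where "\<forall>U\<in>NS. c U \<noteq> 0" "l' = (\<lambda>U\<in>NS. c U \<odot>\<^bsub>forms (on W U)\<^esub> l U)"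
      using u(2) unfolding B_class_def by blast
    then have "\<forall>U\<in>NS. c U \<noteq> 0" "u = c (carrier W) \<odot>\<^bsub>F\<^esub> l (carrier W)" using u(1) nt by simp_all
    then show "u \<in> P_class W (l (carrier W))" using nt unfolding P_class_def by blast
  next
    fix u assume "u \<in> P_class W (l (carrier W))"
    then obtain c where c: "c \<noteq> 0" "u = c \<odot>\<^bsub>F\<^esub> l (carrier W)" unfolding P_class_def by blast
    let ?l = "\<lambda>U\<in>NS. c \<odot>\<^bsub>forms (on W U)\<^esub> l U"
    have "?l \<in> B_class W l" unfolding B_class_def
      by (intro CollectI exI[of _ "\<lambda>_. c"]) (use c(1) in simp)
    moreover have "?l (carrier W) = u" using nt c(2) by simp
    ultimately show "u \<in> blow_down W (B_class W l)" unfolding blow_down_def by blast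
  qed
qed

section \<open>The divisors\<close>

text \<open>The value in question is a coordinate, so it suffices that it vanishes over the open
  part. There the form on W has kernel exactly \<open>U\<close> and is nonzero on \<open>U'\<close>;
  its restriction is thus a nonzero multiple of the form on \<open>U'\<close>, which inherits the
  zeros in \<open>U\<close>.\<close>

lemma B_divisor_kills:
  assumes U: "lin_subspace W U" and x: "x \<in> B_divisor W U" and l: "l \<in> x"
    and U': "U' \<in> NS" "\<not> U' \<subseteq> U" and w: "w \<in> U'" "w \<in> U"
  shows "lv l U' w = 0"
proof -
  have nt: "carrier W \<in> NS"
    using NS_superset[OF U'(1) subspace_carrier] NS_D(4)[OF U'(1)] by blast
  interpret U': fvsp "on W U'" by (rule NS_D(3)[OF U'(1)])
  let ?p = "\<lambda>l. l U' (tensor (on W U') w 1)"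
  have p: "?p \<in> B_polynomials W" by (rule B_polynomials.coord[OF U'(1)]) simp
  have "?p l' = 0" if y: "y \<in> B_points W" "blow_down W y \<in> P_stratum W U" and l': "l' \<in> y" for y l'
  proof -
    note r = B_points_rep[OF y(1) l']
    note d = B_familyD[OF r(1)]
    have lF: "l' (carrier W) \<in> carrier F" using d(2)[OF nt] by simp
    have nz: "\<exists>v\<in>carrier W. val W (l' (carrier W)) v \<noteq> 0" using d(3)[OF nt] by simp
    have "P_class W (l' (carrier W)) \<in> P_stratum W U" using y(2) r blow_down_class[OF r(1) nt] by simp
    then have ker: "\<And>v. v \<in> carrier W \<Longrightarrow> val W (l' (carrier W)) v = 0 \<longleftrightarrow> v \<in> U"
      using P_stratum_iff[OF U lF nz] by blast
    obtain c where c: "\<And>w. w \<in> U' \<Longrightarrow> val W (l' (carrier W)) w = c * lv l' U' w"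
      using d(5)[OF nt U'(1)] NS_D(4)[OF U'(1)] by auto
    obtain w' where w': "w' \<in> U'" "w' \<notin> U" using U'(2) by blast
    then have "c \<noteq> 0" using c[of w'] ker[of w'] NS_D(4)[OF U'(1)] by auto
    then have "lv l' U' w = 0" using c[of w] ker[of w] w NS_D(4)[OF U'(1)] by auto
    then show ?thesis by (simp add: val_def)
  qed
  then have z: "\<forall>y\<in>{x \<in> B_points W. blow_down W x \<in> P_stratum W U}. \<forall>l\<in>y. ?p l = 0"
    by (intro ballI) (elim CollectE conjE)
  have "\<forall>p\<in>B_polynomials W. (\<forall>y\<in>{x \<in> B_points W. blow_down W x \<in> P_stratum W U}. \<forall>l\<in>y. p l = 0) \<longrightarrow> (\<forall>l\<in>x. p l = 0)"
    using x unfolding B_divisor_def B_closure_def by (elim CollectE conjE)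
  from bspec[OF mp[OF bspec[OF this p] z] l] have "?p l = 0" .
  then show ?thesis by (simp add: val_def)
qed

section \<open>Deforming a family into the open part of a divisor\<close>

definition plin :: "'w set \<Rightarrow> ('w \<Rightarrow> 'k alg_closure poly) \<Rightarrow> bool" where
  "plin A n \<longleftrightarrow> (\<forall>x\<in>A. \<forall>y\<in>A. n (x \<oplus> y) = n x + n y) \<and> (\<forall>c. \<forall>x\<in>A. n (c \<odot> x) = Polynomial.smult (to_ac c) (n x))"

text \<open>
  For \<open>t\<close> outside a finite set, \<open>v \<mapsto> poly (n v) t\<close> has kernel \<open>U\<close>; divided by \<open>t\<^sup>j\<close> its restriction to \<open>U'\<close>
  tends to a multiple of \<open>l\<^bsub>U'\<^esub>\<close> as \<open>t\<close> tends to \<open>0\<close>.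
\<close>

definition deforms :: "('k, 'w) form_family \<Rightarrow> 'w set \<Rightarrow> 'w set \<Rightarrow> ('w \<Rightarrow> 'k alg_closure poly) \<Rightarrow> bool" where
  "deforms l U A n \<longleftrightarrow> plin A n \<and> (\<forall>v\<in>A. n v = 0 \<longleftrightarrow> v \<in> U) \<and>
    (\<forall>U'\<in>NS. U' \<subseteq> A \<longrightarrow> \<not> U' \<subseteq> U \<longrightarrow>
      (\<exists>j c q. c \<noteq> 0 \<and> (\<forall>w\<in>U'. n w = [:0, 1:] ^ j * q w \<and> poly (q w) 0 = c * lv l U' w)))"

lemma deformsD:
  assumes "deforms l U A n"
  shows "plin A n" "v \<in> A \<Longrightarrow> n v = 0 \<longleftrightarrow> v \<in> U"
    "U' \<in> NS \<Longrightarrow> U' \<subseteq> A \<Longrightarrow> \<not> U' \<subseteq> U \<Longrightarrow>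
      \<exists>j c q. c \<noteq> 0 \<and> (\<forall>w\<in>U'. n w = [:0, 1:] ^ j * q w \<and> poly (q w) 0 = c * lv l U' w)"
  using assms by (simp_all add: deforms_def)

context
  fixes l U
  assumes fam: "B_family W l" and U: "lin_subspace W U"
    and kills: "\<And>U' w. U' \<in> NS \<Longrightarrow> \<not> U' \<subseteq> U \<Longrightarrow> w \<in> U' \<Longrightarrow> w \<in> U \<Longrightarrow> lv l U' w = 0"
begin

text \<open>
  \<open>n = l\<^sub>0 + t l\<^sub>1 + t\<^sup>2 l\<^sub>2 + \<dots>\<close>, where \<open>l\<^sub>i\<close> extends the form on the \<open>i\<close>-th of the subspaces starting with \<open>A\<close>, each
  the kernel of the form on the preceding one.
\<close>

lemma deformation_exists:
  assumes "A \<in> NS" "U \<subset> A"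
  shows "\<exists>n. deforms l U A n"
  using assms
proof (induction "card A" arbitrary: A rule: less_induct)
  case less
  note d = B_familyD[OF fam]
  note A = NS_D[OF less.prems(1)]
  interpret A: fvsp "on W A" by (rule A(3))
  let ?lam = "lv l A"
  note k = d(4)[OF less.prems(1)]
  define K where "K = {v \<in> A. ?lam v = 0}"
  have KA: "lin_subspace (on W A) K" using A.klin_kernel_subspace[OF k] by (simp add: K_def)
  have K: "lin_subspace W K" "K \<subseteq> A" using KA by (simp_all add: subspace_on_iff[OF A(1)])
  \<comment> \<open>The vanishing hypothesis for \<open>A\<close> itself, which is not contained in
    \<open>U\<close>.\<close>
  have UK: "U \<subseteq> K" using kills[OF less.prems(1)] less.prems(2) by (auto simp: K_def)
  have "K \<noteq> A" using d(3)[OF less.prems(1)] by (auto simp: K_def)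
  obtain n1 where "deforms l U K n1"
  proof (cases "K = U")
    case True
    \<comment> \<open>If the kernel is already \<open>U\<close>, the deformation has no further
      terms.\<close>
    show ?thesis by (rule that[of "\<lambda>_. 0"]) (use True in \<open>auto simp: plin_def deforms_def\<close>)
  next
    case False
    then have "U \<subset> K" using UK by blast
    moreover have "card K < card A" using \<open>K \<noteq> A\<close> K(2) A.fin by (intro psubset_card_mono) auto
    moreover have "K \<in> NS" using K(1) \<open>U \<subset> K\<close> subspaceD(2)[OF U] by (auto simp: nonzero_subspaces_def)
    ultimately show ?thesis using less.hyps[of K] that by blast
  qed
  note n1 = deformsD[OF this]
  \<comment> \<open>Extends \<open>n1\<close> from \<open>K\<close> to \<open>A\<close>. Any linear
    extension serves, because outside \<open>K\<close> the constant term of \<open>n\<close> is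
    nonzero.\<close>
  obtain p where p: "p \<in> lin_hom (on W A) (on W A)" "\<And>x. x \<in> A \<Longrightarrow> p x \<in> K" "\<And>x. x \<in> K \<Longrightarrow> p x = x"
    using A.exists_projection[OF A.fin KA] by auto
  define n where "n v = pCons (?lam v) (n1 (p v))" for v
  have "plin A n"
    using n1(1) p(1,2) klinD[OF k] by (simp add: plin_def n_def lin_hom_iff)
  moreover have "\<forall>v\<in>A. n v = 0 \<longleftrightarrow> v \<in> U"
  proof
    fix v assume v: "v \<in> A"
    have "n v = 0 \<longleftrightarrow> v \<in> K \<and> n1 (p v) = 0" using v by (simp add: n_def K_def)
    also have "\<dots> \<longleftrightarrow> v \<in> U" using p(3)[of v] n1(2)[of v] UK by auto
    finally show "n v = 0 \<longleftrightarrow> v \<in> U" .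
  qed
  moreover have "\<exists>j c q. c \<noteq> 0 \<and> (\<forall>w\<in>U'. n w = [:0, 1:] ^ j * q w \<and> poly (q w) 0 = c * lv l U' w)"
    if U': "U' \<in> NS" "U' \<subseteq> A" "\<not> U' \<subseteq> U" for U'
  proof (cases "U' \<subseteq> K")
    case True
    obtain j c q where q: "c \<noteq> 0" "\<forall>w\<in>U'. n1 w = [:0, 1:] ^ j * q w \<and> poly (q w) 0 = c * lv l U' w"
      using n1(3)[OF U'(1) True U'(3)] by (elim exE conjE)
    \<comment> \<open>On \<open>K\<close> the constant term vanishes and \<open>p\<close> is the
      identity, so \<open>n\<close> is t times \<open>n1\<close> and the exponent goes up by
      one.\<close>
    have "n w = [:0, 1:] ^ Suc j * q w" if w: "w \<in> U'" for w
    proof -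
      have wK: "w \<in> K" using w True by blast
      then have "n w = [:0, 1:] * n1 w" using p(3)[OF wK] by (simp add: n_def K_def)
      also have "n1 w = [:0, 1:] ^ j * q w" using q(2) w by blast
      finally show ?thesis by (simp only: power_Suc mult.assoc)
    qed
    then show ?thesis using q by (intro exI[of _ "Suc j"] exI[of _ c] exI[of _ q]) blast
  next
    case False
    \<comment> \<open>A subspace reaching outside \<open>K\<close> sees the constant term, so no
      power of t is split off and \<open>q\<close> is \<open>n\<close> itself.\<close>
    obtain c where c: "\<And>w. w \<in> U' \<Longrightarrow> ?lam w = c * lv l U' w" using d(5)[OF less.prems(1) U'(1,2)] by blast
    obtain w where "w \<in> U'" "w \<notin> K" using False by blast
    then have "c \<noteq> 0" using c[of w] U'(2) by (auto simp: K_def)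
    moreover have "n w = [:0, 1:] ^ 0 * n w \<and> poly (n w) 0 = c * lv l U' w" if "w \<in> U'" for w
      using c[OF that] by (simp add: n_def)
    ultimately show ?thesis by blast
  qed
  ultimately have "deforms l U A n" unfolding deforms_def by blast
  then show ?case by blast
qed

text \<open>The deformation on W is restricted to each subspace and divided by the power of t it
  carries there. The quotient is polynomial in t, gives \<open>l\<close> at t = 0, and for general t
  comes from one form with kernel \<open>U\<close>.\<close>

lemma deformed_families:
  assumes nt: "carrier W \<in> NS" and pr: "U \<subset> carrier W"
  obtains L Z where "L 0 = l" "finite Z" "\<And>t. t \<notin> Z \<Longrightarrow> B_family W (L t)"
    "\<And>t v. t \<notin> Z \<Longrightarrow> v \<in> carrier W \<Longrightarrow> val W (L t (carrier W)) v = 0 \<longleftrightarrow> v \<in> U"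
    "\<And>U' y. U' \<in> NS \<Longrightarrow> y \<in> carrier (base_change (on W U')) \<Longrightarrow> \<exists>P. \<forall>t. L t U' y = poly P t"
proof -
  note d = B_familyD[OF fam]
  obtain n where "deforms l U (carrier W) n" using deformation_exists[OF nt pr] by blast
  note n = deformsD[OF this]
  have "\<forall>U'\<in>{U' \<in> NS. \<not> U' \<subseteq> U}. \<exists>j c q. c \<noteq> 0 \<and> (\<forall>w\<in>U'. n w = [:0, 1:] ^ j * q w \<and> poly (q w) 0 = c * lv l U' w)"
    using n(3) NS_D(4) by auto
  then obtain J c Q where "\<forall>U'\<in>{U' \<in> NS. \<not> U' \<subseteq> U}. c U' \<noteq> 0 \<and>
      (\<forall>w\<in>U'. n w = [:0, 1:] ^ J U' * Q U' w \<and> poly (Q U' w) 0 = c U' * lv l U' w)"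
    unfolding bchoice_iff by (elim exE)
  then have Q: "\<And>U'. U' \<in> NS \<Longrightarrow> \<not> U' \<subseteq> U \<Longrightarrow> c U' \<noteq> 0"
    "\<And>U' w. U' \<in> NS \<Longrightarrow> \<not> U' \<subseteq> U \<Longrightarrow> w \<in> U' \<Longrightarrow> n w = [:0, 1:] ^ J U' * Q U' w"
    "\<And>U' w. U' \<in> NS \<Longrightarrow> \<not> U' \<subseteq> U \<Longrightarrow> w \<in> U' \<Longrightarrow> poly (Q U' w) 0 = c U' * lv l U' w"
    by auto
  \<comment> \<open>Inside \<open>U\<close>, where \<open>n\<close> vanishes, the forms of
    \<open>l\<close> are kept. Elsewhere the factor \<open>inverse (c U')\<close> normalises the
    quotient so that t = 0 returns \<open>l\<close>.\<close>
  define mu where "mu t U' w = (if U' \<subseteq> U then lv l U' w else inverse (c U') * poly (Q U' w) t)" for t U' w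
  have mu0: "mu 0 U' w = lv l U' w" if "U' \<in> NS" "w \<in> U'" for U' w
    using Q that by (simp add: mu_def)
  have mut: "mu t U' w = (inverse (c U') * inverse (t ^ J U')) * poly (n w) t"
    if "U' \<in> NS" "\<not> U' \<subseteq> U" "w \<in> U'" "t \<noteq> 0" for t U' w
    using Q that by (simp add: mu_def)
  have mu_klin: "klin (on W U') (mu t U')" if U': "U' \<in> NS" for t U'
  proof -
    note s = subspaceD[OF NS_D(1)[OF U']]
    consider "U' \<subseteq> U" | "\<not> U' \<subseteq> U" "t = 0" | "\<not> U' \<subseteq> U" "t \<noteq> 0" by blast
    then show ?thesis
    proof cases
      case 1
      then show ?thesis using d(4)[OF U'] by (simp add: mu_def klin_def)
    next
      case 2
      then show ?thesis using d(4)[OF U'] mu0[OF U'] s(3,4) by (simp add: klin_def)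
    next
      case 3
      then show ?thesis using n(1) mut[OF U'] s by (simp add: klin_def plin_def algebra_simps)
    qed
  qed
  have ex: "\<exists>f. f \<in> carrier (forms (on W U')) \<and> (\<forall>w\<in>U'. val (on W U') f w = mu t U' w)" if U': "U' \<in> NS" for t U'
  proof -
    interpret U': fvsp "on W U'" by (rule NS_D(3)[OF U'])
    show ?thesis
    proof (rule U'.form_exists[OF mu_klin[OF U', of t]])
      fix f
      assume "f \<in> carrier (forms (on W U'))" "\<And>w. w \<in> carrier (on W U') \<Longrightarrow> val (on W U') f w = mu t U' w"
      then show ?thesis by auto
    qed
  qed
  define L0 where "L0 t U' = (SOME f. f \<in> carrier (forms (on W U')) \<and> (\<forall>w\<in>U'. val (on W U') f w = mu t U' w))" for t U'
  have L0: "L0 t U' \<in> carrier (forms (on W U')) \<and> (\<forall>w\<in>U'. val (on W U') (L0 t U') w = mu t U' w)" if "U' \<in> NS" for t U'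
    unfolding L0_def by (rule someI_ex[OF ex[OF that]])
  define L where "L t = restrict (L0 t) NS" for t
  have L: "L t U' \<in> carrier (forms (on W U'))" "\<And>w. w \<in> U' \<Longrightarrow> lv (L t) U' w = mu t U' w" "L t \<in> extensional NS"
    if "U' \<in> NS" for t U'
    using L0 that by (simp_all add: L_def)
  \<comment> \<open>Excluded are t = 0, where powers of t cannot be cancelled, and the roots of the
    finitely many nonzero polynomials \<open>n v\<close>.\<close>
  define Z where "Z = insert 0 (\<Union>v\<in>carrier W - U. {t. poly (n v) t = 0})"
  have Z: "t \<noteq> 0" "\<And>v. v \<in> carrier W \<Longrightarrow> v \<notin> U \<Longrightarrow> poly (n v) t \<noteq> 0" if "t \<notin> Z" for t
    using that by (auto simp: Z_def)
  have s0: "inverse (c U') * inverse (t ^ J U') \<noteq> 0" if "t \<notin> Z" "U' \<in> NS" "\<not> U' \<subseteq> U" for t U'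
    using Z(1)[OF that(1)] Q(1)[OF that(2,3)] by simp
  show ?thesis
  proof (rule that[of L Z])
    show "L 0 = l"
    proof (rule extensionalityI[of _ NS])
      fix U' assume U': "U' \<in> NS"
      interpret U': fvsp "on W U'" by (rule NS_D(3)[OF U'])
      show "L 0 U' = l U'" by (rule U'.form_eqI) (use L[OF U'] d(2)[OF U'] mu0[OF U'] in auto)
    qed (use L[OF nt] d(1) in auto)
    show "finite Z" using n(2) fin unfolding Z_def by (auto intro: poly_roots_finite)
    show "B_family W (L t)" if t: "t \<notin> Z" for t
    proof (rule B_familyI)
      show "L t \<in> extensional NS" by (rule L(3)[OF nt])
      fix U' assume U': "U' \<in> NS"
      show "L t U' \<in> carrier (forms (on W U'))" by (rule L(1)[OF U'])
      show "\<exists>u\<in>U'. lv (L t) U' u \<noteq> 0"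
      proof (cases "U' \<subseteq> U")
        case True
        then show ?thesis using d(3)[OF U'] L(2)[OF U'] by (simp add: mu_def)
      next
        case False
        then obtain u where u: "u \<in> U'" "u \<notin> U" by blast
        then have "poly (n u) t \<noteq> 0" using Z(2)[OF t] NS_D(4)[OF U'] by blast
        then have "lv (L t) U' u \<noteq> 0"
          using L(2)[OF U' u(1)] mut[OF U' False u(1) Z(1)[OF t]] s0[OF t U' False] by simp
        then show ?thesis using u(1) by blast
      qed
      fix U'' assume U'': "U'' \<in> NS" "U'' \<subseteq> U'"
      consider "U' \<subseteq> U" | "\<not> U' \<subseteq> U" "U'' \<subseteq> U" | "\<not> U' \<subseteq> U" "\<not> U'' \<subseteq> U" by blast
      then show "\<exists>a. \<forall>w\<in>U''. lv (L t) U' w = a * lv (L t) U'' w"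
      proof cases
        case 1
        obtain a where "\<forall>w\<in>U''. lv l U' w = a * lv l U'' w" using d(5)[OF U' U''] by blast
        moreover have "lv (L t) U' w = lv l U' w" "lv (L t) U'' w = lv l U'' w" if "w \<in> U''" for w
          using that 1 U'' L(2)[OF U'] L(2)[OF U''(1)] by (auto simp: mu_def)
        ultimately show ?thesis by auto
      next
        \<comment> \<open>The form on \<open>U'\<close> vanishes on \<open>U''\<close>; the
          compatibility condition of a family admits the scalar 0.\<close>
        case 2
        have "lv (L t) U' w = 0 * lv (L t) U'' w" if w: "w \<in> U''" for w
        proof -
          have "n w = 0" using w 2(2) n(2)[of w] NS_D(4)[OF U''(1)] by blast
          moreover have "w \<in> U'" using w U''(2) by blast
          ultimately show ?thesis using L(2)[OF U'] mut[OF U' 2(1) _ Z(1)[OF t]] by simp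
        qed
        then show ?thesis by blast
      next
        case 3
        let ?s = "\<lambda>U'. inverse (c U') * inverse (t ^ J U')"
        have "lv (L t) U' w = (?s U' / ?s U'') * lv (L t) U'' w" if w: "w \<in> U''" for w
        proof -
          have w': "w \<in> U'" using w U''(2) by blast
          have "lv (L t) U' w = ?s U' * poly (n w) t"
            unfolding L(2)[OF U' w'] by (rule mut[OF U' 3(1) w' Z(1)[OF t]])
          moreover have "lv (L t) U'' w = ?s U'' * poly (n w) t"
            unfolding L(2)[OF U''(1) w] by (rule mut[OF U''(1) 3(2) w Z(1)[OF t]])
          moreover have "x = (a / b) * y" if "x = a * p" "y = b * p" "b \<noteq> 0" for x y a b p :: "'k alg_closure"
            using that by simp
          ultimately show ?thesis using s0[OF t U''(1) 3(2)] by blast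
        qed
        then show ?thesis by blast
      qed
    qed
    show "val W (L t (carrier W)) v = 0 \<longleftrightarrow> v \<in> U" if t: "t \<notin> Z" and v: "v \<in> carrier W" for t v
    proof -
      have np: "\<not> carrier W \<subseteq> U" using pr by blast
      have "val W (L t (carrier W)) v = (inverse (c (carrier W)) * inverse (t ^ J (carrier W))) * poly (n v) t"
        using L(2)[OF nt v, of t] mut[OF nt np v Z(1)[OF t]] by simp
      moreover have "poly (n v) t = 0 \<longleftrightarrow> v \<in> U" using Z(2)[OF t v] n(2)[OF v] by auto
      ultimately show ?thesis using s0[OF t nt np] Z(1)[OF t] by simp
    qed
    show "\<exists>P. \<forall>t. L t U' y = poly P t" if U': "U' \<in> NS" and y: "y \<in> carrier (base_change (on W U'))" for U' y
    proof -
      interpret U': fvsp "on W U'" by (rule NS_D(3)[OF U'])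
      obtain f where f: "\<And>l. l \<in> carrier (forms (on W U')) \<Longrightarrow> l y = (\<Sum>w\<in>U'. f w * val (on W U') l w)"
        using U'.form_coords[OF y] by auto
      define q where "q w = (if U' \<subseteq> U then [:lv l U' w:] else Polynomial.smult (inverse (c U')) (Q U' w))" for w
      have "L t U' y = poly (\<Sum>w\<in>U'. Polynomial.smult (f w) (q w)) t" for t
        unfolding f[OF L(1)[OF U']] poly_sum
        by (rule sum.cong) (simp_all add: L(2)[OF U'] mu_def q_def)
      then show ?thesis by blast
    qed
  qed
qed

end

lemma B_polynomial_curve:
  assumes "p \<in> B_polynomials W"
    and "\<And>U' y. U' \<in> NS \<Longrightarrow> y \<in> carrier (base_change (on W U')) \<Longrightarrow> \<exists>P. \<forall>t. L t U' y = poly P t"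
  shows "\<exists>P. \<forall>t. p (L t) = poly P t"
  using assms(1)
proof induction
  case (const c)
  then show ?case by (intro exI[of _ "[:c:]"]) simp
next
  case (coord U' y)
  then show ?case by (rule assms(2))
next
  case (add p p')
  then obtain P P' where "\<forall>t. p (L t) = poly P t" "\<forall>t. p' (L t) = poly P' t" by blast
  then show ?case by (intro exI[of _ "P + P'"]) simp
next
  case (mult p p')
  then obtain P P' where "\<forall>t. p (L t) = poly P t" "\<forall>t. p' (L t) = poly P' t" by blast
  then show ?case by (intro exI[of _ "P * P'"]) simp
qed

text \<open>A polynomial vanishing over the open stratum becomes, along the curve, a polynomial in t
  with infinitely many zeros. It is therefore zero, in particular at t = 0, where the curve passes
  through the given representative.\<close>

lemma kills_imp_B_divisor:
  assumes U: "U \<in> NS" "U \<subset> carrier W" and x: "x \<in> B_points W"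
    and kills: "\<And>l U' w. l \<in> x \<Longrightarrow> U' \<in> NS \<Longrightarrow> \<not> U' \<subseteq> U \<Longrightarrow> w \<in> U' \<Longrightarrow> w \<in> U \<Longrightarrow> lv l U' w = 0"
  shows "x \<in> B_divisor W U"
  unfolding B_divisor_def B_closure_def
proof (intro CollectI conjI x ballI impI)
  fix p l
  assume p: "p \<in> B_polynomials W" "\<forall>y\<in>{x \<in> B_points W. blow_down W x \<in> P_stratum W U}. \<forall>l\<in>y. p l = 0"
    and l: "l \<in> x"
  note r = B_points_rep[OF x l]
  have nt: "carrier W \<in> NS" using NS_superset[OF U(1) subspace_carrier] U(2) by blast
  obtain L Z where L: "L 0 = l" "finite Z" "\<And>t. t \<notin> Z \<Longrightarrow> B_family W (L t)"
    "\<And>t v. t \<notin> Z \<Longrightarrow> v \<in> carrier W \<Longrightarrow> val W (L t (carrier W)) v = 0 \<longleftrightarrow> v \<in> U"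
    "\<And>U' y. U' \<in> NS \<Longrightarrow> y \<in> carrier (base_change (on W U')) \<Longrightarrow> \<exists>P. \<forall>t. L t U' y = poly P t"
    by (rule deformed_families[OF r(1) NS_D(1)[OF U(1)] _ nt U(2)])
       ((rule kills[OF l]; assumption) | (rule that; assumption))+
  have "\<exists>P. \<forall>t. p (L t) = poly P t" by (rule B_polynomial_curve[OF p(1) L(5)])
  then obtain P where P: "\<And>t. p (L t) = poly P t" by blast
  have "poly P t = 0" if t: "t \<notin> Z" for t
  proof -
    note f = L(3)[OF t]
    have lF: "L t (carrier W) \<in> carrier F" using B_familyD(2)[OF f nt] by simp
    have "P_class W (L t (carrier W)) \<in> P_stratum W U"
      using P_stratum_iff[OF NS_D(1)[OF U(1)] lF] B_familyD(3)[OF f nt] L(4)[OF t] by simp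
    then have "blow_down W (B_class W (L t)) \<in> P_stratum W U" using blow_down_class[OF f nt] by simp
    moreover have "B_class W (L t) \<in> B_points W" using f unfolding B_points_def by blast
    ultimately have "p (L t) = 0" using p(2) B_class_self[OF f] by blast
    then show ?thesis using P by simp
  qed
  then have "- Z \<subseteq> {t. poly P t = 0}" by blast
  moreover have "infinite (- Z)" using L(2) infinite_alg_closure by (simp add: Compl_eq_Diff_UNIV)
  ultimately have "infinite {t. poly P t = 0}" using finite_subset by blast
  then have "P = 0" using poly_roots_finite by blast
  then show "p l = 0" using P[of 0] L(1) by simp
qed

end

context fvsp
begin

section \<open>Fixed families\<close>

lemma GL_image_NS:
  assumes f: "f \<in> carrier (GL W)" and U: "U \<in> NS"
  shows "f ` U \<in> NS"
proof -
  note s = subspaceD[OF NS_D(1)[OF U]] and f' = GL_D[OF f]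
  have "f ` U \<subseteq> carrier W" using s(6) f'(2) by blast
  moreover have "f \<zero> = \<zero>" using GL_nonzero[OF f, of \<zero>] by simp
  then have "\<zero> \<in> f ` U" using s(2) by force
  moreover have "\<forall>x\<in>U. \<forall>y\<in>U. f x \<oplus> f y \<in> f ` U" using f'(5) s(3,6) by (metis imageI)
  moreover have "\<forall>c. \<forall>x\<in>U. c \<odot> f x \<in> f ` U" using f'(6) s(4,6) by (metis imageI)
  ultimately have "lin_subspace W (f ` U)" by (auto simp: subspace_iff)
  moreover obtain u where "u \<in> U" "u \<noteq> \<zero>" using NS_D(2)[OF U] by blast
  then have "f ` U \<noteq> {\<zero>}" using GL_nonzero[OF f s(6)] by blast
  ultimately show ?thesis by (simp add: nonzero_subspaces_def)
qed

lemma GL_preimage_NS: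
  assumes f: "f \<in> carrier (GL W)" and U: "U \<in> NS"
  shows "{w \<in> carrier W. f w \<in> U} \<in> NS"
proof -
  note s = subspaceD[OF NS_D(1)[OF U]] and f' = GL_D[OF f]
  have "f \<zero> = \<zero>" using GL_nonzero[OF f, of \<zero>] by simp
  then have "lin_subspace W {w \<in> carrier W. f w \<in> U}"
    using s f' by (auto simp: subspace_iff)
  moreover obtain u where u: "u \<in> U" "u \<noteq> \<zero>" using NS_D(2)[OF U] by blast
  then obtain w where w: "w \<in> carrier W" "u = f w" using s(6) f'(3) by blast
  then have "w \<noteq> \<zero>" using u(2) \<open>f \<zero> = \<zero>\<close> by blast
  then have "{w \<in> carrier W. f w \<in> U} \<noteq> {\<zero>}" using w u(1) by blast
  ultimately show ?thesis by (simp add: nonzero_subspaces_def)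
qed

lemma GL_restrict_hom:
  assumes f: "f \<in> carrier (GL W)" and U: "U \<in> NS"
  shows "f \<in> lin_hom (on W U) (on W (f ` U))"
  using GL_D(5,6)[OF f] NS_D(4)[OF U] by (auto simp: lin_hom_iff)

lemma family_eqI:
  assumes "u \<in> extensional NS" "u' \<in> extensional NS"
    and "\<And>U. U \<in> NS \<Longrightarrow> u U \<in> carrier (forms (on W U))" "\<And>U. U \<in> NS \<Longrightarrow> u' U \<in> carrier (forms (on W U))"
    and "\<And>U w. U \<in> NS \<Longrightarrow> w \<in> U \<Longrightarrow> lv u U w = lv u' U w"
  shows "u = u'"
proof (rule extensionalityI[OF assms(1,2)])
  fix U assume U: "U \<in> NS"
  show "u U = u' U" by (rule fvsp.form_eqI[OF NS_D(3)[OF U]]) (use assms(3-5) U in auto)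
qed

lemma B_act_fixed_iff:
  assumes f: "f \<in> carrier (GL W)" and fam: "B_family W l"
  shows "B_act W (B_class W l) (pgl_class W f) = B_class W l \<longleftrightarrow>
    (\<forall>U\<in>NS. \<exists>c. c \<noteq> 0 \<and> (\<forall>w\<in>U. lv l (f ` U) (f w) = c * lv l U w))"
proof -
  have l: "\<forall>U\<in>NS. l U \<in> carrier (forms (on W U))" using B_familyD(2)[OF fam] by blast
  define act where "act \<gamma> l' = (\<lambda>U\<in>NS. pull_form (on W U) (on W (\<gamma> ` U)) \<gamma> (l' (\<gamma> ` U)))" for \<gamma> and l' :: "('k, 'w) form_family"
  have act: "act \<gamma> l' U \<in> carrier (forms (on W U))" "\<And>w. w \<in> U \<Longrightarrow> lv (act \<gamma> l') U w = lv l' (\<gamma> ` U) (\<gamma> w)"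
    if G: "\<gamma> \<in> carrier (GL W)" and l': "\<forall>U\<in>NS. l' U \<in> carrier (forms (on W U))" and U: "U \<in> NS" for \<gamma> l' U
  proof -
    note N = GL_image_NS[OF G U]
    note p = pull_form[OF NS_D(3)[OF U] NS_D(3)[OF N] GL_restrict_hom[OF G U] l'[rule_format, OF N]]
    show "act \<gamma> l' U \<in> carrier (forms (on W U))" using p(1) U by (simp add: act_def)
    show "lv (act \<gamma> l') U w = lv l' (\<gamma> ` U) (\<gamma> w)" if "w \<in> U" for w
      using p(2)[of w] that U by (simp add: act_def)
  qed
  have act_ext: "act \<gamma> l' \<in> extensional NS" for \<gamma> l' by (simp add: act_def)
  note fl = act[OF f l]
  have fl': "\<forall>U\<in>NS. act f l U \<in> carrier (forms (on W U))" using fl(1) by blast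
  have "B_act W (B_class W l) (pgl_class W f) = B_class W (act f l)"
    unfolding B_act_def
  proof (intro equalityI subsetI)
    fix u
    assume "u \<in> {\<lambda>U\<in>NS. pull_form (on W U) (on W (\<gamma> ` U)) \<gamma> (l' (\<gamma> ` U)) |l' \<gamma>. l' \<in> B_class W l \<and> \<gamma> \<in> pgl_class W f}"
    then obtain l' \<gamma> where u: "u = act \<gamma> l'" and l': "l' \<in> B_class W l" and \<gamma>: "\<gamma> \<in> pgl_class W f"
      unfolding act_def by blast
    obtain b where b: "b \<noteq> 0" "\<gamma> = (\<lambda>x\<in>carrier W. b \<odot> f x)" using \<gamma> unfolding pgl_class_eq[OF f] by blast
    have G: "\<gamma> \<in> carrier (GL W)" by (rule pgl_class_GL[OF f \<gamma>])
    have lf: "\<forall>U\<in>NS. l' U \<in> carrier (forms (on W U))"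
      and l'_scale: "\<forall>U\<in>NS. \<exists>c. c \<noteq> 0 \<and> (\<forall>w\<in>U. lv l' U w = c * lv l U w)"
      using l' unfolding B_class_iff[OF l] by simp_all
    have "\<exists>c. c \<noteq> 0 \<and> (\<forall>w\<in>U. lv u U w = c * lv (act f l) U w)" if U: "U \<in> NS" for U
    proof -
      note N = GL_image_NS[OF f U]
      note s = subspaceD[OF NS_D(1)[OF N]]
      have \<gamma>w: "\<gamma> w = b \<odot> f w" if "w \<in> U" for w using b(2) NS_D(4)[OF U that] by simp
      have "f w \<in> \<gamma> ` U" if w: "w \<in> U" for w
      proof -
        have "inverse b \<odot> w \<in> U" using subspaceD(4)[OF NS_D(1)[OF U] w] .
        moreover have "\<gamma> (inverse b \<odot> w) = f w"
          using \<gamma>w[OF \<open>inverse b \<odot> w \<in> U\<close>] GL_D(2,6)[OF f NS_D(4)[OF U w]] b(1) by (simp add: smult_smult)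
        ultimately show ?thesis by (metis imageI)
      qed
      \<comment> \<open>The two maps differ by a nonzero scalar, which carries the subspace
        \<open>f\<close> makes of \<open>U\<close> to itself.\<close>
      then have im: "\<gamma> ` U = f ` U" using s(4) \<gamma>w by auto
      obtain a where a: "a \<noteq> 0" "\<And>w. w \<in> f ` U \<Longrightarrow> lv l' (f ` U) w = a * lv l (f ` U) w"
        using bspec[OF l'_scale N] by blast
      have "lv u U w = (a * to_ac b) * lv (act f l) U w" if w: "w \<in> U" for w
        using act(2)[OF G lf U w] fl(2)[OF U w] a(2)[of "b \<odot> f w"] s(4) w im \<gamma>w[OF w]
          klinD(2)[OF B_familyD(4)[OF fam N], of "f w" b]
        by (simp add: u)
      then show ?thesis using a(1) b(1) by (intro exI[of _ "a * to_ac b"]) simp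
    qed
    moreover have "\<forall>U\<in>NS. u U \<in> carrier (forms (on W U))" using act(1)[OF G lf] u by blast
    ultimately show "u \<in> B_class W (act f l)"
      unfolding B_class_iff[OF fl'] using act_ext u by blast
  next
    fix u assume "u \<in> B_class W (act f l)"
    then have u: "u \<in> extensional NS" "\<And>U. U \<in> NS \<Longrightarrow> u U \<in> carrier (forms (on W U))"
      "\<forall>U\<in>NS. \<exists>c. c \<noteq> 0 \<and> (\<forall>w\<in>U. lv u U w = c * lv (act f l) U w)"
      unfolding B_class_iff[OF fl'] by blast+
    obtain c where c: "\<And>U. U \<in> NS \<Longrightarrow> c U \<noteq> 0" "\<And>U w. U \<in> NS \<Longrightarrow> w \<in> U \<Longrightarrow> lv u U w = c U * lv (act f l) U w"
      using u(3) unfolding bchoice_iff by blast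
    \<comment> \<open>The member of \<open>act f l'\<close> at \<open>U\<close> comes from the
      member of \<open>l'\<close> at the image of \<open>U\<close>, so the factor \<open>c U\<close>
      must be attached to that image; \<open>?pre\<close> recovers \<open>U\<close> from it.\<close>
    let ?pre = "\<lambda>U. {w \<in> carrier W. f w \<in> U}"
    have pre: "?pre (f ` U) = U" if U: "U \<in> NS" for U
      using GL_D(4)[OF f] NS_D(4)[OF U] by (auto dest: inj_onD)
    define l' where "l' = (\<lambda>U\<in>NS. c (?pre U) \<odot>\<^bsub>forms (on W U)\<^esub> l U)"
    have l': "l' \<in> B_class W l"
      unfolding B_class_def l'_def
      by (intro CollectI exI[of _ "\<lambda>U. c (?pre U)"] conjI refl ballI) (rule c(1)[OF GL_preimage_NS[OF f]])
    then have lf: "\<forall>U\<in>NS. l' U \<in> carrier (forms (on W U))" unfolding B_class_iff[OF l] by blast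
    have "u = act f l'"
    proof (rule family_eqI[OF u(1) act_ext u(2) act(1)[OF f lf]])
      fix U w assume U: "U \<in> NS" and w: "w \<in> U"
      note N = GL_image_NS[OF f U]
      interpret N: fvsp "on W (f ` U)" by (rule NS_D(3)[OF N])
      have "lv l' (f ` U) (f w) = c U * lv l (f ` U) (f w)"
        unfolding l'_def restrict_apply'[OF N] pre[OF U] using l N w by (simp add: N.val_simps)
      then show "lv u U w = lv (act f l') U w" using c(2)[OF U w] act(2)[OF f lf U w] fl(2)[OF U w] by simp
    qed auto
    then show "u \<in> {\<lambda>U\<in>NS. pull_form (on W U) (on W (\<gamma> ` U)) \<gamma> (l' (\<gamma> ` U)) |l' \<gamma>. l' \<in> B_class W l \<and> \<gamma> \<in> pgl_class W f}"
      using l' pgl_class_self[OF f] unfolding act_def by blast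
  qed
  moreover have "B_class W (act f l) = B_class W l \<longleftrightarrow>
    (\<forall>U\<in>NS. \<exists>c. c \<noteq> 0 \<and> (\<forall>w\<in>U. lv l (f ` U) (f w) = c * lv l U w))" (is "?L \<longleftrightarrow> ?R")
  proof
    assume ?L
    have "act f l \<in> B_class W (act f l)"
      unfolding B_class_iff[OF fl'] using act_ext fl' by (auto intro: exI[of _ 1])
    then have "act f l \<in> B_class W l" using \<open>?L\<close> by simp
    then have "\<forall>U\<in>NS. \<exists>c. c \<noteq> 0 \<and> (\<forall>w\<in>U. lv (act f l) U w = c * lv l U w)"
      unfolding B_class_iff[OF l] by blast
    then show ?R using fl(2) by auto
  next
    assume ?R
    then obtain c where c: "\<And>U. U \<in> NS \<Longrightarrow> c U \<noteq> 0" "\<And>U w. U \<in> NS \<Longrightarrow> w \<in> U \<Longrightarrow> lv (act f l) U w = c U * lv l U w"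
      unfolding bchoice_iff using fl(2) by metis
    have "(\<exists>a. a \<noteq> 0 \<and> (\<forall>w\<in>U. lv u U w = a * lv (act f l) U w)) \<longleftrightarrow> (\<exists>a. a \<noteq> 0 \<and> (\<forall>w\<in>U. lv u U w = a * lv l U w))"
      if U: "U \<in> NS" for u U
    proof
      assume "\<exists>a. a \<noteq> 0 \<and> (\<forall>w\<in>U. lv u U w = a * lv (act f l) U w)"
      then obtain a where "a \<noteq> 0" "\<forall>w\<in>U. lv u U w = a * lv (act f l) U w" by blast
      then show "\<exists>a. a \<noteq> 0 \<and> (\<forall>w\<in>U. lv u U w = a * lv l U w)"
        using c[OF U] by (intro exI[of _ "a * c U"]) simp
    next
      assume "\<exists>a. a \<noteq> 0 \<and> (\<forall>w\<in>U. lv u U w = a * lv l U w)"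
      then obtain a where "a \<noteq> 0" "\<forall>w\<in>U. lv u U w = a * lv l U w" by blast
      then show "\<exists>a. a \<noteq> 0 \<and> (\<forall>w\<in>U. lv u U w = a * lv (act f l) U w)"
        using c[OF U] by (intro exI[of _ "a / c U"]) simp
    qed
    then show ?L unfolding set_eq_iff B_class_iff[OF l] B_class_iff[OF fl'] by simp
  qed
  ultimately show ?thesis by simp
qed

section \<open>Flags\<close>

text \<open>The last conclusion finds, for a nonzero subspace, the last term of the chain containing
  it; the form on that term does not vanish on the subspace, by \<open>B_stratum_kernel\<close>, and
  so controls its form.\<close>

lemma flag_chain:
  assumes "is_flag W Fs"
  shows "flag_chain W Fs ! 0 = carrier W" "flag_chain W Fs ! Suc (length Fs) = {\<zero>}"
    and "i < j \<Longrightarrow> j \<le> Suc (length Fs) \<Longrightarrow> flag_chain W Fs ! j \<subset> flag_chain W Fs ! i"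
    and "i \<le> Suc (length Fs) \<Longrightarrow> lin_subspace W (flag_chain W Fs ! i)"
    and "i \<le> length Fs \<Longrightarrow> flag_chain W Fs ! i \<in> NS"
    and "i < length Fs \<Longrightarrow> flag_chain W Fs ! Suc i \<in> set Fs"
    and "U \<in> set Fs \<Longrightarrow> \<exists>j. 0 < j \<and> j \<le> length Fs \<and> U = flag_chain W Fs ! j"
    and "U \<in> NS \<Longrightarrow> \<exists>i\<le>length Fs. U \<subseteq> flag_chain W Fs ! i \<and> \<not> U \<subseteq> flag_chain W Fs ! Suc i"
proof -
  let ?C = "flag_chain W Fs" and ?n = "length Fs"
  have Fs: "\<And>U. U \<in> set Fs \<Longrightarrow> lin_subspace W U" and s: "sorted_wrt (\<lambda>A B. B \<subset> A) ?C"
    using assms by (auto simp: is_flag_def)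
  show 0: "?C ! 0 = carrier W" by (simp add: flag_chain_def)
  show n: "?C ! Suc ?n = {\<zero>}" by (simp add: flag_chain_def nth_append)
  have len: "length ?C = Suc (Suc ?n)" by (simp add: flag_chain_def)
  show dec: "?C ! j \<subset> ?C ! i" if "i < j" "j \<le> Suc ?n" for i j
    using sorted_wrt_nth_less[OF s] that len by simp
  have Cs: "?C ! Suc i = Fs ! i" if "i < ?n" for i using that by (simp add: flag_chain_def nth_append)
  show "?C ! Suc i \<in> set Fs" if "i < ?n" for i using that Cs by simp
  have "set ?C = insert (carrier W) (insert {\<zero>} (set Fs))" by (auto simp: flag_chain_def)
  then show sub: "lin_subspace W (?C ! i)" if "i \<le> Suc ?n" for i
    using nth_mem[of i ?C] that len Fs subspace_carrier subspace_zero by auto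
  show "?C ! i \<in> NS" if "i \<le> ?n" for i
    using sub[of i] dec[of i "Suc ?n"] that n by (auto simp: nonzero_subspaces_def)
  show "\<exists>j. 0 < j \<and> j \<le> ?n \<and> U = ?C ! j" if U: "U \<in> set Fs" for U
  proof -
    obtain i where "i < ?n" "U = Fs ! i" using U by (auto simp: in_set_conv_nth)
    then show ?thesis using Cs by (intro exI[of _ "Suc i"]) auto
  qed
  show "\<exists>i\<le>?n. U \<subseteq> ?C ! i \<and> \<not> U \<subseteq> ?C ! Suc i" if U: "U \<in> NS" for U
  proof (rule ccontr)
    assume *: "\<not> ?thesis"
    have "U \<subseteq> ?C ! i" if "i \<le> Suc ?n" for i
      using that by (induction i) (use 0 NS_D(4)[OF U] * in auto)
    then have "U \<subseteq> {\<zero>}" using n by fastforce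
    then show False using NS_D(2)[OF U] by blast
  qed
qed

lemma B_ratio_nonzero:
  assumes fam: "B_family W l" and U: "U \<in> NS" "U' \<in> NS" "U' \<subseteq> U" and u: "u \<in> U'" "lv l U u \<noteq> 0"
  obtains c where "c \<noteq> 0" "\<And>w. w \<in> U' \<Longrightarrow> lv l U w = c * lv l U' w"
proof -
  obtain c where c: "\<And>w. w \<in> U' \<Longrightarrow> lv l U w = c * lv l U' w" using B_familyD(5)[OF fam U] by blast
  moreover have "c \<noteq> 0" using c[OF u(1)] u(2) by auto
  ultimately show ?thesis by (rule that[rotated])
qed

text \<open>The divisors of the flag put the next term of the chain inside the kernel
  \<open>K\<close>. If \<open>K\<close> were larger, the point would also lie in the divisor of
  \<open>K\<close>, which stands strictly between two consecutive terms and so is outside the flag;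
  the stratum excludes this.\<close>

lemma B_stratum_kernel:
  assumes flag: "is_flag W Fs" and x: "x \<in> B_stratum W (set Fs)" and lx: "l \<in> x" and i: "i \<le> length Fs"
    and v: "v \<in> flag_chain W Fs ! i"
  shows "lv l (flag_chain W Fs ! i) v = 0 \<longleftrightarrow> v \<in> flag_chain W Fs ! Suc i"
proof -
  let ?C = "flag_chain W Fs"
  note C = flag_chain[OF flag]
  have xB: "x \<in> B_points W" and xD: "\<And>U. U \<in> set Fs \<Longrightarrow> x \<in> B_divisor W U"
    and xN: "\<And>U. U \<in> NS \<Longrightarrow> U \<subset> carrier W \<Longrightarrow> x \<in> B_divisor W U \<Longrightarrow> U \<in> set Fs"
    using x unfolding B_stratum_def by blast+
  note fam = B_points_rep[OF xB lx]
  note N = C(5)[OF i]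
  interpret A: fvsp "on W (?C ! i)" by (rule NS_D(3)[OF N])
  note k = B_familyD(4)[OF fam(1) N]
  define K where "K = {v \<in> ?C ! i. lv l (?C ! i) v = 0}"
  have K: "lin_subspace W K"
    using A.klin_kernel_subspace[OF k] by (simp add: K_def subspace_on_iff[OF NS_D(1)[OF N]])
  have CK: "?C ! Suc i \<subseteq> K"
  proof
    fix w assume w: "w \<in> ?C ! Suc i"
    then have wi: "w \<in> ?C ! i" using C(3)[of i "Suc i"] i by auto
    have "lv l (?C ! i) w = 0"
    proof (cases "i = length Fs")
      case True
      then have "w = \<zero>" using w C(2) by simp
      then show ?thesis using A.klin_0[OF k] by simp
    next
      case False
      then have "?C ! Suc i \<in> set Fs" using C(6) i by simp
      moreover have "\<not> ?C ! i \<subseteq> ?C ! Suc i" using C(3)[of i "Suc i"] i by auto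
      ultimately show ?thesis
        using B_divisor_kills[OF C(4)[of "Suc i"] xD lx N _ wi w] i by simp
    qed
    then show "w \<in> K" using wi by (simp add: K_def)
  qed
  have "K = ?C ! Suc i"
  proof (rule ccontr)
    assume "K \<noteq> ?C ! Suc i"
    then have CK': "?C ! Suc i \<subset> K" using CK by blast
    have KN: "K \<in> NS" using K CK' subspaceD(2)[OF C(4)[of "Suc i"]] i by (auto simp: nonzero_subspaces_def)
    have Ki: "K \<subset> ?C ! i" using B_familyD(3)[OF fam(1) N] by (auto simp: K_def)
    have Kc: "K \<subset> carrier W" using Ki NS_D(4)[OF N] by blast
    have "x \<in> B_divisor W K"
    proof (rule kills_imp_B_divisor[OF KN Kc xB])
      fix l' U w assume l': "l' \<in> x" and U: "U \<in> NS" "\<not> U \<subseteq> K" and w: "w \<in> U" "w \<in> K"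
      note fam' = B_points_rep[OF xB l']
      have f': "\<forall>U\<in>NS. l' U \<in> carrier (forms (on W U))" using B_familyD(2)[OF fam'(1)] by blast
      obtain a where a: "a \<noteq> 0" "\<And>w. w \<in> ?C ! i \<Longrightarrow> lv l (?C ! i) w = a * lv l' (?C ! i) w"
        using lx N unfolding fam'(2) B_class_iff[OF f'] by blast
      have K': "v \<in> K \<longleftrightarrow> lv l' (?C ! i) v = 0" if "v \<in> ?C ! i" for v
        using a that by (simp add: K_def)
      show "lv l' U w = 0"
      proof (cases "U \<subseteq> ?C ! i")
        case True
        obtain u where u: "u \<in> U" "u \<notin> K" using U(2) by blast
        then have "lv l' (?C ! i) u \<noteq> 0" using K' True by blast
        then obtain c where c: "c \<noteq> 0" "\<And>w. w \<in> U \<Longrightarrow> lv l' (?C ! i) w = c * lv l' U w"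
          using B_ratio_nonzero[OF fam'(1) N U(1) True u(1)] by blast
        have "lv l' (?C ! i) w = 0" using K'[of w] w True by blast
        then show ?thesis using c(1) c(2)[OF w(1)] by simp
      next
        case False
        \<comment> \<open>A subspace not inside term i leaves the chain earlier. The term after that
          point belongs to the flag and contains \<open>K\<close>, so its divisor already forces the
          vanishing at \<open>w\<close>.\<close>
        obtain j where j: "j \<le> length Fs" "U \<subseteq> ?C ! j" "\<not> U \<subseteq> ?C ! Suc j" using C(8)[OF U(1)] by blast
        have ji: "j < i"
        proof (rule ccontr)
          assume "\<not> j < i"
          then have "?C ! j \<subseteq> ?C ! i" using C(3)[of i j] j(1) by (cases "i = j") auto
          then show False using j(2) False by blast
        qed
        then have "?C ! i \<subseteq> ?C ! Suc j" using C(3)[of "Suc j" i] i by (cases "i = Suc j") auto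
        then have "w \<in> ?C ! Suc j" using w(2) Ki by blast
        then show ?thesis
          using B_divisor_kills[OF C(4)[of "Suc j"] xD l' U(1) j(3) w(1)] C(6)[of j] ji i by simp
      qed
    qed
    then have "K \<in> set Fs" by (rule xN[OF KN Kc])
    then obtain j where j: "0 < j" "j \<le> length Fs" "K = ?C ! j" using C(7) by blast
    consider "j < i" | "j = i" | "j = Suc i" | "Suc i < j" by linarith
    then show False
    proof cases
      case 1
      then show False using C(3)[of j i] i Ki j(3) by auto
    next
      case 4
      then show False using C(3)[of "Suc i" j] j(2,3) CK' by auto
    qed (use Ki CK' j(3) in auto)
  qed
  then show ?thesis using v by (auto simp: K_def)
qed

text \<open>From a fixed point, stability descends from W, each term being the kernel of the form on
  the one above. Conversely the block relations contain the triangular shape: stability is recovered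
  from the zero space upward, and the eigenvector equations on the chain yield those on all
  subspaces.\<close>

theorem B_part:
  assumes g: "g \<in> carrier (PGL W)" and flag: "is_flag W Fs"
    and x: "x \<in> B_stratum W (set Fs)" and lx: "l \<in> x"
  shows "let C = flag_chain W Fs in
      (B_act W x g = x \<longleftrightarrow>
        (\<exists>\<gamma>\<in>g. \<exists>V' S. \<forall>i\<le>length Fs.
          complement_in W (C ! i) (C ! Suc i) (V' i) \<and>
          S i \<in> carrier (GL (on W (V' i))) \<and>
          (\<forall>v\<in>V' i. \<gamma> v \<ominus> S i v \<in> C ! Suc i) \<and>
          condition_F_quot W (C ! i) (C ! Suc i) (V' i) (l (C ! i)) (S i))) \<and>
      (\<forall>i\<le>length Fs. \<forall>V'. complement_in W (C ! i) (C ! Suc i) V' \<longrightarrow>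
        (\<forall>S\<in>carrier (GL (on W V')).
          condition_F_quot W (C ! i) (C ! Suc i) V' (l (C ! i)) S \<longrightarrow>
          pgl_semisimple (on W V') (pgl_class (on W V') S)))"
proof -
  define C where "C = flag_chain W Fs"
  let ?n = "length Fs"
  note C = flag_chain[OF flag, folded C_def]
  note ker = B_stratum_kernel[OF flag x lx, folded C_def]
  have "x \<in> B_points W" using x unfolding B_stratum_def by blast
  note r = B_points_rep[OF this lx]
  note d = B_familyD[OF r(1)]
  have dec: "C ! Suc i \<subset> C ! i" "lin_subspace W (C ! i)" "lin_subspace W (C ! Suc i)" "C ! i \<in> NS" if "i \<le> ?n" for i
    using C(3)[of i "Suc i"] C(4)[of i] C(4)[of "Suc i"] C(5) that by auto
  obtain f where f: "f \<in> carrier (GL W)" "g = pgl_class W f" by (rule PGL_cases[OF g])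
  have g_eq: "g = pgl_class W \<gamma>" if "\<gamma> \<in> g" for \<gamma>
    using pgl_class_rep[OF f(1)] f(2) that by simp
  have cF: "condition_F_quot W (C ! i) (C ! Suc i) D (l (C ! i)) S \<longleftrightarrow>
      (\<exists>c. c \<noteq> 0 \<and> (\<forall>v\<in>D. lv l (C ! i) (S v) = c * lv l (C ! i) v))"
    if i: "i \<le> ?n" and "complement_in W (C ! i) (C ! Suc i) D" "S \<in> carrier (GL (on W D))" for i D S
    by (rule condition_F_quot_iff[OF dec(2)[OF i] dec(3)[OF i] dec(1)[OF i] that(2) d(2)[OF dec(4)[OF i]] ker[OF i] that(3)])
  have ker0: "lv l (C ! i) v = 0" if i: "i \<le> ?n" and v: "v \<in> C ! Suc i" for i v
    using ker[OF i] v dec(1)[OF i] by blast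
  have SC: "S v \<in> D" if "complement_in W A N D" "S \<in> carrier (GL (on W D))" "v \<in> D" for A N D S v
  proof -
    have "lin_subspace W D" using that(1) by (simp add: complement_in_def)
    then show ?thesis using vsp.GL_D(2)[OF vsp_on that(2)] that(3) by simp
  qed
  have "B_act W x g = x \<longleftrightarrow>
        (\<exists>\<gamma>\<in>g. \<exists>V' S. \<forall>i\<le>?n.
          complement_in W (C ! i) (C ! Suc i) (V' i) \<and>
          S i \<in> carrier (GL (on W (V' i))) \<and>
          (\<forall>v\<in>V' i. \<gamma> v \<ominus> S i v \<in> C ! Suc i) \<and>
          condition_F_quot W (C ! i) (C ! Suc i) (V' i) (l (C ! i)) (S i))" (is "?L \<longleftrightarrow> ?R")
  proof
    assume ?L
    then have eig: "\<exists>c. c \<noteq> 0 \<and> (\<forall>w\<in>U. lv l (f ` U) (f w) = c * lv l U w)" if "U \<in> NS" for U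
      using B_act_fixed_iff[OF f(1) r(1)] r(2) f(2) that by simp
    have im: "f ` (C ! i) = C ! i" if "i \<le> Suc ?n" for i
      using that
    proof (induction i)
      case 0
      then show ?case using C(1) GL_D(3)[OF f(1)] by simp
    next
      case (Suc i)
      then have i: "i \<le> ?n" and eq: "f ` (C ! i) = C ! i" by auto
      obtain c where c: "\<And>w. w \<in> C ! i \<Longrightarrow> lv l (C ! i) (f w) = c * lv l (C ! i) w"
        using eig[OF dec(4)[OF i]] unfolding eq by blast
      have "f v \<in> C ! Suc i" if v: "v \<in> C ! Suc i" for v
      proof -
        have vi: "v \<in> C ! i" "f v \<in> C ! i" using v dec(1)[OF i] eq by auto
        then show ?thesis using ker[OF i vi(2)] c[OF vi(1)] ker0[OF i v] by simp
      qed
      then show ?case by (rule GL_stable_subspace(1)[OF dec(3)[OF i] f(1)])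
    qed
    have "\<exists>D S. complement_in W (C ! i) (C ! Suc i) D \<and> S \<in> carrier (GL (on W D)) \<and>
        (\<forall>v\<in>D. f v \<ominus> S v \<in> C ! Suc i) \<and> condition_F_quot W (C ! i) (C ! Suc i) D (l (C ! i)) S"
      if i: "i \<le> ?n" for i
    proof -
      have fs: "\<And>v. v \<in> C ! i \<Longrightarrow> f v \<in> C ! i" "\<And>v. v \<in> C ! Suc i \<Longrightarrow> f v \<in> C ! Suc i"
        using im[of i] im[of "Suc i"] i by auto
      have le: "C ! Suc i \<subseteq> C ! i" using dec(1)[OF i] by blast
      obtain D where D: "complement_in W (C ! i) (C ! Suc i) D"
        using exists_complement[OF fin dec(2)[OF i] dec(3)[OF i] le] by blast
      obtain S where S: "S \<in> carrier (GL (on W D))" "\<And>v. v \<in> D \<Longrightarrow> f v \<ominus> S v \<in> C ! Suc i"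
        using GL_block[OF dec(2)[OF i] dec(3)[OF i] le D f(1) fs] by metis
      obtain c where c: "c \<noteq> 0" "\<And>w. w \<in> C ! i \<Longrightarrow> lv l (C ! i) (f w) = c * lv l (C ! i) w"
        using eig[OF dec(4)[OF i]] im[of i] i by auto
      have "lv l (C ! i) (S v) = c * lv l (C ! i) v" if "v \<in> D" for v
        using block_eigenform(3)[OF dec(2)[OF i] dec(3)[OF i] le D d(4)[OF dec(4)[OF i]] ker0[OF i] f(1) fs(2)
            SC[OF D S(1)] S(2) c(2) that] .
      then show ?thesis using cF[OF i D S(1)] c(1) D S by blast
    qed
    then have "\<forall>i\<in>{..?n}. \<exists>D S. complement_in W (C ! i) (C ! Suc i) D \<and> S \<in> carrier (GL (on W D)) \<and>
        (\<forall>v\<in>D. f v \<ominus> S v \<in> C ! Suc i) \<and> condition_F_quot W (C ! i) (C ! Suc i) D (l (C ! i)) S"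
      by blast
    then obtain D S where "\<forall>i\<in>{..?n}. complement_in W (C ! i) (C ! Suc i) (D i) \<and> S i \<in> carrier (GL (on W (D i))) \<and>
        (\<forall>v\<in>D i. f v \<ominus> S i v \<in> C ! Suc i) \<and> condition_F_quot W (C ! i) (C ! Suc i) (D i) (l (C ! i)) (S i)"
      unfolding bchoice_iff by (elim exE)
    then show ?R using pgl_class_self[OF f(1)] f(2) by (intro bexI[of _ f] exI[of _ D] exI[of _ S]) auto
  next
    assume ?R
    then obtain \<gamma> D S where \<gamma>: "\<gamma> \<in> g"
      and all: "\<forall>i\<le>?n. complement_in W (C ! i) (C ! Suc i) (D i) \<and> S i \<in> carrier (GL (on W (D i))) \<and>
        (\<forall>v\<in>D i. \<gamma> v \<ominus> S i v \<in> C ! Suc i) \<and> condition_F_quot W (C ! i) (C ! Suc i) (D i) (l (C ! i)) (S i)"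
      by (elim bexE exE)
    have D: "complement_in W (C ! i) (C ! Suc i) (D i)" and S: "S i \<in> carrier (GL (on W (D i)))"
      and b: "\<And>v. v \<in> D i \<Longrightarrow> \<gamma> v \<ominus> S i v \<in> C ! Suc i"
      and F: "condition_F_quot W (C ! i) (C ! Suc i) (D i) (l (C ! i)) (S i)" if "i \<le> ?n" for i
      using all that by auto
    have G: "\<gamma> \<in> carrier (GL W)" using pgl_class_GL[OF f(1)] \<gamma> f(2) by simp
    have le: "C ! Suc i \<subseteq> C ! i" if "i \<le> ?n" for i using dec(1)[OF that] by blast
    have st: "\<forall>v\<in>C ! i. \<gamma> v \<in> C ! i" if "i \<le> Suc ?n" for i
      using that
    proof (induction i rule: inc_induct)
      case base
      then show ?case using C(2) GL_nonzero[OF G, of \<zero>] by simp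
    next
      case (step i)
      then have i: "i \<le> ?n" by simp
      have st: "\<And>v. v \<in> C ! Suc i \<Longrightarrow> \<gamma> v \<in> C ! Suc i" using step.IH by blast
      show ?case
        using block_eigenform(1)[OF dec(2)[OF i] dec(3)[OF i] le[OF i] D[OF i] d(4)[OF dec(4)[OF i]] ker0[OF i] G st
            SC[OF D[OF i] S[OF i]] b[OF i]] by blast
    qed
    have eig: "\<exists>c. c \<noteq> 0 \<and> (\<forall>v\<in>C ! i. lv l (C ! i) (\<gamma> v) = c * lv l (C ! i) v)" if i: "i \<le> ?n" for i
    proof -
      have st': "\<And>v. v \<in> C ! Suc i \<Longrightarrow> \<gamma> v \<in> C ! Suc i" using st[of "Suc i"] i by simp
      obtain c where c: "c \<noteq> 0" "\<And>v. v \<in> D i \<Longrightarrow> lv l (C ! i) (S i v) = c * lv l (C ! i) v"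
        using F[OF i] cF[OF i D[OF i] S[OF i]] by blast
      have "lv l (C ! i) (\<gamma> v) = c * lv l (C ! i) v" if "v \<in> C ! i" for v
        by (rule block_eigenform(2)[OF dec(2)[OF i] dec(3)[OF i] le[OF i] D[OF i] d(4)[OF dec(4)[OF i]] ker0[OF i] G st'
            SC[OF D[OF i] S[OF i]] b[OF i] c(2) that])
      then show ?thesis using c(1) by blast
    qed
    \<comment> \<open>The forms on \<open>U\<close> and on its image are compared with the form on
      the last term containing \<open>U\<close>. A vector \<open>u\<close> of \<open>U\<close>
      outside the next term shows that both ratios are nonzero.\<close>
    have "\<exists>c. c \<noteq> 0 \<and> (\<forall>w\<in>U. lv l (\<gamma> ` U) (\<gamma> w) = c * lv l U w)" if U: "U \<in> NS" for U
    proof -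
      obtain i where i: "i \<le> ?n" "U \<subseteq> C ! i" "\<not> U \<subseteq> C ! Suc i" using C(8)[OF U] by blast
      obtain u where u: "u \<in> U" "u \<notin> C ! Suc i" using i(3) by blast
      then have u0: "lv l (C ! i) u \<noteq> 0" using ker[OF i(1)] i(2) by blast
      obtain c where c: "c \<noteq> 0" "\<And>w. w \<in> C ! i \<Longrightarrow> lv l (C ! i) (\<gamma> w) = c * lv l (C ! i) w" using eig[OF i(1)] by blast
      have c0: "lv l (C ! i) (\<gamma> u) \<noteq> 0" using c(1) c(2)[of u] u0 u(1) i(2) by auto
      have sub: "\<gamma> ` U \<subseteq> C ! i" using st[of i] i(1,2) by auto
      obtain a where a: "a \<noteq> 0" "\<And>w. w \<in> U \<Longrightarrow> lv l (C ! i) w = a * lv l U w"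
        using B_ratio_nonzero[OF r(1) dec(4)[OF i(1)] U i(2) u(1) u0] by blast
      obtain b where b: "b \<noteq> 0" "\<And>w. w \<in> \<gamma> ` U \<Longrightarrow> lv l (C ! i) w = b * lv l (\<gamma> ` U) w"
        using B_ratio_nonzero[OF r(1) dec(4)[OF i(1)] GL_image_NS[OF G U] sub imageI[OF u(1)] c0] by blast
      have "lv l (\<gamma> ` U) (\<gamma> w) = (c * a / b) * lv l U w" if w: "w \<in> U" for w
      proof -
        have "b * lv l (\<gamma> ` U) (\<gamma> w) = c * (a * lv l U w)"
          using b(2)[OF imageI[OF w]] c(2)[of w] a(2)[OF w] w i(2) by auto
        then show ?thesis using b(1) by (simp add: field_simps)
      qed
      then show ?thesis using a(1) b(1) c(1) by (intro exI[of _ "c * a / b"]) simp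
    qed
    then show ?L using B_act_fixed_iff[OF G r(1)] r(2) g_eq[OF \<gamma>] by simp
  qed
  moreover have "pgl_semisimple (on W D) (pgl_class (on W D) S)"
    if i: "i \<le> ?n" and "complement_in W (C ! i) (C ! Suc i) D" "S \<in> carrier (GL (on W D))"
      "condition_F_quot W (C ! i) (C ! Suc i) D (l (C ! i)) S" for i D S
    by (rule condition_F_quot_semisimple[OF dec(2)[OF i] dec(3)[OF i] dec(1)[OF i] that(2) d(2)[OF dec(4)[OF i]] ker[OF i] that(3,4)])
  ultimately show ?thesis unfolding Let_def C_def by blast
qed

end

theorem theorem4p1:
  fixes V :: "('k :: {field, finite}, 'v) module"
  assumes "vectorspace (class_ring :: 'k ring) V"
    and "vectorspace.fin_dim (class_ring :: 'k ring) V"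
    and "vectorspace.dim (class_ring :: 'k ring) V \<ge> 2"
    and "g \<in> carrier (PGL V)"
  shows "(\<forall>V' x l. lin_subspace V V' \<and> V' \<subset> carrier V \<and> x \<in> P_stratum V V' \<and> l \<in> x \<longrightarrow>
      (P_act V x g = x \<longleftrightarrow>
        (\<exists>\<gamma>\<in>g. \<exists>V''. complement_in V (carrier V) V' V'' \<and>
          (\<exists>S\<in>carrier (GL (on V V'')).
            (\<forall>v\<in>V'. \<gamma> v \<in> V') \<and> (\<forall>v\<in>V''. \<gamma> v \<ominus>\<^bsub>V\<^esub> S v \<in> V') \<and>
            condition_F_quot V (carrier V) V' V'' l S))) \<and>
      (\<forall>V''. complement_in V (carrier V) V' V'' \<longrightarrow>
        (\<forall>S\<in>carrier (GL (on V V'')). condition_F_quot V (carrier V) V' V'' l S \<longrightarrow>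
          pgl_semisimple (on V V'') (pgl_class (on V V'') S)))) \<and>
    (\<forall>V' x r. lin_subspace V V' \<and> V' \<noteq> {\<zero>\<^bsub>V\<^esub>} \<and> x \<in> Q_stratum V V' \<and> r \<in> x \<longrightarrow>
      (let l' = reciprocal_form V V' r in
      (Q_act V x g = x \<longleftrightarrow>
        (\<exists>\<gamma>\<in>g. \<exists>V''. complement_in V (carrier V) V' V'' \<and>
          (\<exists>S\<in>carrier (GL (on V V')).
            (\<forall>v\<in>V'. \<gamma> v = S v) \<and>
            condition_F (on V V') l' (pgl_class (on V V') S)))) \<and>
      (\<forall>S\<in>carrier (GL (on V V')). condition_F (on V V') l' (pgl_class (on V V') S) \<longrightarrow>
        pgl_semisimple (on V V') (pgl_class (on V V') S)))) \<and>
    (\<forall>Fs x l. is_flag V Fs \<and> x \<in> B_stratum V (set Fs) \<and> l \<in> x \<longrightarrow>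
      (let C = flag_chain V Fs in
      (B_act V x g = x \<longleftrightarrow>
        (\<exists>\<gamma>\<in>g. \<exists>V' S. \<forall>i\<le>length Fs.
          complement_in V (C ! i) (C ! Suc i) (V' i) \<and>
          S i \<in> carrier (GL (on V (V' i))) \<and>
          (\<forall>v\<in>V' i. \<gamma> v \<ominus>\<^bsub>V\<^esub> S i v \<in> C ! Suc i) \<and>
          condition_F_quot V (C ! i) (C ! Suc i) (V' i) (l (C ! i)) (S i))) \<and>
      (\<forall>i\<le>length Fs. \<forall>V'. complement_in V (C ! i) (C ! Suc i) V' \<longrightarrow>
        (\<forall>S\<in>carrier (GL (on V V')).
          condition_F_quot V (C ! i) (C ! Suc i) V' (l (C ! i)) S \<longrightarrow>
          pgl_semisimple (on V V') (pgl_class (on V V') S)))))"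
proof -
  have vs: "vsp V" by (rule vsp.intro) (rule assms(1))
  have f: "fvsp V"
    using vs vsp.finite_carrier_card(1)[OF vs assms(2)] by (simp add: fvsp_def fvsp_axioms_def)
  show ?thesis
    by (intro conjI; intro allI impI; elim conjE;
        (rule fvsp.P_part[OF f assms(4)] | rule fvsp.Q_part[OF f assms(4)] | rule fvsp.B_part[OF f assms(4)]);
        assumption)
qed

end
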